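(* The infinite associahedron $C$ is contractible.
   Context: **Dyadic arcs.** Let $D$ be the open disk in $\mathbb{R}^2$ with center $(0,0)$ and perimeter $1$, and let $\gamma:[0,1]\to\partial D$ be the arc-length parametrization of its boundary circle with $\gamma(0)=\gamma(1)=(\tfrac{1}{2\pi},0)$. A *dyadic arc* is a geodesic segment (chord) of $D$ joining two distinct points of $\gamma(\mathbb{Z}[1/2]\cap[0,1])$; $(x,y)$ denotes the (unoriented) dyadic arc with endpoints $\gamma(x),\gamma(y)$. Let $$A_F=\{(0,\tfrac12)\}\cup\{(\tfrac{m}{2^n},\tfrac{m+1}{2^n}) : m,n\in\mathbb{Z},\ n>1,\ 0\le m\le 2^n-1\}.$$ **$F$-triangulations and $F$-tessellations.** An *$F$-triangulation* is a set $A$ of dyadic arcs, no two of which cross inside $D$ (common endpoints are allowed), such that (1) $D$ minus the union of the arcs in $A$ is a disjoint union of open triangles; (2) for every $a\in A$, the set $A\setminus\{a\}$ no longer has this property; (3) the symmetric difference of $A$ and $A_F$ is finite. An *$F$-tessellation* is a set $B=A\setminus\{a_1,\dots,a_k\}$ with $A$ an $F$-triangulation and $a_1,\dots,a_k$ ($k\ge 0$) distinct arcs of $A$; the number $k$ depends only on $B$ and is called the *rank* of $B$. Let $\mathcal{I}$ be the set of all $F$-tessellations, partially ordered by $A<B$ iff $B\subsetneq A$. The complement $D\setminus B$ of an $F$-tessellation is a disjoint union of infinitely many open triangles and finitely many non-triangular open polygons. **Associahedra.** For a convex polygon $P$ with $n\ge 3$ vertices, a tessellation of $P$ is a (possibly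 empty) set $\alpha$ of pairwise non-crossing interior diagonals, with $\alpha<\beta$ iff $\beta\subsetneq\alpha$. Stasheff's associahedron $\mathcal{A}(P)$ is a closed $(n-3)$-ball with a cell structure having one closed cell $f_\alpha$, of dimension $n-3-|\alpha|$, for each tessellation $\alpha$, with $f_\emptyset=\mathcal{A}(P)$, and inclusions $f_\alpha\subset f_\beta$ for $\alpha<\beta$, defined inductively. $\mathcal{A}(\text{triangle})$ is a point; $\mathcal{A}(\text{square})$ is a closed segment whose two endpoints are the cells of the two diagonals. For $n\ge5$ and $\alpha\ne\emptyset$, $f_\alpha=\prod_Q\mathcal{A}(Q)$ over the polygons $Q$ obtained by cutting $P$ along $\alpha$; if $\emptyset\neq\beta=\alpha\setminus\{d\}$ and $Q_1,Q_2$ are the two polygons adjacent to $d$, the inclusion $f_\alpha\to f_\beta$ is the inclusion $\mathcal{A}(Q_1)\times\mathcal{A}(Q_2)=f_{\{d\}}\subset\mathcal{A}(Q_1\cup Q_2)$ times the identity on the other factors, and general inclusions are compositions of these. The boundary $\partial\mathcal{A}(P)$ is the union of all $f_\alpha$, $\alpha\neq\emptyset$, glued along these inclusions (it is homeomorphic to $S^{n-4}$), and $\mathcal{A}(P)$ is obtained by filling it with an $(n-3)$-ball. **The infinite associahedron $C$.** To $A\in\mathcal{I}$ of rank $k$ associate the closed $k$-cell $f_A=\prod_Q\mathcal{A}(Q)$ over the non-triangular polygons $Q$ of $D\setminus A$ (a point if $k=0$). If $A<B$, then $A$ restricts to a tessellation $\alpha_Q$ of each non-triangular polygon $Q$ of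 $D\setminus B$, and the inclusions $f_{\alpha_Q}\subset\mathcal{A}(Q)$ give an injection $\iota_{BA}:f_A\cong\prod_Q f_{\alpha_Q}\to\prod_Q\mathcal{A}(Q)=f_B$. Then $$C=\Big(\bigsqcup_{A\in\mathcal{I}}f_A\Big)/\sim,$$ where $\sim$ is generated by $x\sim\iota_{BA}(x)$ for $A<B$, $x\in f_A$, with the CW topology. Thus $C$ is a regular CW complex with one closed cell $f_A$, of dimension $\mathrm{rank}(A)$, for each $A\in\mathcal{I}$; and $f_A\subseteq f_B$ iff $B\subseteq A$. *)

theory Defs
  imports "HOL-Analysis.Analysis"
begin

section \<open>Gluing a family of spaces\<close>

definition quotient_topology :: "'a topology \<Rightarrow> ('a \<times> 'a) set \<Rightarrow> 'a set topology" where
  "quotient_topology X r =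
     topology (\<lambda>U. U \<subseteq> topspace X // r \<and> openin X {x \<in> topspace X. r `` {x} \<in> U})"

lemma openin_quotient_topology:
  "openin (quotient_topology X r) U \<longleftrightarrow>
     U \<subseteq> topspace X // r \<and> openin X {x \<in> topspace X. r `` {x} \<in> U}"
proof -
  have "istopology (\<lambda>U. U \<subseteq> topspace X // r \<and> openin X {x \<in> topspace X. r `` {x} \<in> U})"
    unfolding istopology_def
  proof (intro conjI allI impI)
    fix S T
    assume S: "S \<subseteq> topspace X // r \<and> openin X {x \<in> topspace X. r `` {x} \<in> S}"
      and T: "T \<subseteq> topspace X // r \<and> openin X {x \<in> topspace X. r `` {x} \<in> T}"
    show "S \<inter> T \<subseteq> topspace X // r" using S by blast
    have "{x \<in> topspace X. r `` {x} \<in> S \<inter> T} =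
            {x \<in> topspace X. r `` {x} \<in> S} \<inter> {x \<in> topspace X. r `` {x} \<in> T}" by blast
    with S T show "openin X {x \<in> topspace X. r `` {x} \<in> S \<inter> T}" by (simp add: openin_Int)
  next
    fix K
    assume K: "\<forall>k\<in>K. k \<subseteq> topspace X // r \<and> openin X {x \<in> topspace X. r `` {x} \<in> k}"
    show "\<Union>K \<subseteq> topspace X // r" using K by blast
    have "{x \<in> topspace X. r `` {x} \<in> \<Union>K} =
            (\<Union>k\<in>K. {x \<in> topspace X. r `` {x} \<in> k})" by blast
    with K show "openin X {x \<in> topspace X. r `` {x} \<in> \<Union>K}" by auto
  qed
  then show ?thesis by (simp add: quotient_topology_def)
qed

lemma topspace_quotient_topology: "topspace (quotient_topology X r) = topspace X // r"
proof -
  have "{x \<in> topspace X. r `` {x} \<in> topspace X // r} = topspace X"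
    by (auto intro: quotientI)
  then have "openin (quotient_topology X r) (topspace X // r)"
    by (simp add: openin_quotient_topology)
  then show ?thesis
    by (metis openin_quotient_topology openin_subset openin_topspace subset_antisym)
qed

definition glue_rel ::
    "('i \<Rightarrow> 'b topology) \<Rightarrow> 'i set \<Rightarrow> (('i \<times> 'b) \<times> ('i \<times> 'b)) set \<Rightarrow> (('i \<times> 'b) \<times> ('i \<times> 'b)) set"
  where
  "glue_rel F I R =
     {(p, q). p \<in> topspace (sum_topology F I) \<and> q \<in> topspace (sum_topology F I) \<and>
              equivclp (\<lambda>u v. (u, v) \<in> R) p q}"

definition glue ::
    "('i \<Rightarrow> 'b topology) \<Rightarrow> 'i set \<Rightarrow> (('i \<times> 'b) \<times> ('i \<times> 'b)) set \<Rightarrow> ('i \<times> 'b) set topology"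
  where
  "glue F I R = quotient_topology (sum_topology F I) (glue_rel F I R)"


section \<open>Convex polygons and their tessellations\<close>

text \<open>The plane is \<^typ>\<open>complex\<close>, and arcs and diagonals are closed segments, as sets of points.
  For an open convex region \<open>U\<close> (the disk or the interior of a polygon) and a set \<open>\<alpha>\<close> of arcs,
  \<open>pieces U \<alpha>\<close> consists of the closures of the components of the complement of \<open>\<alpha>\<close>, so that
  every piece is a closed polygon.\<close>

definition pieces :: "complex set \<Rightarrow> complex set set \<Rightarrow> complex set set" where
  "pieces U \<alpha> = closure ` components (U - \<Union>\<alpha>)"

definition noncrossing :: "complex set \<Rightarrow> complex set set \<Rightarrow> bool" where
  "noncrossing U \<alpha> \<longleftrightarrow> pairwise (\<lambda>a b. a \<inter> b \<inter> U = {}) \<alpha>"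

definition polygon :: "complex set \<Rightarrow> bool" where
  "polygon P \<longleftrightarrow> polytope P \<and> interior P \<noteq> {}"

definition polygon_vertices :: "complex set \<Rightarrow> complex set" where
  "polygon_vertices P = {v. v extreme_point_of P}"

definition triangle :: "complex set \<Rightarrow> bool" where
  "triangle P \<longleftrightarrow> polygon P \<and> card (polygon_vertices P) = 3"

definition diagonals :: "complex set \<Rightarrow> complex set set" where
  "diagonals P = {closed_segment v w | v w.
     v \<in> polygon_vertices P \<and> w \<in> polygon_vertices P \<and> v \<noteq> w \<and> open_segment v w \<subseteq> interior P}"

definition tessellation :: "complex set \<Rightarrow> complex set set \<Rightarrow> bool" where
  "tessellation P \<alpha> \<longleftrightarrow> \<alpha> \<subseteq> diagonals P \<and> noncrossing (interior P) \<alpha>"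

definition arcs_through :: "complex set set \<Rightarrow> complex set \<Rightarrow> complex set set" where
  "arcs_through \<alpha> Q = {a \<in> \<alpha>. a \<inter> interior Q \<noteq> {}}"


section \<open>Stasheff's associahedra\<close>

text \<open>Filling a sphere by a ball leaves a choice of homeomorphism, so the inductive definition
  determines the associahedra only up to such choices. Accordingly it is rendered as a predicate
  on a family of spaces \<open>X P\<close>, for all convex polygons \<open>P\<close>, together with the inclusions
  \<open>J P \<alpha>\<close> of the cells \<open>f\<^sub>\<alpha>\<close> (products of associahedra of the pieces) into \<open>X P\<close>.\<close>

definition face_space ::
    "(complex set \<Rightarrow> 'a topology) \<Rightarrow> complex set \<Rightarrow> complex set set \<Rightarrow> (complex set \<Rightarrow> 'a) topology"
  where
  "face_space X P \<alpha> = product_topology X (pieces (interior P) \<alpha>)"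

text \<open>The inclusion \<open>f\<^sub>\<alpha> \<rightarrow> f\<^sub>\<beta>\<close> for \<open>\<beta> = \<alpha> - {d}\<close>: the piece of \<open>\<beta>\<close> containing \<open>d\<close> is the union of
  the two pieces of \<open>\<alpha>\<close> adjacent to \<open>d\<close>, and all other factors are unchanged.\<close>

definition face_incl ::
    "(complex set \<Rightarrow> complex set set \<Rightarrow> (complex set \<Rightarrow> 'a) \<Rightarrow> 'a) \<Rightarrow>
     complex set \<Rightarrow> complex set set \<Rightarrow> complex set \<Rightarrow> (complex set \<Rightarrow> 'a) \<Rightarrow> (complex set \<Rightarrow> 'a)"
  where
  "face_incl J P \<alpha> d x =
     (\<lambda>Q \<in> pieces (interior P) (\<alpha> - {d}).
        if d \<inter> interior Q \<noteq> {} then J Q {d} (restrict x (pieces (interior Q) {d})) else x Q)"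

definition boundary_faces :: "complex set \<Rightarrow> complex set set set" where
  "boundary_faces P = {\<alpha>. tessellation P \<alpha> \<and> \<alpha> \<noteq> {}}"

definition boundary_incls ::
    "(complex set \<Rightarrow> 'a topology) \<Rightarrow>
     (complex set \<Rightarrow> complex set set \<Rightarrow> (complex set \<Rightarrow> 'a) \<Rightarrow> 'a) \<Rightarrow> complex set \<Rightarrow>
     ((complex set set \<times> (complex set \<Rightarrow> 'a)) \<times> (complex set set \<times> (complex set \<Rightarrow> 'a))) set"
  where
  "boundary_incls X J P =
     {((\<alpha>, x), (\<alpha> - {d}, face_incl J P \<alpha> d x)) | \<alpha> d x.
        \<alpha> \<in> boundary_faces P \<and> d \<in> \<alpha> \<and> \<alpha> - {d} \<noteq> {} \<and> x \<in> topspace (face_space X P \<alpha>)}"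

definition unit_ball :: "nat \<Rightarrow> (nat \<Rightarrow> real) topology" where
  "unit_ball k = subtopology (Euclidean_space k) {x. (\<Sum>i<k. (x i)\<^sup>2) \<le> 1}"

definition unit_ball_boundary :: "nat \<Rightarrow> (nat \<Rightarrow> real) set" where
  "unit_ball_boundary k = {x \<in> topspace (Euclidean_space k). (\<Sum>i<k. (x i)\<^sup>2) = 1}"

text \<open>For an \<open>n\<close>-gon \<open>P\<close>, the space \<open>X P\<close> is an \<open>(n-3)\<close>-ball whose boundary sphere is identified,
  by \<open>g\<close>, with the union of the cells \<open>f\<^sub>\<alpha>\<close>, \<open>\<alpha> \<noteq> {}\<close>, glued along their inclusions. That \<open>g\<close> is
  well defined on the glued space makes the maps \<open>J P \<alpha>\<close> compatible with \<open>face_incl\<close>.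
  The only piece for \<open>\<alpha> = {}\<close> is \<open>P\<close> itself, and \<open>f\<^sub>\<emptyset> = X P\<close>. A triangle has no diagonals and
  \<open>unit_ball 0\<close> is a point with empty boundary; \<open>unit_ball 1\<close> is a segment.\<close>

definition stasheff_associahedra ::
    "(complex set \<Rightarrow> 'a topology) \<Rightarrow>
     (complex set \<Rightarrow> complex set set \<Rightarrow> (complex set \<Rightarrow> 'a) \<Rightarrow> 'a) \<Rightarrow> bool"
  where
  "stasheff_associahedra X J \<longleftrightarrow>
     (\<forall>P. polygon P \<longrightarrow>
        (\<forall>x \<in> topspace (face_space X P {}). J P {} x = x P) \<and>
        (\<forall>\<alpha>. tessellation P \<alpha> \<longrightarrow> embedding_map (face_space X P \<alpha>) (X P) (J P \<alpha>)) \<and>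
        (let k = card (polygon_vertices P) - 3;
             R = boundary_incls X J P;
             bd = glue (face_space X P) (boundary_faces P) R
         in \<exists>h g. homeomorphic_map (unit_ball k) (X P) h \<and>
                  embedding_map bd (X P) g \<and>
                  g ` topspace bd = h ` unit_ball_boundary k \<and>
                  (\<forall>\<alpha> \<in> boundary_faces P. \<forall>x \<in> topspace (face_space X P \<alpha>).
                     g (glue_rel (face_space X P) (boundary_faces P) R `` {(\<alpha>, x)}) = J P \<alpha> x)))"


section \<open>F-triangulations and F-tessellations\<close>

definition disk :: "complex set" where
  "disk = ball 0 (1 / (2 * pi))"

definition circle_param :: "real \<Rightarrow> complex" where
  "circle_param t = complex_of_real (1 / (2 * pi)) * cis (2 * pi * t)"

definition dyadics :: "real set" where
  "dyadics = {real_of_int m / 2 ^ n | m n. True} \<inter> {0..1}"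

definition chord :: "real \<Rightarrow> real \<Rightarrow> complex set" where
  "chord x y = closed_segment (circle_param x) (circle_param y)"

definition dyadic_arcs :: "complex set set" where
  "dyadic_arcs = {chord x y | x y.
     x \<in> dyadics \<and> y \<in> dyadics \<and> circle_param x \<noteq> circle_param y}"

definition A_F :: "complex set set" where
  "A_F = insert (chord 0 (1/2))
     {chord (real m / 2 ^ n) (real (m + 1) / 2 ^ n) | m n. n > 1 \<and> m < 2 ^ n}"

definition open_triangle :: "complex set \<Rightarrow> bool" where
  "open_triangle T \<longleftrightarrow>
     (\<exists>a b c. \<not> collinear {a, b, c} \<and> T = interior (convex hull {a, b, c}))"

definition triangulates_disk :: "complex set set \<Rightarrow> bool" where
  "triangulates_disk A \<longleftrightarrow>
     (\<exists>\<T>. pairwise disjnt \<T> \<and> (\<forall>T \<in> \<T>. open_triangle T) \<and> disk - \<Union>A = \<Union>\<T>)"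

definition F_triangulation :: "complex set set \<Rightarrow> bool" where
  "F_triangulation A \<longleftrightarrow>
     A \<subseteq> dyadic_arcs \<and> noncrossing disk A \<and>
     triangulates_disk A \<and>
     (\<forall>a \<in> A. \<not> triangulates_disk (A - {a})) \<and>
     finite ((A - A_F) \<union> (A_F - A))"

definition F_tessellation :: "complex set set \<Rightarrow> bool" where
  "F_tessellation B \<longleftrightarrow> (\<exists>A S. F_triangulation A \<and> finite S \<and> S \<subseteq> A \<and> B = A - S)"


section \<open>The infinite associahedron\<close>

definition nontriangular_pieces :: "complex set set \<Rightarrow> complex set set" where
  "nontriangular_pieces A = {Q \<in> pieces disk A. \<not> triangle Q}"

definition cell ::
    "(complex set \<Rightarrow> 'a topology) \<Rightarrow> complex set set \<Rightarrow> (complex set \<Rightarrow> 'a) topology" where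
  "cell X A = product_topology X (nontriangular_pieces A)"

text \<open>For \<open>B \<subset> A\<close>, the map \<open>\<iota>\<^sub>B\<^sub>A\<close> from \<open>cell X A\<close> to \<open>cell X B\<close>. A point of \<open>cell X A\<close> has no
  coordinates at triangles, whereas \<open>J\<close> takes a point of the product over all pieces of \<open>Q\<close>;
  the missing coordinate is the only point of \<open>X R\<close>.\<close>

definition cell_incl ::
    "(complex set \<Rightarrow> 'a topology) \<Rightarrow>
     (complex set \<Rightarrow> complex set set \<Rightarrow> (complex set \<Rightarrow> 'a) \<Rightarrow> 'a) \<Rightarrow>
     complex set set \<Rightarrow> complex set set \<Rightarrow> (complex set \<Rightarrow> 'a) \<Rightarrow> (complex set \<Rightarrow> 'a)"
  where
  "cell_incl X J A B x =
     (\<lambda>Q \<in> nontriangular_pieces B.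
        J Q (arcs_through A Q)
          (\<lambda>R \<in> pieces (interior Q) (arcs_through A Q).
             if triangle R then (THE y. y \<in> topspace (X R)) else x R))"

definition infinite_associahedron ::
    "(complex set \<Rightarrow> 'a topology) \<Rightarrow>
     (complex set \<Rightarrow> complex set set \<Rightarrow> (complex set \<Rightarrow> 'a) \<Rightarrow> 'a) \<Rightarrow>
     (complex set set \<times> (complex set \<Rightarrow> 'a)) set topology"
  where
  "infinite_associahedron X J =
     glue (cell X) {A. F_tessellation A}
       {((A, x), (B, cell_incl X J A B x)) | A B x.
          F_tessellation A \<and> F_tessellation B \<and> B \<subset> A \<and> x \<in> topspace (cell X A)}"

end

theory Submission
  imports Defs
begin

text \<open>
  Removing arcs makes a cell larger, and two \<open>F\<close>-tessellations differ by finitely many arcs, so the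
  intersection of finitely many \<open>F\<close>-tessellations is again one: any finitely many cells lie in a common
  closed cell. There are only countably many \<open>F\<close>-tessellations, because each is a finite modification of
  \<open>A_F\<close>. Intersecting them one after the other gives a sequence \<open>B\<^sub>0 \<supseteq> B\<^sub>1 \<supseteq> \<dots>\<close> whose closed cells
  increase and exhaust the complex (\<open>F_tessellation_sequence\<close>).

  Every closed cell is a product of balls, hence compact, Hausdorff and an absolute extensor: maps into
  it extend from closed subsets of compact Hausdorff spaces, by Tietze's theorem followed by radial
  retraction. This gives contractions of the cells that extend each other. If \<open>G\<close> contracts the cell
  \<open>Z\<close> to \<open>p\<close> inside \<open>Z\<close>, and \<open>Z\<close> is embedded in the next cell \<open>Y\<close>, then the identity of \<open>Y\<close> at
  time \<open>0\<close>, the constant \<open>p\<close> at time \<open>1\<close> and \<open>G\<close> on \<open>[0,1] \<times> Z\<close> fit together on a closed subset of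
  \<open>[0,1] \<times> Y\<close>, and any extension to \<open>[0,1] \<times> Y\<close> contracts \<open>Y\<close> (\<open>extend_contraction\<close>). The union of
  these contractions is continuous on \<open>[0,1] \<times> C\<close>, because a quotient map times the identity of a
  compact interval is again a quotient map (\<open>contractible_glue\<close>).

  For this the inclusions between cells have to be continuous, injective and functorial.
  Functoriality reduces to one polygon: the inclusion of a face \<open>f\<^sub>\<alpha>\<close> of the associahedron of \<open>P\<close>
  factors through \<open>f\<^sub>\<beta>\<close> for every \<open>\<beta> \<subseteq> \<alpha>\<close>. Gluing the boundary of the associahedron states this when
  \<open>\<alpha>\<close> has one diagonal more than \<open>\<beta>\<close>, and induction on \<open>card (\<alpha> - \<beta>)\<close> gives the rest
  (\<open>J_refine\<close>). The planar geometry behind it is that a component of a convex region minus chords is the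
  intersection of the region with open half-planes (\<open>component_halfplanes\<close>), hence convex, so that it
  is recovered as the interior of its closure and cutting in two stages agrees with cutting at once
  (\<open>pieces_arcs_through\<close>).

  Two facts about the disk remain. The complex is not empty, because \<open>A_F\<close> is itself an
  \<open>F\<close>-triangulation (\<open>F_triangulation_A_F\<close>): its complementary triangles have as vertices the ends and
  the midpoint of a standard dyadic interval. And the pieces of an \<open>F\<close>-tessellation are polygons
  (\<open>disk_tessellation_F\<close>): the arcs of \<open>A_F\<close> accumulate only at the circle, so that components are open,
  and each arc removed from an \<open>F\<close>-triangulation merges finitely many polytopes into a convex set.
\<close>

section \<open>Spaces into which maps extend\<close>

text \<open>The conclusion of Tietze's theorem for maps from \<open>Z\<close> to \<open>Y\<close>. The domain is a parameter, because a
  single formula cannot quantify over the types of all normal spaces.\<close>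

definition extends_into :: "'a topology \<Rightarrow> 'b topology \<Rightarrow> bool" where
  "extends_into Z Y \<longleftrightarrow>
     (\<forall>S f. closedin Z S \<and> continuous_map (subtopology Z S) Y f \<longrightarrow>
        (\<exists>g. continuous_map Z Y g \<and> (\<forall>x\<in>S. g x = f x)))"

lemma extends_intoE:
  assumes "extends_into Z Y" "closedin Z S" "continuous_map (subtopology Z S) Y f"
  obtains g where "continuous_map Z Y g" "\<And>x. x \<in> S \<Longrightarrow> g x = f x"
  using assms unfolding extends_into_def by blast

lemma extends_into_homeomorphic:
  assumes "extends_into Z Y" "homeomorphic_map Y Y' h"
  shows "extends_into Z Y'"
proof -
  obtain k where hk: "homeomorphic_maps Y Y' h k"
    using assms(2) homeomorphic_map_maps by blast
  then have ch: "continuous_map Y Y' h" and ck: "continuous_map Y' Y k"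
    and hk': "\<And>y. y \<in> topspace Y' \<Longrightarrow> h (k y) = y"
    by (auto simp: homeomorphic_maps_def)
  show ?thesis
    unfolding extends_into_def
  proof (intro allI impI)
    fix S f assume a: "closedin Z S \<and> continuous_map (subtopology Z S) Y' f"
    then have "continuous_map (subtopology Z S) Y (k \<circ> f)"
      using ck continuous_map_compose by blast
    with a assms(1) obtain g where g: "continuous_map Z Y g" "\<And>x. x \<in> S \<Longrightarrow> g x = (k \<circ> f) x"
      by (metis extends_intoE)
    have "h (g x) = f x" if "x \<in> S" for x
    proof -
      have "x \<in> topspace (subtopology Z S)"
        using a that closedin_subset by fastforce
      then have "f x \<in> topspace Y'" using a by (meson continuous_map_image_subset_topspace image_subset_iff)
      then show ?thesis using g that hk' by simp
    qed
    then show "\<exists>g. continuous_map Z Y' g \<and> (\<forall>x\<in>S. g x = f x)"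
      using continuous_map_compose[OF g(1) ch] by (metis comp_apply)
  qed
qed

lemma extends_into_product:
  assumes "\<And>i. i \<in> I \<Longrightarrow> extends_into Z (Y i)"
  shows "extends_into Z (product_topology Y I)"
  unfolding extends_into_def
proof (intro allI impI)
  fix S f assume a: "closedin Z S \<and> continuous_map (subtopology Z S) (product_topology Y I) f"
  have "\<exists>g. continuous_map Z (Y i) g \<and> (\<forall>x\<in>S. g x = f x i)" if "i \<in> I" for i
  proof -
    have "continuous_map (subtopology Z S) (Y i) (\<lambda>x. f x i)"
      using a that continuous_map_componentwise by metis
    with a assms[OF that] show ?thesis by (metis extends_intoE)
  qed
  then obtain g where g: "\<And>i. i \<in> I \<Longrightarrow> continuous_map Z (Y i) (g i)"
      "\<And>i x. i \<in> I \<Longrightarrow> x \<in> S \<Longrightarrow> g i x = f x i"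
    by metis
  have ext: "f x \<in> extensional I" if "x \<in> S" for x
  proof -
    have "x \<in> topspace (subtopology Z S)"
      using a that closedin_subset by fastforce
    with a show ?thesis by (auto simp: continuous_map_componentwise)
  qed
  have "continuous_map Z (product_topology Y I) (\<lambda>x. \<lambda>i\<in>I. g i x)"
    using g by (auto simp: continuous_map_componentwise)
  moreover have "\<forall>x\<in>S. (\<lambda>i\<in>I. g i x) = f x"
    using g(2) ext by (auto intro!: extensionalityI[of _ I])
  ultimately show "\<exists>g. continuous_map Z (product_topology Y I) g \<and> (\<forall>x\<in>S. g x = f x)"
    by blast
qed

text \<open>Tietze's theorem extends the coordinates as real functions; dividing by \<open>max 1\<close> of the norm brings
  the result back into the ball and changes nothing where the map was already given.\<close>

lemma extends_into_unit_ball: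
  fixes Z :: "'a topology"
  assumes "normal_space Z"
  shows "extends_into Z (unit_ball k)"
  unfolding extends_into_def
proof (intro allI impI)
  fix S f assume a: "closedin Z S \<and> continuous_map (subtopology Z S) (unit_ball k) f"
  have S: "x \<in> topspace (subtopology Z S)" if "x \<in> S" for x
    using a that closedin_subset by fastforce
  have fx: "(\<forall>i\<ge>k. f x i = 0) \<and> (\<Sum>i<k. (f x i)\<^sup>2) \<le> 1" if "x \<in> S" for x
  proof -
    have "f x \<in> topspace (unit_ball k)"
      using a S[OF that] by (meson continuous_map_image_subset_topspace image_subset_iff)
    then show ?thesis by (simp add: unit_ball_def topspace_Euclidean_space)
  qed
  have "\<exists>g. continuous_map Z euclideanreal g \<and> (\<forall>x\<in>S. g x = f x i)" for i
  proof -
    have "continuous_map (subtopology Z S) (powertop_real UNIV) f"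
      using a by (simp add: unit_ball_def Euclidean_space_def continuous_map_in_subtopology)
    then have "continuous_map (subtopology Z S) euclideanreal (\<lambda>x. f x i)"
      by (simp add: continuous_map_componentwise_UNIV)
    then show ?thesis
      using Tietze_extension_realinterval[of Z S UNIV "\<lambda>x. f x i"] assms a
      by (metis empty_not_UNIV is_interval_univ subset_UNIV)
  qed
  then obtain G where G: "\<And>i. continuous_map Z euclideanreal (G i)"
      "\<And>i x. x \<in> S \<Longrightarrow> G i x = f x i"
    by metis
  \<comment> \<open>radial retraction of the Euclidean space onto the ball\<close>
  define N where "N x = max 1 (sqrt (\<Sum>i<k. (G i x)\<^sup>2))" for x
  define g where "g x = (\<lambda>i. if i < k then G i x / N x else 0)" for x
  have N: "N x \<ge> 1" for x by (simp add: N_def)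
  have cN: "continuous_map Z euclideanreal N"
    unfolding N_def
    by (intro continuous_map_real_max continuous_map_const[THEN iffD2] continuous_map_sqrt
         continuous_map_sum continuous_map_real_pow G) auto
  have "continuous_map Z (powertop_real UNIV) g"
    unfolding continuous_map_componentwise_UNIV
  proof
    fix i
    have "continuous_map Z euclideanreal (\<lambda>x. G i x / N x)"
      using N by (intro continuous_map_real_divide G cN) (metis not_one_le_zero)
    then show "continuous_map Z euclideanreal (\<lambda>x. g x i)"
      by (cases "i < k") (auto simp: g_def)
  qed
  moreover have "(\<Sum>i<k. (g x i)\<^sup>2) \<le> 1" for x
  proof -
    have "(\<Sum>i<k. (g x i)\<^sup>2) = (\<Sum>i<k. (G i x)\<^sup>2) / (N x)\<^sup>2"
      by (simp add: g_def power_divide sum_divide_distrib)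
    moreover have "(\<Sum>i<k. (G i x)\<^sup>2) \<le> (N x)\<^sup>2"
    proof -
      have "(\<Sum>i<k. (G i x)\<^sup>2) = (sqrt (\<Sum>i<k. (G i x)\<^sup>2))\<^sup>2"
        by (simp add: sum_nonneg)
      also have "\<dots> \<le> (N x)\<^sup>2"
        by (intro power_mono) (auto simp: N_def sum_nonneg)
      finally show ?thesis .
    qed
    ultimately show ?thesis using N[of x] by (simp add: divide_le_eq)
  qed
  ultimately have "continuous_map Z (unit_ball k) g"
    by (auto simp: unit_ball_def Euclidean_space_def continuous_map_in_subtopology g_def)
  moreover have "g x = f x" if "x \<in> S" for x
  proof -
    have "N x = 1" using fx[OF that] by (simp add: N_def G(2)[OF that])
    then show ?thesis using fx[OF that] by (auto simp: g_def G(2)[OF that])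
  qed
  ultimately show "\<exists>g. continuous_map Z (unit_ball k) g \<and> (\<forall>x\<in>S. g x = f x)"
    by blast
qed

lemma Hausdorff_unit_ball: "Hausdorff_space (unit_ball k)"
  unfolding unit_ball_def by (intro Hausdorff_space_subtopology Hausdorff_Euclidean_space)

text \<open>The ball is a closed subset of the compact cube \<open>[-1,1]\<close> to the power of the natural numbers.\<close>

lemma compact_unit_ball: "compact_space (unit_ball k)"
proof -
  let ?P = "powertop_real (UNIV::nat set)"
  let ?K = "PiE (UNIV::nat set) (\<lambda>i. {-1..1::real})"
  let ?B = "{x. \<forall>i\<ge>k. x i = 0} \<inter> {x::nat\<Rightarrow>real. (\<Sum>i<k. (x i)\<^sup>2) \<le> 1}"
  have K: "compactin ?P ?K"
    by (auto simp: compactin_PiE)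
  have c: "continuous_map ?P euclideanreal (\<lambda>x. x i)" for i
    by (rule continuous_map_product_projection) simp
  have "closedin ?P {x \<in> topspace ?P. (\<Sum>i<k. (x i)\<^sup>2) \<in> {..1}}"
    by (rule closedin_continuous_map_preimage[where Y=euclideanreal])
       (auto intro!: continuous_map_sum continuous_map_real_pow c)
  moreover have "closedin ?P {x \<in> topspace ?P. x i \<in> {0}}" for i
    by (rule closedin_continuous_map_preimage[OF c]) simp
  then have "closedin ?P (\<Inter>i\<in>{k..}. {x \<in> topspace ?P. x i \<in> {0}})"
    by (intro closedin_Inter) blast+
  moreover have "?B = (\<Inter>i\<in>{k..}. {x \<in> topspace ?P. x i \<in> {0}}) \<inter> {x \<in> topspace ?P. (\<Sum>i<k. (x i)\<^sup>2) \<in> {..1}}"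
    by auto
  ultimately have B: "closedin ?P ?B"
    by (simp add: closedin_Int)
  have "?B \<subseteq> ?K"
  proof
    fix x assume x: "x \<in> ?B"
    have "\<bar>x i\<bar> \<le> 1" for i
    proof (cases "i < k")
      case True
      then have "(x i)\<^sup>2 \<le> (\<Sum>i<k. (x i)\<^sup>2)" by (intro member_le_sum) auto
      then have "(x i)\<^sup>2 \<le> 1" using x by force
      then show ?thesis by (simp add: abs_square_le_1)
    next
      case False then show ?thesis using x by auto
    qed
    then show "x \<in> ?K" by (auto simp: abs_le_iff minus_le_iff)
  qed
  then have "compactin ?P ?B"
    using closed_compactin[OF K _ B] by blast
  then have "compact_space (subtopology ?P ?B)"
    by (simp add: compact_space_subtopology)
  then show ?thesis
    by (simp add: unit_ball_def Euclidean_space_def subtopology_subtopology)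
qed

lemma zero_in_unit_ball: "(\<lambda>i. 0) \<in> topspace (unit_ball k)"
  by (simp add: unit_ball_def topspace_Euclidean_space)

text \<open>The inductive step for contracting an increasing union. The prescribed values on the bottom, on the
  top and on \<open>[0,1] \<times> e(Z)\<close> agree on overlaps because \<open>G\<close> is a contraction of \<open>Z\<close> to \<open>p\<close>; the three
  sets are closed because \<open>e\<close> maps a compact space to a Hausdorff space. Since \<open>H\<close> restricts to \<open>G\<close>
  exactly, the contractions obtained by iteration have a union.\<close>

lemma extend_contraction:
  fixes Z Y :: "'b topology"
  assumes Z: "compact_space Z" and Y: "compact_space Y" "Hausdorff_space Y"
    and AE: "extends_into (prod_topology (top_of_set {0..1::real}) Y) Y"
    and e: "continuous_map Z Y e" "inj_on e (topspace Z)"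
    and G: "continuous_map (prod_topology (top_of_set {0..1::real}) Z) Z G"
      "\<And>z. z \<in> topspace Z \<Longrightarrow> G (0, z) = z" "\<And>z. z \<in> topspace Z \<Longrightarrow> G (1, z) = p"
    and p: "p \<in> topspace Z"
  obtains H where "continuous_map (prod_topology (top_of_set {0..1::real}) Y) Y H"
    "\<And>y. y \<in> topspace Y \<Longrightarrow> H (0, y) = y" "\<And>y. y \<in> topspace Y \<Longrightarrow> H (1, y) = e p"
    "\<And>z t. z \<in> topspace Z \<Longrightarrow> t \<in> {0..1} \<Longrightarrow> H (t, e z) = e (G (t, z))"
proof -
  let ?I = "top_of_set {0..1::real}"
  let ?W = "prod_topology ?I Y"
  have clo: "closed_map Z Y e"
    using continuous_imp_closed_map e(1) Z Y(2) by blast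
  then have emb: "embedding_map Z Y e"
    using e by (intro injective_closed_imp_embedding_map) auto
  then obtain d where d: "homeomorphic_maps Z (subtopology Y (e ` topspace Z)) e d"
    by (auto simp: embedding_map_def homeomorphic_map_maps)
  have dc: "continuous_map (subtopology Y (e ` topspace Z)) Z d"
    and de: "\<And>z. z \<in> topspace Z \<Longrightarrow> d (e z) = z"
    using d by (auto simp: homeomorphic_maps_def)
  have ce: "closedin Y (e ` topspace Z)"
    using clo by (simp add: closed_map_def)
  \<comment> \<open>bottom, top, and the cylinder over the image of \<open>Z\<close>\<close>
  define T where "T i = (if i = 0 then {0::real} \<times> topspace Y
      else if i = 1 then {1} \<times> topspace Y else {0..1::real} \<times> (e ` topspace Z))" for i::nat
  define f where "f i = (\<lambda>(t::real, y). if i = 0 then y else if i = 1 then e p else e (G (t, d y)))" for i::nat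
  define h where "h = (\<lambda>(t::real, y). if t = 0 then y else if t = 1 then e p else e (G (t, d y)))"
  let ?T = "\<Union>(T ` {0, 1, 2})"
  have cT: "closedin ?W (T i)" for i
    unfolding T_def using ce by (auto simp: closedin_prod_Times_iff closedin_closed_eq)
  have cUT: "closedin ?W ?T" by (intro closedin_Union) (use cT in auto)
  have ep: "e p \<in> topspace Y" using e(1) p by (meson continuous_map_image_subset_topspace image_subset_iff)
  have cf: "continuous_map (subtopology (subtopology ?W ?T) (T i)) Y (f i)" if i: "i \<in> {0,1,2}" for i
  proof -
    have "continuous_map (subtopology ?W (T i)) Y (f i)"
    proof -
      consider "i = 0" | "i = 1" | "i = 2" using i by blast
      then show ?thesis
      proof cases
        case 1
        have "f i = snd" using 1 by (auto simp: f_def)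
        then show ?thesis by (simp add: continuous_map_from_subtopology continuous_map_snd)
      next
        case 2
        have "f i = (\<lambda>_. e p)" using 2 by (auto simp: f_def)
        then show ?thesis using ep by simp
      next
        case 3
        have s: "subtopology ?W (T i) = prod_topology ?I (subtopology Y (e ` topspace Z))"
          using 3 by (simp add: T_def subtopology_Times subtopology_subtopology)
        have "f i = e \<circ> G \<circ> (\<lambda>(t, y). (t, d y))" using 3 by (auto simp: f_def)
        moreover have "continuous_map (prod_topology ?I (subtopology Y (e ` topspace Z))) (prod_topology ?I Z) (\<lambda>(t, y). (t, d y))"
          using dc by (simp add: continuous_map_prod_top)
        ultimately show ?thesis unfolding s
          using continuous_map_compose[OF continuous_map_compose[OF _ G(1)] e(1)] by (simp only: comp_assoc)
      qed
    qed
    moreover have "T i \<subseteq> ?T" using i by auto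
    ultimately show ?thesis by (simp add: subtopology_subtopology Int_absorb1)
  qed
  have ft: "f i x = h x" if "i \<in> {0,1,2}" "x \<in> T i" for i x
    using that G de by (auto simp: f_def h_def T_def split: if_splits)
  have "continuous_map (subtopology ?W ?T) Y h"
  proof (rule pasting_lemma_closed[where I = "{0,1,2::nat}" and T = T and f = f])
    show "closedin (subtopology ?W ?T) (T i)" if "i \<in> {0,1,2}" for i
      using cT that by (intro closedin_subset_topspace) auto
    show "f i x = f j x" if "i \<in> {0,1,2}" "j \<in> {0,1,2}" "x \<in> topspace (subtopology ?W ?T) \<inter> T i \<inter> T j" for i j x
      using ft[of i x] ft[of j x] that by (metis IntE)
    show "\<exists>j. j \<in> {0,1,2} \<and> x \<in> T j \<and> h x = f j x" if "x \<in> topspace (subtopology ?W ?T)" for x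
    proof -
      have "x \<in> ?T" using that unfolding topspace_subtopology by blast
      then obtain j where "j \<in> {0,1,2}" "x \<in> T j" by blast
      then show ?thesis using ft[of j x] by metis
    qed
  qed (use cf in auto)
  then obtain H where H: "continuous_map ?W Y H" "\<And>x. x \<in> ?T \<Longrightarrow> H x = h x"
    using extends_intoE[OF AE cUT] by blast
  show thesis
  proof
    show "continuous_map ?W Y H" by fact
    show "H (0, y) = y" if "y \<in> topspace Y" for y
      using H(2)[of "(0,y)"] that by (auto simp: T_def h_def)
    show "H (1, y) = e p" if "y \<in> topspace Y" for y
      using H(2)[of "(1,y)"] that by (auto simp: T_def h_def)
    show "H (t, e z) = e (G (t, z))" if "z \<in> topspace Z" "t \<in> {0..1}" for z t
    proof -
      have "(t, e z) \<in> T 2" using that by (auto simp: T_def)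
      then have "H (t, e z) = f 2 (t, e z)" using H(2) ft[of 2] by auto
      then show ?thesis using de that by (simp add: f_def)
    qed
  qed
qed

section \<open>Contractibility of directed gluings\<close>

lemma openin_sum_topology_slice:
  assumes "i \<in> I" "openin (F i) U"
  shows "openin (sum_topology F I) ({i} \<times> U)"
proof -
  have "{x. (j, x) \<in> {i} \<times> U} = (if j = i then U else {})" for j by auto
  then show ?thesis using assms openin_subset[OF assms(2)] by (auto simp: openin_sum_topology)
qed

lemma glue_class_eq:
  assumes "p \<in> topspace (sum_topology F I)" "q \<in> topspace (sum_topology F I)"
    "equivclp (\<lambda>u v. (u, v) \<in> R) p q"
  shows "glue_rel F I R `` {p} = glue_rel F I R `` {q}"
  using assms unfolding glue_rel_def
  by (auto intro: equivclp_trans equivclp_sym)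

text \<open>A diagram of spaces and injective maps indexed by a preorder. The index relation is
  reflexive, with \<open>\<iota> i i\<close> the identity, so that consecutive terms of a cofinal sequence may coincide.\<close>

locale directed_gluing =
  fixes F :: "'i \<Rightarrow> 'b topology" and I :: "'i set" and le :: "'i \<Rightarrow> 'i \<Rightarrow> bool"
    and \<iota> :: "'i \<Rightarrow> 'i \<Rightarrow> 'b \<Rightarrow> 'b"
  assumes le_refl: "i \<in> I \<Longrightarrow> le i i"
    and le_trans: "le i j \<Longrightarrow> le j k \<Longrightarrow> le i k"
    and incl_cont: "\<lbrakk>i \<in> I; j \<in> I; le i j\<rbrakk> \<Longrightarrow> continuous_map (F i) (F j) (\<iota> i j)"
    and incl_inj: "\<lbrakk>i \<in> I; j \<in> I; le i j\<rbrakk> \<Longrightarrow> inj_on (\<iota> i j) (topspace (F i))"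
    and incl_refl: "\<lbrakk>i \<in> I; x \<in> topspace (F i)\<rbrakk> \<Longrightarrow> \<iota> i i x = x"
    and incl_comp: "\<lbrakk>i \<in> I; j \<in> I; k \<in> I; le i j; le j k; x \<in> topspace (F i)\<rbrakk>
       \<Longrightarrow> \<iota> j k (\<iota> i j x) = \<iota> i k x"
begin

definition inclusions :: "(('i \<times> 'b) \<times> ('i \<times> 'b)) set" where
  "inclusions = {((i, x), (j, \<iota> i j x)) | i j x. i \<in> I \<and> j \<in> I \<and> le i j \<and> i \<noteq> j \<and> x \<in> topspace (F i)}"

definition glue_class :: "'i \<times> 'b \<Rightarrow> ('i \<times> 'b) set" where
  "glue_class p = glue_rel F I inclusions `` {p}"

lemma incl_in: "\<lbrakk>i \<in> I; j \<in> I; le i j; x \<in> topspace (F i)\<rbrakk> \<Longrightarrow> \<iota> i j x \<in> topspace (F j)"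
  using incl_cont by (meson continuous_map_image_subset_topspace image_subset_iff)

lemma equivclp_imp_glue_class_eq:
  assumes "p \<in> topspace (sum_topology F I)" "q \<in> topspace (sum_topology F I)"
    "equivclp (\<lambda>u v. (u, v) \<in> inclusions) p q"
  shows "glue_class p = glue_class q"
  unfolding glue_class_def using assms by (rule glue_class_eq)

lemma glue_class_eq_imp_equivclp:
  assumes "p \<in> topspace (sum_topology F I)" "q \<in> topspace (sum_topology F I)" "glue_class p = glue_class q"
  shows "equivclp (\<lambda>u v. (u, v) \<in> inclusions) p q"
proof -
  have "q \<in> glue_class q" using assms by (simp add: glue_class_def glue_rel_def)
  then have "q \<in> glue_class p" using assms by simp
  then show ?thesis by (simp add: glue_class_def glue_rel_def)
qed

lemma glue_class_incl:
  assumes "i \<in> I" "j \<in> I" "le i j" "x \<in> topspace (F i)"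
  shows "glue_class (j, \<iota> i j x) = glue_class (i, x)"
proof (cases "i = j")
  case True then show ?thesis using assms incl_refl by simp
next
  case False
  then have "((i, x), (j, \<iota> i j x)) \<in> inclusions" using assms by (auto simp: inclusions_def)
  then have "equivclp (\<lambda>u v. (u, v) \<in> inclusions) (i, x) (j, \<iota> i j x)" by auto
  then show ?thesis using assms incl_in by (intro equivclp_imp_glue_class_eq[symmetric]) auto
qed

lemma quotient_map_glue_class: "quotient_map (sum_topology F I) (glue F I inclusions) glue_class"
  unfolding quotient_map_def
proof (intro conjI allI impI)
  show im: "glue_class ` topspace (sum_topology F I) = topspace (glue F I inclusions)"
    by (auto simp: glue_def topspace_quotient_topology glue_class_def quotient_def)
  fix U assume U: "U \<subseteq> topspace (glue F I inclusions)"
  then show "openin (sum_topology F I) {x \<in> topspace (sum_topology F I). glue_class x \<in> U} = openin (glue F I inclusions) U"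
    by (simp add: glue_def openin_quotient_topology topspace_quotient_topology glue_class_def)
qed

lemma continuous_map_glue_class: "i \<in> I \<Longrightarrow> continuous_map (F i) (glue F I inclusions) (\<lambda>x. glue_class (i, x))"
  using continuous_map_compose[OF continuous_map_component_injection quotient_imp_continuous_map[OF quotient_map_glue_class]]
  by (auto simp: o_def)

text \<open>For countable cofinality the glued space is the increasing union of the images of the spaces
  \<open>F (s n)\<close>, and \<open>extend_contraction\<close> supplies contractions \<open>H n\<close> that extend each other. A point of
  \<open>F i\<close> is moved by any \<open>H n\<close> with \<open>le i (s n)\<close>, after inclusion into \<open>F (s n)\<close>; functoriality of the
  inclusions makes the result independent of \<open>n\<close> and compatible with the identifications.\<close>

theorem contractible_glue:
  fixes s :: "nat \<Rightarrow> 'i"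
  assumes s: "\<And>n. s n \<in> I" "\<And>n. le (s n) (s (Suc n))" "\<And>i. i \<in> I \<Longrightarrow> \<exists>n. le i (s n)"
    and F: "\<And>i. i \<in> I \<Longrightarrow> compact_space (F i)" "\<And>i. i \<in> I \<Longrightarrow> Hausdorff_space (F i)"
      "\<And>i. i \<in> I \<Longrightarrow> extends_into (prod_topology (top_of_set {0..1::real}) (F i)) (F i)"
      "\<And>i. i \<in> I \<Longrightarrow> topspace (F i) \<noteq> {}"
  shows "contractible_space (glue F I inclusions)"
proof -
  let ?I = "top_of_set {0..1::real}"
  obtain p0 where p0: "p0 \<in> topspace (F (s 0))" using F(4) s(1) by blast
  define p where "p n = \<iota> (s 0) (s n) p0" for n
  have le0: "le (s n) (s m)" if "n \<le> m" for n m
    using that by (induction m rule: dec_induct) (use s le_refl le_trans in blast)+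
  have p: "p n \<in> topspace (F (s n))" for n
    unfolding p_def using incl_in s(1) le0 p0 by blast
  have pS: "\<iota> (s n) (s (Suc n)) (p n) = p (Suc n)" for n
    unfolding p_def using incl_comp s(1) le0 p0 by simp
  define good where "good n H \<longleftrightarrow> continuous_map (prod_topology ?I (F (s n))) (F (s n)) H \<and>
      (\<forall>x\<in>topspace (F (s n)). H (0, x) = x \<and> H (1, x) = p n)" for n H
  define ext where "ext n G H \<longleftrightarrow> (\<forall>x\<in>topspace (F (s n)). \<forall>t\<in>{0..1::real}.
      H (t, \<iota> (s n) (s (Suc n)) x) = \<iota> (s n) (s (Suc n)) (G (t, x)))" for n G H
  have step: "\<exists>H. good (Suc n) H \<and> ext n G H" if "good n G" for n G
  proof -
    have G: "continuous_map (prod_topology ?I (F (s n))) (F (s n)) G"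
      "\<And>x. x \<in> topspace (F (s n)) \<Longrightarrow> G (0, x) = x" "\<And>x. x \<in> topspace (F (s n)) \<Longrightarrow> G (1, x) = p n"
      using that by (auto simp: good_def)
    obtain H where "continuous_map (prod_topology ?I (F (s (Suc n)))) (F (s (Suc n))) H"
      "\<And>y. y \<in> topspace (F (s (Suc n))) \<Longrightarrow> H (0, y) = y"
      "\<And>y. y \<in> topspace (F (s (Suc n))) \<Longrightarrow> H (1, y) = \<iota> (s n) (s (Suc n)) (p n)"
      "\<And>z t. z \<in> topspace (F (s n)) \<Longrightarrow> t \<in> {0..1} \<Longrightarrow>
         H (t, \<iota> (s n) (s (Suc n)) z) = \<iota> (s n) (s (Suc n)) (G (t, z))"
      by (rule extend_contraction[of "F (s n)" "F (s (Suc n))" "\<iota> (s n) (s (Suc n))" G "p n"])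
         (use G F s incl_cont incl_inj p in \<open>simp_all\<close>)
    then show ?thesis unfolding good_def ext_def pS by blast
  qed
  have "\<exists>H. good 0 H"
  proof -
    \<comment> \<open>The first contraction extends the constant contraction of the point \<open>p 0\<close>.\<close>
    let ?Z = "subtopology (F (s 0)) {p 0}"
    obtain H where "continuous_map (prod_topology ?I (F (s 0))) (F (s 0)) H"
      "\<And>y. y \<in> topspace (F (s 0)) \<Longrightarrow> H (0, y) = y"
      "\<And>y. y \<in> topspace (F (s 0)) \<Longrightarrow> H (1, y) = id (p 0)"
      by (rule extend_contraction[of ?Z "F (s 0)" id snd "p 0"])
         (use F s p in \<open>auto simp: continuous_map_snd compact_space_subtopology continuous_map_from_subtopology\<close>)
    then show ?thesis by (auto simp: good_def)
  qed
  then obtain H where H: "\<And>n. good n (H n)" "\<And>n. ext n (H n) (H (Suc n))"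
    using dependent_nat_choice[of good ext] step by metis
  have Hin: "H n (t, x) \<in> topspace (F (s n))" if "t \<in> {0..1}" "x \<in> topspace (F (s n))" for n t x
    using H(1)[of n] that unfolding good_def
    by (metis SigmaI continuous_map_image_subset_topspace image_subset_iff topspace_euclidean_subtopology topspace_prod_topology)
  have Hext: "H m (t, \<iota> (s n) (s m) x) = \<iota> (s n) (s m) (H n (t, x))"
    if "n \<le> m" "t \<in> {0..1}" "x \<in> topspace (F (s n))" for n m t x
    using that(1)
  proof (induction m rule: dec_induct)
    case base then show ?case using that Hin incl_refl s by simp
  next
    case (step m)
    have c: "\<iota> (s n) (s (Suc m)) y = \<iota> (s m) (s (Suc m)) (\<iota> (s n) (s m) y)" if "y \<in> topspace (F (s n))" for y
      using incl_comp[of "s n" "s m" "s (Suc m)" y] s le0 step that by simp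
    have "\<iota> (s n) (s m) x \<in> topspace (F (s m))" using incl_in s le0 step that by blast
    then have "H (Suc m) (t, \<iota> (s n) (s (Suc m)) x) = \<iota> (s m) (s (Suc m)) (H m (t, \<iota> (s n) (s m) x))"
      using H(2)[of m] that c by (simp add: ext_def)
    then show ?case using step c Hin that by simp
  qed
  \<comment> \<open>A point of \<open>F i\<close> is moved at a chosen stage; by \<open>K_mono\<close> every later one gives the same.\<close>
  define stage where "stage i = (SOME n. le i (s n))" for i
  have stage: "le i (s (stage i))" if "i \<in> I" for i
    unfolding stage_def using s(3)[OF that] by (rule someI_ex)
  define K where "K = (\<lambda>(t, (i, x)). glue_class (s (stage i), H (stage i) (t, \<iota> i (s (stage i)) x)))"
  have K_mono: "glue_class (s n, H n (t, \<iota> i (s n) x)) = glue_class (s m, H m (t, \<iota> i (s m) x))"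
    if "i \<in> I" "x \<in> topspace (F i)" "t \<in> {0..1}" "le i (s n)" "n \<le> m" for i x t n m
  proof -
    have x: "\<iota> i (s n) x \<in> topspace (F (s n))" using that incl_in s by blast
    have "\<iota> i (s m) x = \<iota> (s n) (s m) (\<iota> i (s n) x)"
      using incl_comp[of i "s n" "s m" x] that s le0 by simp
    then have "H m (t, \<iota> i (s m) x) = \<iota> (s n) (s m) (H n (t, \<iota> i (s n) x))"
      using Hext that x by simp
    then show ?thesis
      using glue_class_incl[of "s n" "s m" "H n (t, \<iota> i (s n) x)"] s le0 that Hin x by simp
  qed
  have K_eq: "K (t, (i, x)) = glue_class (s n, H n (t, \<iota> i (s n) x))"
    if "i \<in> I" "x \<in> topspace (F i)" "t \<in> {0..1}" "le i (s n)" for i x t n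
    using K_mono[of i x t n "max n (stage i)"] K_mono[of i x t "stage i" "max n (stage i)"] that stage
    by (simp add: K_def)
  have K_incl: "K (t, (j, \<iota> i j x)) = K (t, (i, x))"
    if "i \<in> I" "j \<in> I" "le i j" "x \<in> topspace (F i)" "t \<in> {0..1}" for i j x t
  proof -
    obtain n where n: "le j (s n)" using s(3)[OF \<open>j \<in> I\<close>] by blast
    then have "\<iota> j (s n) (\<iota> i j x) = \<iota> i (s n) x"
      using incl_comp[of i j "s n" x] that s by simp
    then show ?thesis
      using K_eq[of j "\<iota> i j x" t n] K_eq[of i x t n] that n le_trans[of i j] incl_in[of i j] by auto
  qed
  have K_equiv: "K (t, u) = K (t, v)" if "equivclp (\<lambda>u v. (u, v) \<in> inclusions) u v" "t \<in> {0..1}" for t u v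
    using that(1)
  proof (induction rule: equivclp_induct)
    case base then show ?case ..
  next
    case (step v w)
    then have "(v, w) \<in> inclusions \<or> (w, v) \<in> inclusions" by simp
    then have "K (t, v) = K (t, w)" using K_incl that(2) by (fastforce simp: inclusions_def)
    then show ?case using step by simp
  qed
  \<comment> \<open>Continuity is checked on the open slices \<open>{i} \<times> F i\<close>, on which the stage is constant.\<close>
  have K_cont: "continuous_map (prod_topology ?I (sum_topology F I)) (glue F I inclusions) K"
  proof (rule pasting_lemma[where I = I and T = "\<lambda>i. {0..1} \<times> ({i} \<times> topspace (F i))" and f = "\<lambda>_. K"])
    show "openin (prod_topology ?I (sum_topology F I)) ({0..1} \<times> ({i} \<times> topspace (F i)))" if "i \<in> I" for i
      using openin_sum_topology_slice[where F = F, OF that openin_topspace] by (simp add: openin_prod_Times_iff)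
    show "\<exists>j. j \<in> I \<and> x \<in> {0..1} \<times> ({j} \<times> topspace (F j)) \<and> K x = K x"
      if "x \<in> topspace (prod_topology ?I (sum_topology F I))" for x
      using that by auto
    fix i assume i: "i \<in> I"
    let ?S = "subtopology (sum_topology F I) ({i} \<times> topspace (F i))"
    have snd: "continuous_map ?S (F i) snd"
      unfolding continuous_map_def
    proof (intro conjI allI impI)
      show "snd \<in> topspace ?S \<rightarrow> topspace (F i)" by auto
      fix U assume "openin (F i) U"
      then have "openin (sum_topology F I) ({i} \<times> U)" "U \<subseteq> topspace (F i)"
        using i openin_subset openin_sum_topology_slice by auto
      moreover have "{x \<in> topspace ?S. snd x \<in> U} = {i} \<times> U"
        using \<open>U \<subseteq> topspace (F i)\<close> i by auto
      ultimately show "openin ?S {x \<in> topspace ?S. snd x \<in> U}"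
        unfolding openin_subtopology using \<open>U \<subseteq> topspace (F i)\<close> by auto
    qed
    let ?n = "stage i"
    have sub: "subtopology (prod_topology ?I (sum_topology F I)) ({0..1} \<times> ({i} \<times> topspace (F i))) = prod_topology ?I ?S"
      by (simp add: subtopology_Times subtopology_subtopology)
    have 1: "continuous_map (prod_topology ?I ?S) (prod_topology ?I (F (s ?n))) (\<lambda>(t, u). (t, \<iota> i (s ?n) (snd u)))"
      using continuous_map_compose[OF snd incl_cont[of i "s ?n"]] i s stage
      by (simp add: continuous_map_prod_top o_def)
    have 2: "continuous_map (prod_topology ?I (F (s ?n))) (glue F I inclusions) ((\<lambda>x. glue_class (s ?n, x)) \<circ> H ?n)"
      using continuous_map_compose[OF _ continuous_map_glue_class] s H(1)[of ?n] by (auto simp: good_def)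
    have "continuous_map (prod_topology ?I ?S) (glue F I inclusions) (\<lambda>x. ((\<lambda>x. glue_class (s ?n, x)) \<circ> H ?n) ((\<lambda>(t, u). (t, \<iota> i (s ?n) (snd u))) x))"
      using continuous_map_compose[OF 1 2] by (simp add: o_def)
    then show "continuous_map (subtopology (prod_topology ?I (sum_topology F I)) ({0..1} \<times> ({i} \<times> topspace (F i)))) (glue F I inclusions) K"
      unfolding sub by (rule continuous_map_eq) (auto simp: K_def)
  qed auto
  have "quotient_map (prod_topology ?I (sum_topology F I)) (prod_topology ?I (glue F I inclusions)) (\<lambda>(t, u). (t, glue_class u))"
    by (rule quotient_map_prod_right[OF _ _ quotient_map_glue_class])
       (auto simp: compact_imp_locally_compact_space compact_space_subtopology Hausdorff_space_subtopology)
  then obtain g where g: "continuous_map (prod_topology ?I (glue F I inclusions)) (glue F I inclusions) g"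
    "\<And>x. x \<in> topspace (prod_topology ?I (sum_topology F I)) \<Longrightarrow> g ((\<lambda>(t, u). (t, glue_class u)) x) = K x"
  proof (rule quotient_map_lift_exists[OF _ K_cont])
    fix x y
    assume xy: "x \<in> topspace (prod_topology ?I (sum_topology F I))" "y \<in> topspace (prod_topology ?I (sum_topology F I))"
      "(case x of (t, u) \<Rightarrow> (t, glue_class u)) = (case y of (t, u) \<Rightarrow> (t, glue_class u))"
    obtain t u where x: "x = (t, u)" by (cases x)
    with xy obtain v where y: "y = (t, v)" "glue_class u = glue_class v" by (cases y) auto
    have "equivclp (\<lambda>u v. (u, v) \<in> inclusions) u v"
      using glue_class_eq_imp_equivclp[of u v] xy x y by auto
    then show "K x = K y" using K_equiv x y xy by auto
  qed blast
  have top: "topspace (glue F I inclusions) = glue_class ` topspace (sum_topology F I)"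
    using quotient_map_glue_class by (simp add: quotient_map_def)
  have "g (0, y) = y \<and> g (1, y) = glue_class (s 0, p0)" if "y \<in> topspace (glue F I inclusions)" for y
  proof -
    from that obtain i x where ix: "i \<in> I" "x \<in> topspace (F i)" "y = glue_class (i, x)" using top by auto
    let ?n = "stage i"
    have x: "\<iota> i (s ?n) x \<in> topspace (F (s ?n))" using ix stage incl_in s by blast
    have "g (0, y) = K (0, (i, x))" using g(2)[of "(0, (i, x))"] ix by simp
    also have "\<dots> = glue_class (s ?n, \<iota> i (s ?n) x)" using H(1)[of ?n] x by (simp add: K_def good_def)
    also have "\<dots> = y" using glue_class_incl ix stage s by simp
    finally have 0: "g (0, y) = y" .
    have "g (1, y) = K (1, (i, x))" using g(2)[of "(1, (i, x))"] ix by simp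
    also have "\<dots> = glue_class (s ?n, p ?n)" using H(1)[of ?n] x by (simp add: K_def good_def)
    also have "\<dots> = glue_class (s 0, p0)" unfolding p_def using glue_class_incl s le0 p0 by simp
    finally show ?thesis using 0 by simp
  qed
  then have "homotopic_with (\<lambda>x. True) (glue F I inclusions) (glue F I inclusions) id (\<lambda>x. glue_class (s 0, p0))"
    using g(1) by (subst homotopic_with) auto
  then show ?thesis unfolding contractible_space_def by blast
qed

end

section \<open>Convex regions cut along lines\<close>

text \<open>Inside \<open>U\<close> the closed set \<open>a\<close> is cut out by a line; outside \<open>U\<close> it is arbitrary. This is what makes
  a chord separate \<open>U\<close> into two convex sides.\<close>

definition slit :: "complex set \<Rightarrow> complex set \<Rightarrow> bool" where
  "slit U a \<longleftrightarrow> closed a \<and> (\<exists>n b. n \<noteq> 0 \<and> a \<inter> U = {z \<in> U. n \<bullet> z = b})"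

text \<open>Infinitely many slits are allowed as long as they are locally finite inside \<open>U\<close>: the arcs of \<open>A_F\<close>
  accumulate at the circle, but nowhere in the open disk.\<close>

definition slit_region :: "complex set \<Rightarrow> complex set set \<Rightarrow> bool" where
  "slit_region U \<alpha> \<longleftrightarrow> open U \<and> convex U \<and> (\<forall>a\<in>\<alpha>. slit U a) \<and>
     (\<forall>z\<in>U. \<exists>e>0. finite {a \<in> \<alpha>. a \<inter> ball z e \<noteq> {}})"

lemma slit_region_subset: "slit_region U \<alpha> \<Longrightarrow> \<beta> \<subseteq> \<alpha> \<Longrightarrow> slit_region U \<beta>"
proof -
  assume s: "slit_region U \<alpha>" and \<beta>: "\<beta> \<subseteq> \<alpha>"
  have "finite {a \<in> \<beta>. a \<inter> ball z e \<noteq> {}}" if "finite {a \<in> \<alpha>. a \<inter> ball z e \<noteq> {}}" for z e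
    by (rule finite_subset[OF _ that]) (use \<beta> in blast)
  then show ?thesis using s \<beta> unfolding slit_region_def by blast
qed

lemma slit_region_finite:
  assumes "open U" "convex U" "\<And>a. a \<in> \<alpha> \<Longrightarrow> slit U a" "finite \<alpha>"
  shows "slit_region U \<alpha>"
  using assms unfolding slit_region_def by (auto intro!: exI[of _ "1::real"])

text \<open>A component \<open>c\<close> is connected and misses every slit, so it lies on one side of each. Conversely, the
  points of \<open>U\<close> on these sides form a convex set that misses all slits, and \<open>c\<close> is maximal.\<close>

lemma component_halfplanes:
  assumes U: "convex U" and \<alpha>: "\<And>a. a \<in> \<alpha> \<Longrightarrow> slit U a"
    and c: "c \<in> components (U - \<Union>\<alpha>)"
  shows "\<exists>m k. (\<forall>a\<in>\<alpha>. m a \<noteq> 0) \<and> c = {z \<in> U. \<forall>a\<in>\<alpha>. k a < m a \<bullet> z}"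
proof -
  obtain z0 where z0: "z0 \<in> c" using in_components_nonempty[OF c] by blast
  have cs: "c \<subseteq> U - \<Union>\<alpha>" and cc: "connected c"
    using in_components_subset[OF c] in_components_connected[OF c] .
  \<comment> \<open>The normal vector of each line is chosen to point towards \<open>z0\<close>.\<close>
  have "\<exists>m k. m \<noteq> 0 \<and> a \<inter> U = {z \<in> U. m \<bullet> z = k} \<and> k < m \<bullet> z0" if a: "a \<in> \<alpha>" for a
  proof -
    obtain n b where nb: "n \<noteq> 0" "a \<inter> U = {z \<in> U. n \<bullet> z = b}"
      using \<alpha>[OF a] unfolding slit_def by blast
    have "n \<bullet> z0 \<noteq> b" using nb z0 cs a by blast
    then consider "b < n \<bullet> z0" | "-b < (-n) \<bullet> z0" by (auto simp: neq_iff)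
    then show ?thesis
    proof cases
      case 1 then show ?thesis using nb by blast
    next
      case 2
      then show ?thesis using nb by (intro exI[of _ "-n"] exI[of _ "-b"]) auto
    qed
  qed
  then obtain m k where mk: "\<And>a. a \<in> \<alpha> \<Longrightarrow> m a \<noteq> 0"
      "\<And>a. a \<in> \<alpha> \<Longrightarrow> a \<inter> U = {z \<in> U. m a \<bullet> z = k a}"
      "\<And>a. a \<in> \<alpha> \<Longrightarrow> k a < m a \<bullet> z0"
    by metis
  let ?c = "{z \<in> U. \<forall>a\<in>\<alpha>. k a < m a \<bullet> z}"
  have "c \<subseteq> ?c"
  proof
    fix z assume z: "z \<in> c"
    have "k a < m a \<bullet> z" if a: "a \<in> \<alpha>" for a
    proof (rule ccontr)
      assume "\<not> k a < m a \<bullet> z"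
      then obtain y where "y \<in> c" "m a \<bullet> y = k a"
        using connected_ivt_hyperplane[OF cc z z0, of "m a" "k a"] mk(3)[OF a] by auto
      then show False using mk(2)[OF a] cs a by blast
    qed
    then show "z \<in> ?c" using z cs by blast
  qed
  moreover have "?c \<subseteq> c"
  proof (rule components_maximal[OF c])
    have "?c = U \<inter> (\<Inter>a\<in>\<alpha>. {z. k a < m a \<bullet> z})" by auto
    moreover have "convex \<dots>"
      by (intro convex_Int U convex_INT convex_halfspace_gt)
    ultimately show "connected ?c" by (simp add: convex_connected)
    show "?c \<subseteq> U - \<Union>\<alpha>"
    proof
      fix z assume z: "z \<in> ?c"
      have "z \<notin> a" if "a \<in> \<alpha>" for a
        using mk(2)[OF that] z that by force
      then show "z \<in> U - \<Union>\<alpha>" using z by blast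
    qed
    show "c \<inter> ?c \<noteq> {}" using \<open>c \<subseteq> ?c\<close> z0 by blast
  qed
  ultimately have "c = ?c" by blast
  then show ?thesis using mk(1) by blast
qed

lemma convex_component:
  assumes "convex U" "\<And>a. a \<in> \<alpha> \<Longrightarrow> slit U a" "c \<in> components (U - \<Union>\<alpha>)"
  shows "convex c"
proof -
  obtain m :: "complex set \<Rightarrow> complex" and k
    where "c = {z \<in> U. \<forall>a\<in>\<alpha>. k a < m a \<bullet> z}"
    using component_halfplanes[OF assms] by blast
  then have "c = U \<inter> (\<Inter>a\<in>\<alpha>. {z. k a < m a \<bullet> z})" by auto
  then show ?thesis
    by (simp add: convex_Int assms(1) convex_INT convex_halfspace_gt)
qed

lemma polytope_closure_component:
  assumes U: "open U" "convex U" "polytope (closure U)" and \<alpha>: "finite \<alpha>" "\<And>a. a \<in> \<alpha> \<Longrightarrow> slit U a"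
    and c: "c \<in> components (U - \<Union>\<alpha>)"
  shows "polytope (closure c)"
proof -
  obtain m :: "complex set \<Rightarrow> complex" and k where m: "\<forall>a\<in>\<alpha>. m a \<noteq> 0"
    and ceq: "c = {z \<in> U. \<forall>a\<in>\<alpha>. k a < m a \<bullet> z}"
    using component_halfplanes[OF U(2) \<alpha>(2) c] by blast
  let ?h = "\<lambda>a. {z. k a < m a \<bullet> z}"
  let ?F = "insert U (?h ` \<alpha>)"
  have cF: "c = \<Inter>?F" using ceq by auto
  \<comment> \<open>Closure commutes with intersections of open convex sets that have a common point.\<close>
  have "closure (\<Inter>?F) = \<Inter>(closure ` ?F)"
  proof -
    have "\<Inter>?F \<noteq> {}" using cF in_components_nonempty[OF c] by simp
    moreover have "convex S \<and> open S" if "S \<in> ?F" for S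
      using that U by (auto simp: convex_halfspace_gt open_halfspace_gt)
    ultimately show ?thesis using closure_Inter_convex_open[of ?F] by metis
  qed
  then have "closure c = closure U \<inter> (\<Inter>a\<in>\<alpha>. {z. k a \<le> m a \<bullet> z})"
    using m cF by auto
  moreover have "polyhedron (closure U \<inter> (\<Inter>a\<in>\<alpha>. {z. k a \<le> m a \<bullet> z}))"
    using U(3) \<alpha>(1) by (intro polyhedron_Int polyhedron_Inter) (auto simp: polytope_imp_polyhedron polyhedron_halfspace_ge)
  moreover have "bounded (closure U)" using U(3) polytope_imp_bounded by blast
  ultimately show ?thesis
    by (metis bounded_Int polytope_eq_bounded_polyhedron)
qed

text \<open>Near a point only finitely many slits have to be avoided, and each is closed.\<close>

lemma open_minus_slits:
  assumes "slit_region U \<alpha>" shows "open (U - \<Union>\<alpha>)"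
proof (subst open_subopen, intro ballI)
  fix z assume z: "z \<in> U - \<Union>\<alpha>"
  then obtain e where e: "e > 0" "finite {a \<in> \<alpha>. a \<inter> ball z e \<noteq> {}}"
    using assms z unfolding slit_region_def by blast
  let ?F = "{a \<in> \<alpha>. a \<inter> ball z e \<noteq> {}}"
  have "open (U \<inter> ball z e - \<Union>?F)"
    using e(2) assms by (intro open_Diff open_Int closed_Union) (auto simp: slit_region_def slit_def)
  moreover have "U \<inter> ball z e - \<Union>?F \<subseteq> U - \<Union>\<alpha>" by blast
  moreover have "z \<in> U \<inter> ball z e - \<Union>?F" using z e(1) by auto
  ultimately show "\<exists>T. open T \<and> z \<in> T \<and> T \<subseteq> U - \<Union>\<alpha>" by blast
qed

text \<open>Pieces are defined as closures of components. Convexity of components is what allows passing back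
  from a piece to its component by taking the interior.\<close>

lemma interior_closure_component:
  assumes "slit_region U \<alpha>" "c \<in> components (U - \<Union>\<alpha>)"
  shows "open c" "convex c" "interior (closure c) = c"
proof -
  show 1: "open c" using open_components[OF open_minus_slits[OF assms(1)] assms(2)] .
  show 2: "convex c" using assms convex_component unfolding slit_region_def by blast
  show "interior (closure c) = c" using 1 2 by (simp add: convex_interior_closure interior_open)
qed

lemma pieces_iff:
  assumes "slit_region U \<alpha>"
  shows "Q \<in> pieces U \<alpha> \<longleftrightarrow> interior Q \<in> components (U - \<Union>\<alpha>) \<and> closure (interior Q) = Q"
  using interior_closure_component(3)[OF assms] by (auto simp: pieces_def image_iff)

lemma pieceD:
  assumes "slit_region U \<alpha>" "Q \<in> pieces U \<alpha>"
  shows "interior Q \<in> components (U - \<Union>\<alpha>)" "closure (interior Q) = Q" "interior Q \<noteq> {}"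
    "interior Q \<subseteq> U" "interior Q \<inter> \<Union>\<alpha> = {}" "convex (interior Q)"
proof -
  show 1: "interior Q \<in> components (U - \<Union>\<alpha>)" "closure (interior Q) = Q"
    using assms pieces_iff by auto
  show "interior Q \<noteq> {}" "interior Q \<subseteq> U" "interior Q \<inter> \<Union>\<alpha> = {}"
    using in_components_nonempty[OF 1(1)] in_components_subset[OF 1(1)] by auto
  show "convex (interior Q)"
    using interior_closure_component(2)[OF assms(1) 1(1)] .
qed

text \<open>Cutting along more slits refines the components: a connected subset of \<open>U\<close> that avoids \<open>\<alpha>\<close> and meets \<open>c0\<close>
  avoids \<open>\<beta>\<close>, hence stays in \<open>c0\<close>.\<close>

lemma components_within_component:
  assumes "\<beta> \<subseteq> \<alpha>" and c0: "c0 \<in> components (U - \<Union>\<beta>)"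
  shows "components (c0 - \<Union>\<alpha>) = {c \<in> components (U - \<Union>\<alpha>). c \<subseteq> c0}"
proof -
  have sub: "c0 - \<Union>\<alpha> \<subseteq> U - \<Union>\<alpha>" using in_components_subset[OF c0] by blast
  have "c \<in> components (U - \<Union>\<alpha>)" if c: "c \<in> components (c0 - \<Union>\<alpha>)" for c
    unfolding in_components_maximal
  proof (intro conjI allI impI)
    show "c \<noteq> {}" "connected c" using in_components_nonempty[OF c] in_components_connected[OF c] .
    show "c \<subseteq> U - \<Union>\<alpha>" using in_components_subset[OF c] sub by blast
    fix D assume D: "D \<noteq> {} \<and> c \<subseteq> D \<and> D \<subseteq> U - \<Union>\<alpha> \<and> connected D"
    have "D \<subseteq> c0"
    proof (rule components_maximal[OF c0])
      show "D \<subseteq> U - \<Union>\<beta>" using D assms(1) by blast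
      show "c0 \<inter> D \<noteq> {}" using D in_components_nonempty[OF c] in_components_subset[OF c] by blast
    qed (use D in blast)
    then have "D \<subseteq> c0 - \<Union>\<alpha>" using D by blast
    moreover have "\<forall>D. D \<noteq> {} \<and> c \<subseteq> D \<and> D \<subseteq> c0 - \<Union>\<alpha> \<and> connected D \<longrightarrow> D = c"
      using c in_components_maximal by metis
    ultimately show "D = c" using D by metis
  qed
  moreover have "c \<subseteq> c0" if "c \<in> components (c0 - \<Union>\<alpha>)" for c
    using in_components_subset[OF that] by blast
  moreover have "c \<in> components (c0 - \<Union>\<alpha>)" if c: "c \<in> components (U - \<Union>\<alpha>)" "c \<subseteq> c0" for c
    by (rule components_intermediate_subset[OF c(1) _ sub])
       (use c(2) in_components_subset[OF c(1)] in blast)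
  ultimately show ?thesis by blast
qed

lemma slit_region_within:
  assumes "slit_region U \<alpha>" "open V" "convex V" "V \<subseteq> U"
  shows "slit_region V \<alpha>"
  unfolding slit_region_def
proof (intro conjI ballI)
  fix a assume "a \<in> \<alpha>"
  then obtain n b where "closed a" "n \<noteq> 0" "a \<inter> U = {z \<in> U. n \<bullet> z = b}"
    using assms(1) unfolding slit_region_def slit_def by blast
  moreover from this have "a \<inter> V = {z \<in> V. n \<bullet> z = b}" using assms(4) by blast
  ultimately show "slit V a" unfolding slit_def by blast
qed (use assms in \<open>auto simp: slit_region_def\<close>)

text \<open>Cutting in two stages agrees with cutting at once. Arcs that miss the interior of \<open>Q\<close> remove nothing
  from it, so this is \<open>components_within_component\<close> carried over from components to pieces.\<close>

lemma pieces_arcs_through: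
  assumes s: "slit_region U \<alpha>" and \<beta>: "\<beta> \<subseteq> \<alpha>" and Q: "Q \<in> pieces U \<beta>"
  shows "slit_region (interior Q) (arcs_through \<alpha> Q)"
    and "pieces (interior Q) (arcs_through \<alpha> Q) = {R \<in> pieces U \<alpha>. interior R \<subseteq> interior Q}"
proof -
  note Q' = pieceD[OF slit_region_subset[OF s \<beta>] Q]
  show s': "slit_region (interior Q) (arcs_through \<alpha> Q)"
    by (rule slit_region_subset[OF slit_region_within[OF s]]) (use Q' in \<open>auto simp: arcs_through_def\<close>)
  have eq: "interior Q - \<Union>(arcs_through \<alpha> Q) = interior Q - \<Union>\<alpha>"
    by (auto simp: arcs_through_def)
  show "pieces (interior Q) (arcs_through \<alpha> Q) = {R \<in> pieces U \<alpha>. interior R \<subseteq> interior Q}"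
    using components_within_component[OF \<beta> Q'(1)]
    by (auto simp: pieces_iff[OF s'] pieces_iff[OF s] eq)
qed

lemma piece_superset:
  assumes s: "slit_region U \<alpha>" and \<beta>: "\<beta> \<subseteq> \<alpha>" and R: "R \<in> pieces U \<alpha>"
  obtains Q where "Q \<in> pieces U \<beta>" "interior R \<subseteq> interior Q"
proof -
  note R' = pieceD[OF s R]
  have s': "slit_region U \<beta>" using slit_region_subset[OF s \<beta>] .
  have "interior R \<subseteq> U - \<Union>\<beta>" using R' \<beta> by blast
  moreover have "U - \<Union>\<beta> \<noteq> {}" using calculation R' by blast
  moreover have "connected (interior R)" using R'(6) convex_connected by blast
  ultimately obtain c where c: "c \<in> components (U - \<Union>\<beta>)" "interior R \<subseteq> c"
    using exists_component_superset by metis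
  then have "closure c \<in> pieces U \<beta>" by (simp add: pieces_def)
  moreover have "interior R \<subseteq> interior (closure c)"
    using interior_closure_component(3)[OF s' c(1)] c(2) by simp
  ultimately show thesis using that by blast
qed

lemma pieces_empty:
  assumes "convex Q" "closed Q" "interior Q \<noteq> {}"
  shows "pieces (interior Q) {} = {Q}"
proof -
  have "components (interior Q) = {interior Q}"
    using assms by (intro components_eq_sing_iff[THEN iffD2]) (auto simp: convex_connected)
  then show ?thesis
    using assms convex_closure_interior[of Q] by (simp add: pieces_def)
qed

section \<open>Chords of a region and diagonals of its pieces\<close>

text \<open>A common form of the diagonals of a polygon and the chords of a disk: requiring the ends to be extreme
  points of the closed region makes the chord the whole intersection of its line with the region.\<close>

definition spanning_chord :: "complex set \<Rightarrow> complex set \<Rightarrow> bool" where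
  "spanning_chord U a \<longleftrightarrow> (\<exists>v w. a = closed_segment v w \<and> v \<noteq> w \<and>
     v extreme_point_of closure U \<and> w extreme_point_of closure U \<and> open_segment v w \<subseteq> U)"

text \<open>Beyond \<open>v\<close> or \<open>w\<close> the line carries no point of \<open>C\<close>, since such a point would make \<open>v\<close> or \<open>w\<close> an
  interior point of a segment in \<open>C\<close>.\<close>

lemma on_line_through_extreme_points:
  fixes v w z n :: complex
  assumes ex: "v extreme_point_of C" "w extreme_point_of C" and vw: "v \<noteq> w"
    and n: "n \<noteq> 0" "n \<bullet> w = n \<bullet> v" and z: "z \<in> C" "n \<bullet> z = n \<bullet> v"
  shows "z \<in> closed_segment v w"
proof -
  \<comment> \<open>Both differences are orthogonal to \<open>n\<close>, so their quotient is real: the position of \<open>z\<close> on the line.\<close>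
  define t where "t = Re ((z - v) / (w - v))"
  have 1: "Re n * Re (w - v) + Im n * Im (w - v) = 0" "Re n * Re (z - v) + Im n * Im (z - v) = 0"
    using n(2) z(2) by (auto simp: inner_complex_def algebra_simps)
  have "Re n * (Im (z - v) * Re (w - v) - Re (z - v) * Im (w - v)) = 0"
    "Im n * (Im (z - v) * Re (w - v) - Re (z - v) * Im (w - v)) = 0"
    using 1 by algebra+
  then have "Im (z - v) * Re (w - v) - Re (z - v) * Im (w - v) = 0"
    using n(1) by (auto simp: complex_eq_iff)
  then have "Im ((z - v) / (w - v)) = 0" by (simp add: Im_divide)
  then have "(z - v) / (w - v) = of_real t" by (simp add: t_def complex_eq_iff)
  then have zt: "z = v + t *\<^sub>R (w - v)" using vw by (simp add: field_simps scaleR_conv_of_real)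
  have vc: "v \<in> C" "w \<in> C" using ex by (auto simp: extreme_point_of_def)
  have "0 \<le> t"
  proof (rule ccontr)
    assume t: "\<not> 0 \<le> t"
    let ?u = "- t / (1 - t)"
    have "(1 - ?u) *\<^sub>R z + ?u *\<^sub>R w = (1 / (1 - t)) *\<^sub>R (z - t *\<^sub>R w)"
      using t by (simp add: field_simps scaleR_diff_right)
    also have "z - t *\<^sub>R w = (1 - t) *\<^sub>R v" using zt by (simp add: algebra_simps)
    finally have "v = (1 - ?u) *\<^sub>R z + ?u *\<^sub>R w" using t by simp
    moreover have "z \<noteq> w"
    proof
      assume "z = w"
      then have "w - v = t *\<^sub>R (w - v)" using zt by (simp add: diff_eq_eq add.commute)
      then have "(1 - t) *\<^sub>R (w - v) = 0" unfolding scaleR_left_diff_distrib by simp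
      then show False using t vw by simp
    qed
    moreover have "0 < ?u" "?u < 1" using t by (auto simp: divide_simps)
    ultimately have "v \<in> open_segment z w" unfolding in_segment by blast
    then show False using ex(1) z vc unfolding extreme_point_of_def by blast
  qed
  moreover have "t \<le> 1"
  proof (rule ccontr)
    assume t: "\<not> t \<le> 1"
    have "w = (1 - 1/t) *\<^sub>R v + (1/t) *\<^sub>R z" using t by (simp add: zt algebra_simps)
    moreover have "z \<noteq> v" using zt t vw by auto
    moreover have "0 < 1/t" "1/t < 1" using t by auto
    ultimately have "w \<in> open_segment v z" unfolding in_segment by metis
    then show False using ex(2) z vc unfolding extreme_point_of_def by blast
  qed
  ultimately show ?thesis unfolding in_segment using zt by (auto simp: algebra_simps)
qed

lemma slit_spanning_chord:
  assumes "spanning_chord U a" shows "slit U a"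
proof -
  obtain v w where a: "a = closed_segment v w" and vw: "v \<noteq> w"
    and ex: "v extreme_point_of closure U" "w extreme_point_of closure U"
    using assms unfolding spanning_chord_def by blast
  define n where "n = \<i> * (w - v)"
  have n0: "n \<noteq> 0" using vw by (simp add: n_def)
  have nw: "n \<bullet> w = n \<bullet> v" by (simp add: n_def inner_complex_def algebra_simps)
  have "n \<bullet> z = n \<bullet> v" if "z \<in> a" for z
  proof -
    obtain t where "z = (1 - t) *\<^sub>R v + t *\<^sub>R w"
      using \<open>z \<in> a\<close> unfolding a closed_segment_def by blast
    then have "n \<bullet> z = (1 - t) * (n \<bullet> v) + t * (n \<bullet> w)" by (simp add: inner_right_distrib)
    then show ?thesis using nw by (simp add: algebra_simps)
  qed
  moreover have "z \<in> a" if "z \<in> U" "n \<bullet> z = n \<bullet> v" for z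
    using on_line_through_extreme_points[OF ex vw n0 nw _ that(2)] that(1) closure_subset a by blast
  ultimately have "a \<inter> U = {z \<in> U. n \<bullet> z = n \<bullet> v}" by blast
  then show ?thesis unfolding slit_def using n0 a by auto
qed

lemma extreme_point_of_subset:
  "x extreme_point_of S \<Longrightarrow> T \<subseteq> S \<Longrightarrow> x \<in> T \<Longrightarrow> x extreme_point_of T"
  unfolding extreme_point_of_def by blast

text \<open>The open chord is connected and misses the cuts, so it lies within one piece; its ends are then in that
  closed piece, and they remain extreme there because they are extreme in a larger set.\<close>

lemma spanning_chord_diagonal:
  assumes s: "slit_region U \<beta>" and a: "spanning_chord U a" and nc: "\<And>b. b \<in> \<beta> \<Longrightarrow> a \<inter> b \<inter> U = {}"
    and Q: "Q \<in> pieces U \<beta>" "a \<inter> interior Q \<noteq> {}"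
  shows "a \<in> diagonals Q"
proof -
  obtain v w where vw: "a = closed_segment v w" "v \<noteq> w"
    and ex: "v extreme_point_of closure U" "w extreme_point_of closure U" and o: "open_segment v w \<subseteq> U"
    using a unfolding spanning_chord_def by blast
  note Q' = pieceD[OF s Q(1)]
  have Uo: "open U" using s by (simp add: slit_region_def)
  have "z \<notin> U" if "z extreme_point_of closure U" for z
    using extreme_point_not_in_interior[OF that] Uo by (meson closure_subset interior_maximal subsetD)
  then have aU: "a \<inter> U = open_segment v w"
    using o ex vw unfolding closed_segment_eq_open by auto
  have sub: "open_segment v w \<subseteq> interior Q"
  proof (rule components_maximal[OF Q'(1)])
    show "open_segment v w \<subseteq> U - \<Union>\<beta>" using o nc aU by blast
    show "interior Q \<inter> open_segment v w \<noteq> {}" using Q(2) Q'(4) aU by blast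
  qed (simp add: convex_connected)
  have "closed_segment v w \<subseteq> closure (interior Q)"
    using closure_mono[OF sub] vw(2) by simp
  then have vQ: "v \<in> Q" "w \<in> Q" using Q'(2) by auto
  have "Q \<subseteq> closure U" using Q'(2,4) closure_mono by metis
  then have "v extreme_point_of Q" "w extreme_point_of Q" using ex vQ extreme_point_of_subset by auto
  then show ?thesis using vw sub unfolding diagonals_def polygon_vertices_def by blast
qed

lemma closure_interior_polygon:
  assumes "polygon P" shows "closure (interior P) = P" "convex P" "closed P" "interior P \<noteq> {}"
  using assms convex_closure_interior[of P] unfolding polygon_def
  by (auto simp: polytope_imp_convex polytope_imp_closed)

lemma diagonals_spanning_chord:
  assumes "polygon P" "a \<in> diagonals P" shows "spanning_chord (interior P) a"
  using assms(2) closure_interior_polygon[OF assms(1)]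
  unfolding diagonals_def polygon_vertices_def spanning_chord_def by auto

lemma finite_diagonals:
  assumes "polygon P" shows "finite (diagonals P)"
proof -
  have f: "finite (polygon_vertices P)"
    using assms unfolding polygon_vertices_def polygon_def
    by (simp add: finite_polyhedron_extreme_points polytope_imp_polyhedron)
  have "diagonals P \<subseteq> (\<lambda>(v, w). closed_segment v w) ` (polygon_vertices P \<times> polygon_vertices P)"
    unfolding diagonals_def by auto
  then show ?thesis using f finite_subset by blast
qed

lemma slit_region_tessellation:
  assumes "polygon P" "tessellation P \<alpha>" shows "slit_region (interior P) \<alpha>" "finite \<alpha>"
proof -
  show f: "finite \<alpha>" using assms finite_diagonals finite_subset unfolding tessellation_def by blast
  show "slit_region (interior P) \<alpha>"
    using f assms closure_interior_polygon[OF assms(1)] slit_spanning_chord diagonals_spanning_chord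
    by (intro slit_region_finite) (auto simp: tessellation_def)
qed

lemma tessellation_subset: "tessellation P \<alpha> \<Longrightarrow> \<beta> \<subseteq> \<alpha> \<Longrightarrow> tessellation P \<beta>"
  unfolding tessellation_def noncrossing_def using pairwise_subset by blast

lemma polygon_piece:
  assumes P: "polygon P" and \<alpha>: "tessellation P \<alpha>" and Q: "Q \<in> pieces (interior P) \<alpha>"
  shows "polygon Q"
proof -
  note s = slit_region_tessellation[OF P \<alpha>]
  note Q' = pieceD[OF s(1) Q]
  have "polytope (closure (interior Q))"
    by (rule polytope_closure_component[OF _ _ _ s(2) _ Q'(1)])
       (use s(1) P closure_interior_polygon[OF P] in \<open>auto simp: slit_region_def polygon_def\<close>)
  then show ?thesis using Q' by (simp add: polygon_def)
qed

text \<open>By \<open>spanning_chord_diagonal\<close>, since arcs of \<open>\<beta>\<close> do not run through pieces of \<open>\<beta>\<close>. The region may be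
  the disk or the interior of a polygon.\<close>

lemma tessellation_arcs_through:
  assumes s: "slit_region U \<alpha>" and \<alpha>: "\<And>a. a \<in> \<alpha> \<Longrightarrow> spanning_chord U a" "noncrossing U \<alpha>"
    and \<beta>: "\<beta> \<subseteq> \<alpha>" and Q: "Q \<in> pieces U \<beta>"
  shows "tessellation Q (arcs_through \<alpha> Q)"
proof -
  note s' = slit_region_subset[OF s \<beta>]
  note Q' = pieceD[OF s' Q]
  have "a \<in> diagonals Q" if "a \<in> arcs_through \<alpha> Q" for a
  proof (rule spanning_chord_diagonal[OF s' _ _ Q])
    have a: "a \<in> \<alpha>" "a \<inter> interior Q \<noteq> {}" using that by (auto simp: arcs_through_def)
    then show "spanning_chord U a" "a \<inter> interior Q \<noteq> {}" using \<alpha> by auto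
    fix b assume b: "b \<in> \<beta>"
    moreover from this have "a \<noteq> b" using a Q'(5) by blast
    ultimately show "a \<inter> b \<inter> U = {}" using \<alpha>(2) a \<beta> unfolding noncrossing_def pairwise_def by blast
  qed
  moreover have "noncrossing (interior Q) (arcs_through \<alpha> Q)"
    using \<alpha>(2) Q'(4) unfolding noncrossing_def pairwise_def arcs_through_def by blast
  ultimately show ?thesis unfolding tessellation_def by blast
qed

lemma tessellation_arcs_through_polygon:
  assumes "polygon P" "tessellation P \<alpha>" "\<beta> \<subseteq> \<alpha>" "Q \<in> pieces (interior P) \<beta>"
  shows "tessellation Q (arcs_through \<alpha> Q)"
  using tessellation_arcs_through[OF slit_region_tessellation(1)[OF assms(1,2)] _ _ assms(3,4)]
    diagonals_spanning_chord[OF assms(1)] assms(2) unfolding tessellation_def by blast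

lemma polygon_eq_hull: "polygon P \<Longrightarrow> P = convex hull (polygon_vertices P)"
  unfolding polygon_def polygon_vertices_def
  using Krein_Milman_Minkowski[of P] polytope_imp_compact polytope_imp_convex by blast

text \<open>A diagonal has vertices on both sides of its line, but a triangle has only one vertex besides the ends
  of the diagonal.\<close>

lemma triangle_no_diagonals:
  assumes "triangle P" shows "diagonals P = {}"
proof (rule ccontr)
  assume "diagonals P \<noteq> {}"
  then obtain v w where vw: "v \<in> polygon_vertices P" "w \<in> polygon_vertices P" "v \<noteq> w" "open_segment v w \<subseteq> interior P"
    unfolding diagonals_def by blast
  have P: "polygon P" and c3: "card (polygon_vertices P) = 3" using assms by (auto simp: triangle_def)
  have fin: "finite (polygon_vertices P)" using c3 by (metis card.infinite zero_neq_numeral)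
  have "card (polygon_vertices P - {v, w}) = 1" using vw c3 fin by (simp add: card_Diff_subset)
  then obtain u where "polygon_vertices P - {v, w} = {u}" by (metis card_1_singletonE)
  then have V: "polygon_vertices P = {u, v, w}" using vw by auto
  obtain n where n: "n \<noteq> 0" "n \<bullet> w = n \<bullet> v" "n \<bullet> v \<le> n \<bullet> u"
  proof -
    have 1: "(\<i> * (w - v)) \<bullet> w = (\<i> * (w - v)) \<bullet> v" by (simp add: inner_complex_def algebra_simps)
    show thesis
    proof (cases "(\<i> * (w - v)) \<bullet> v \<le> (\<i> * (w - v)) \<bullet> u")
      case True then show thesis using that[of "\<i> * (w - v)"] 1 vw by auto
    next
      case False then show thesis using that[of "- (\<i> * (w - v))"] 1 vw by (auto simp del: mult_minus_right)
    qed
  qed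
  have "P \<subseteq> {z. n \<bullet> v \<le> n \<bullet> z}"
  proof -
    have "convex hull (polygon_vertices P) \<subseteq> {z. n \<bullet> v \<le> n \<bullet> z}"
      by (rule hull_minimal) (use n V in \<open>auto simp: convex_halfspace_ge\<close>)
    then show ?thesis using polygon_eq_hull[OF P] by simp
  qed
  then have "interior P \<subseteq> {z. n \<bullet> v < n \<bullet> z}"
    using interior_mono[of P] n(1) by (metis interior_halfspace_ge)
  moreover have m: "midpoint v w \<in> interior P" using vw by auto
  moreover have "n \<bullet> midpoint v w = n \<bullet> v" using n(2) by (simp add: midpoint_def inner_right_distrib)
  ultimately show False by auto
qed

section \<open>Functoriality of the faces of associahedra\<close>

text \<open>After putting \<open>d\<close> back, only the piece that \<open>d\<close> crosses is cut further, and it is cut by \<open>d\<close> alone.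
  This is the case distinction in \<open>face_incl\<close>.\<close>

lemma arcs_through_remove1:
  assumes s: "slit_region U \<alpha>" and d: "d \<in> \<alpha>" and Q: "Q \<in> pieces U (\<alpha> - {d})"
  shows "arcs_through \<alpha> Q = (if d \<inter> interior Q \<noteq> {} then {d} else {})"
proof -
  have "interior Q \<inter> \<Union>(\<alpha> - {d}) = {}"
    using pieceD(5)[OF slit_region_subset[OF s] Q] by blast
  then show ?thesis using d by (auto simp: arcs_through_def)
qed

lemma closed_piece:
  assumes "slit_region U \<alpha>" "Q \<in> pieces U \<alpha>"
  shows "closed Q" "convex Q"
proof -
  note Q = pieceD[OF assms]
  show "closed Q" using Q(2) by (metis closed_closure)
  show "convex Q" using Q(2,6) by (metis convex_closure)
qed

lemma topspace_face_space: "topspace (face_space X P \<alpha>) = PiE (pieces (interior P) \<alpha>) (\<lambda>R. topspace (X R))"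
  by (simp add: face_space_def o_def)

lemma topspace_cell: "topspace (cell X A) = PiE (nontriangular_pieces A) (\<lambda>R. topspace (X R))"
  by (simp add: cell_def o_def)

lemma restrict_in_face_space:
  assumes "\<And>R. R \<in> pieces (interior Q) \<gamma> \<Longrightarrow> x R \<in> topspace (X R)"
  shows "restrict x (pieces (interior Q) \<gamma>) \<in> topspace (face_space X Q \<gamma>)"
  using assms by (auto simp: topspace_face_space)

text \<open>The properties of an \<open>F\<close>-tessellation on which the maps between cells depend.\<close>

definition disk_tessellation :: "complex set set \<Rightarrow> bool" where
  "disk_tessellation A \<longleftrightarrow> slit_region disk A \<and> (\<forall>a\<in>A. spanning_chord disk a) \<and>
     noncrossing disk A \<and> (\<forall>Q\<in>pieces disk A. polygon Q)"

locale stasheff =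
  fixes X :: "complex set \<Rightarrow> 'a topology"
    and J :: "complex set \<Rightarrow> complex set set \<Rightarrow> (complex set \<Rightarrow> 'a) \<Rightarrow> 'a"
  assumes stasheff: "stasheff_associahedra X J"
begin

lemma associahedron_ball:
  assumes "polygon P"
  obtains h where "homeomorphic_map (unit_ball (card (polygon_vertices P) - 3)) (X P) h"
  using stasheff assms unfolding stasheff_associahedra_def Let_def by blast

lemma J_empty:
  assumes "polygon P" "x \<in> topspace (face_space X P {})"
  shows "J P {} x = x P"
  using stasheff assms unfolding stasheff_associahedra_def by blast

lemma J_embedding:
  assumes "polygon P" "tessellation P \<alpha>"
  shows "continuous_map (face_space X P \<alpha>) (X P) (J P \<alpha>)"
    "inj_on (J P \<alpha>) (topspace (face_space X P \<alpha>))"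
    "x \<in> topspace (face_space X P \<alpha>) \<Longrightarrow> J P \<alpha> x \<in> topspace (X P)"
proof -
  have e: "embedding_map (face_space X P \<alpha>) (X P) (J P \<alpha>)"
    using stasheff assms unfolding stasheff_associahedra_def by blast
  show c: "continuous_map (face_space X P \<alpha>) (X P) (J P \<alpha>)"
    using homeomorphic_imp_continuous_map[OF e[unfolded embedding_map_def]]
    by (rule continuous_map_into_fulltopology)
  show "inj_on (J P \<alpha>) (topspace (face_space X P \<alpha>))"
    using homeomorphic_imp_injective_map[OF e[unfolded embedding_map_def]] .
  show "x \<in> topspace (face_space X P \<alpha>) \<Longrightarrow> J P \<alpha> x \<in> topspace (X P)"
    using continuous_map_image_subset_topspace[OF c] by blast
qed

text \<open>The glued boundary identifies points only if both lie in the face spaces, so this is needed before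
  the gluing relation can be used.\<close>

lemma face_incl_in_face_space:
  assumes P: "polygon P" and \<alpha>: "tessellation P \<alpha>" and d: "d \<in> \<alpha>"
    and x: "x \<in> topspace (face_space X P \<alpha>)"
  shows "face_incl J P \<alpha> d x \<in> topspace (face_space X P (\<alpha> - {d}))"
proof -
  have s: "slit_region (interior P) \<alpha>" using slit_region_tessellation[OF P \<alpha>] by simp
  have "(if d \<inter> interior Q \<noteq> {} then J Q {d} (restrict x (pieces (interior Q) {d})) else x Q) \<in> topspace (X Q)"
    if Q: "Q \<in> pieces (interior P) (\<alpha> - {d})" for Q
  proof -
    have Qpoly: "polygon Q" using polygon_piece[OF P tessellation_subset[OF \<alpha>] Q] by blast
    have arcs: "arcs_through \<alpha> Q = (if d \<inter> interior Q \<noteq> {} then {d} else {})"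
      using arcs_through_remove1[OF s d Q] .
    have pcs: "pieces (interior Q) (arcs_through \<alpha> Q) \<subseteq> pieces (interior P) \<alpha>"
      using pieces_arcs_through(2)[OF s _ Q] by blast
    have tess: "tessellation Q (arcs_through \<alpha> Q)"
      using tessellation_arcs_through_polygon[OF P \<alpha> _ Q] by blast
    show ?thesis
    proof (cases "d \<inter> interior Q = {}")
      case True
      then have "Q \<in> pieces (interior P) \<alpha>"
        using arcs pcs pieces_empty closure_interior_polygon[OF Qpoly] by auto
      then show ?thesis using True x by (auto simp: topspace_face_space)
    next
      case False
      then have "restrict x (pieces (interior Q) {d}) \<in> topspace (face_space X Q {d})"
        using arcs pcs x by (intro restrict_in_face_space) (auto simp: topspace_face_space)
      then show ?thesis using False J_embedding(3)[OF Qpoly, of "{d}"] tess arcs by simp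
    qed
  qed
  then show ?thesis unfolding face_incl_def topspace_face_space by auto
qed

text \<open>The map from the glued boundary into the associahedron is a single function on classes, and the two
  arguments represent the same class. If \<open>d\<close> is the only diagonal, the right-hand side is the top cell,
  which is not part of the boundary; there the equation holds by the definition of \<open>face_incl\<close> and because
  \<open>J P {}\<close> takes the only coordinate.\<close>

lemma J_remove1:
  assumes P: "polygon P" and \<alpha>: "tessellation P \<alpha>" and d: "d \<in> \<alpha>"
    and x: "x \<in> topspace (face_space X P \<alpha>)"
  shows "J P \<alpha> x = J P (\<alpha> - {d}) (face_incl J P \<alpha> d x)"
proof (cases "\<alpha> - {d} = {}")
  case True
  then have a: "\<alpha> = {d}" using d by blast
  have PP: "pieces (interior P) {} = {P}"
    using pieces_empty closure_interior_polygon[OF P] by simp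
  have "d \<inter> interior P \<noteq> {}"
  proof -
    obtain v w where vw: "d = closed_segment v w" "v \<noteq> w" "open_segment v w \<subseteq> interior P"
      using \<alpha> d unfolding tessellation_def diagonals_def by blast
    then have "midpoint v w \<in> d \<inter> interior P" by auto
    then show ?thesis by blast
  qed
  moreover have "restrict x (pieces (interior P) \<alpha>) = x"
    using x by (auto simp: topspace_face_space PiE_iff extensional_restrict)
  ultimately have "face_incl J P \<alpha> d x P = J P \<alpha> x" by (simp add: face_incl_def a PP)
  then show ?thesis
    using J_empty[OF P] face_incl_in_face_space[OF P \<alpha> d x] unfolding True by simp
next
  case False
  let ?F = "face_space X P" and ?I = "boundary_faces P" and ?R = "boundary_incls X J P"
  obtain g where g: "\<forall>\<alpha> \<in> ?I. \<forall>x \<in> topspace (?F \<alpha>). g (glue_rel ?F ?I ?R `` {(\<alpha>, x)}) = J P \<alpha> x"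
    using stasheff P unfolding stasheff_associahedra_def Let_def by blast
  have I: "\<alpha> \<in> ?I" "\<alpha> - {d} \<in> ?I"
    using \<alpha> False tessellation_subset[OF \<alpha>, of "\<alpha> - {d}"] by (auto simp: boundary_faces_def)
  have y: "face_incl J P \<alpha> d x \<in> topspace (?F (\<alpha> - {d}))"
    by (rule face_incl_in_face_space[OF P \<alpha> d x])
  have "((\<alpha>, x), (\<alpha> - {d}, face_incl J P \<alpha> d x)) \<in> ?R"
    using I d x False unfolding boundary_incls_def by blast
  then have "equivclp (\<lambda>u v. (u, v) \<in> ?R) (\<alpha>, x) (\<alpha> - {d}, face_incl J P \<alpha> d x)" by auto
  then have "glue_rel ?F ?I ?R `` {(\<alpha>, x)} = glue_rel ?F ?I ?R `` {(\<alpha> - {d}, face_incl J P \<alpha> d x)}"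
    using I x y by (intro glue_class_eq) auto
  then show ?thesis using g I x y by metis
qed

lemma restrict_face:
  assumes P: "polygon P" and \<alpha>: "tessellation P \<alpha>" and \<beta>: "\<beta> \<subseteq> \<alpha>"
    and x: "x \<in> topspace (face_space X P \<alpha>)" and Q: "Q \<in> pieces (interior P) \<beta>"
  shows "restrict x (pieces (interior Q) (arcs_through \<alpha> Q)) \<in> topspace (face_space X Q (arcs_through \<alpha> Q))"
  using x pieces_arcs_through(2)[OF slit_region_tessellation(1)[OF P \<alpha>] \<beta> Q]
  by (intro restrict_in_face_space) (auto simp: topspace_face_space)

text \<open>Compares, inside one piece \<open>R\<close> of \<open>\<beta>\<close>, the inclusion of \<open>x\<close> with the inclusion of the point obtained
  from \<open>x\<close> by removing \<open>d\<close>. If \<open>d\<close> crosses \<open>R\<close>, this is \<open>J_remove1\<close> for the polygon \<open>R\<close>; otherwise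
  nothing changes inside \<open>R\<close>.\<close>

lemma J_refine_step:
  assumes P: "polygon P" and \<alpha>: "tessellation P \<alpha>" and \<beta>: "\<beta> \<subseteq> \<alpha> - {d}" and d: "d \<in> \<alpha>"
    and x: "x \<in> topspace (face_space X P \<alpha>)" and R: "R \<in> pieces (interior P) \<beta>"
  shows "J R (arcs_through (\<alpha> - {d}) R)
           (restrict (face_incl J P \<alpha> d x) (pieces (interior R) (arcs_through (\<alpha> - {d}) R))) =
         J R (arcs_through \<alpha> R) (restrict x (pieces (interior R) (arcs_through \<alpha> R)))"
proof -
  let ?y = "face_incl J P \<alpha> d x" and ?\<gamma> = "arcs_through \<alpha> R"
  have \<alpha>': "tessellation P (\<alpha> - {d})" and \<beta>': "\<beta> \<subseteq> \<alpha>" using tessellation_subset[OF \<alpha>] \<beta> by auto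
  have s: "slit_region (interior P) \<alpha>" "slit_region (interior P) (\<alpha> - {d})"
    using slit_region_tessellation(1)[OF P] \<alpha> \<alpha>' by auto
  have pcs: "pieces (interior R) (arcs_through (\<alpha> - {d}) R) \<subseteq> pieces (interior P) (\<alpha> - {d})"
    "R' \<in> pieces (interior R) (arcs_through (\<alpha> - {d}) R) \<Longrightarrow> interior R' \<subseteq> interior R" for R'
    using pieces_arcs_through(2)[OF s(2) \<beta> R] by auto
  have arcs: "arcs_through (\<alpha> - {d}) R = ?\<gamma> - {d}" by (auto simp: arcs_through_def)
  show ?thesis
  proof (cases "d \<inter> interior R = {}")
    case True
    then have eq: "arcs_through (\<alpha> - {d}) R = ?\<gamma>" by (auto simp: arcs_through_def)
    have "?y R' = x R'" if "R' \<in> pieces (interior R) ?\<gamma>" for R'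
    proof -
      have "R' \<in> pieces (interior P) (\<alpha> - {d})" "d \<inter> interior R' = {}"
        using pcs(1) pcs(2)[of R'] that eq True by auto
      then show ?thesis by (simp add: face_incl_def)
    qed
    then have "restrict ?y (pieces (interior R) ?\<gamma>) = restrict x (pieces (interior R) ?\<gamma>)"
      by (auto simp: restrict_def)
    then show ?thesis using eq by simp
  next
    case False
    then have d\<gamma>: "d \<in> ?\<gamma>" using d by (auto simp: arcs_through_def)
    have Rp: "polygon R" using polygon_piece[OF P tessellation_subset[OF \<alpha> \<beta>'] R] .
    have \<gamma>: "tessellation R ?\<gamma>" using tessellation_arcs_through_polygon[OF P \<alpha> \<beta>' R] .
    have s\<gamma>: "slit_region (interior R) ?\<gamma>" using slit_region_tessellation(1)[OF Rp \<gamma>] .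
    let ?x = "restrict x (pieces (interior R) ?\<gamma>)"
    have x': "?x \<in> topspace (face_space X R ?\<gamma>)" using restrict_face[OF P \<alpha> \<beta>' x R] .
    have "face_incl J R ?\<gamma> d ?x R' = restrict ?y (pieces (interior R) (?\<gamma> - {d})) R'" for R'
    proof (cases "R' \<in> pieces (interior R) (?\<gamma> - {d})")
      case R': True
      have RP: "R' \<in> pieces (interior P) (\<alpha> - {d})" using R' pcs arcs by auto
      have a: "arcs_through ?\<gamma> R' = (if d \<inter> interior R' \<noteq> {} then {d} else {})"
        using arcs_through_remove1[OF s\<gamma> d\<gamma> R'] .
      have sub: "pieces (interior R') (arcs_through ?\<gamma> R') \<subseteq> pieces (interior R) ?\<gamma>"
        using pieces_arcs_through(2)[OF s\<gamma> _ R'] by blast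
      show ?thesis
      proof (cases "d \<inter> interior R' = {}")
        case True
        have "closed R'" "convex R'" "interior R' \<noteq> {}"
          using closed_piece[OF s(2) RP] pieceD(3)[OF s(2) RP] by auto
        then have "R' \<in> pieces (interior R) ?\<gamma>"
          using sub a True pieces_empty by auto
        then show ?thesis using True R' RP by (simp add: face_incl_def)
      next
        case False
        then have "restrict ?x (pieces (interior R') {d}) = restrict x (pieces (interior R') {d})"
          using sub a by (auto simp: restrict_def fun_eq_iff)
        then show ?thesis using False R' RP by (simp add: face_incl_def)
      qed
    qed (simp add: face_incl_def)
    then have "face_incl J R ?\<gamma> d ?x = restrict ?y (pieces (interior R) (?\<gamma> - {d}))" by blast
    then show ?thesis using J_remove1[OF Rp \<gamma> d\<gamma> x'] arcs by simp
  qed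
qed

text \<open>Functoriality of face inclusions: including \<open>f\<^sub>\<alpha>\<close> directly is the same as first including, in each
  piece of the coarser tessellation \<open>\<beta>\<close>, the face determined by \<open>\<alpha>\<close>, and then including \<open>f\<^sub>\<beta>\<close>.
  The diagonals in \<open>\<alpha> - \<beta>\<close> are removed one at a time.\<close>

lemma J_refine:
  assumes P: "polygon P" and \<alpha>: "tessellation P \<alpha>" and \<beta>: "\<beta> \<subseteq> \<alpha>"
    and x: "x \<in> topspace (face_space X P \<alpha>)"
  shows "J P \<alpha> x = J P \<beta> (\<lambda>R \<in> pieces (interior P) \<beta>.
           J R (arcs_through \<alpha> R) (restrict x (pieces (interior R) (arcs_through \<alpha> R))))"
  using \<alpha> \<beta> x
proof (induction "card (\<alpha> - \<beta>)" arbitrary: \<alpha> x)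
  case 0
  then have "finite (\<alpha> - \<beta>)" using slit_region_tessellation(2)[OF P] by blast
  then have ab: "\<alpha> = \<beta>" using 0 by auto
  have s: "slit_region (interior P) \<alpha>" using slit_region_tessellation(1)[OF P 0(2)] .
  have "(\<lambda>R \<in> pieces (interior P) \<beta>.
           J R (arcs_through \<alpha> R) (restrict x (pieces (interior R) (arcs_through \<alpha> R)))) R = x R" for R
  proof (cases "R \<in> pieces (interior P) \<beta>")
    case True
    then have R: "R \<in> pieces (interior P) \<alpha>" using ab by simp
    have Rp: "polygon R" using polygon_piece[OF P 0(2) R] .
    have a: "arcs_through \<alpha> R = {}" using pieceD(5)[OF s R] by (auto simp: arcs_through_def)
    have p: "pieces (interior R) {} = {R}"
      using pieces_empty closure_interior_polygon[OF Rp] by simp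
    have "restrict x {R} \<in> topspace (face_space X R {})"
      using restrict_face[OF P 0(2,3,4) True] a p by simp
    then show ?thesis using True a p J_empty[OF Rp] by simp
  next
    case False
    then show ?thesis using 0(4) ab by (auto simp: topspace_face_space PiE_iff extensional_def)
  qed
  then show ?case using ab by (simp only: fun_eq_iff)
next
  case (Suc n)
  have fin: "finite (\<alpha> - \<beta>)" using slit_region_tessellation(2)[OF P] Suc.prems by blast
  obtain d where d: "d \<in> \<alpha> - \<beta>" using Suc(2) by (metis card.empty ex_in_conv nat.distinct(1))
  have \<alpha>': "tessellation P (\<alpha> - {d})" using tessellation_subset Suc.prems by blast
  have \<beta>': "\<beta> \<subseteq> \<alpha> - {d}" using d Suc.prems by blast
  have n: "n = card (\<alpha> - {d} - \<beta>)"
  proof -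
    have "\<alpha> - {d} - \<beta> = (\<alpha> - \<beta>) - {d}" by blast
    then show ?thesis using card_Diff_singleton[of d "\<alpha> - \<beta>"] d Suc(2) by simp
  qed
  have y: "face_incl J P \<alpha> d x \<in> topspace (face_space X P (\<alpha> - {d}))"
    using face_incl_in_face_space[OF P Suc.prems(1) _ Suc.prems(3)] d by blast
  have "J P \<alpha> x = J P (\<alpha> - {d}) (face_incl J P \<alpha> d x)"
    using J_remove1[OF P Suc.prems(1) _ Suc.prems(3)] d by blast
  also have "\<dots> = J P \<beta> (\<lambda>R \<in> pieces (interior P) \<beta>. J R (arcs_through (\<alpha> - {d}) R)
      (restrict (face_incl J P \<alpha> d x) (pieces (interior R) (arcs_through (\<alpha> - {d}) R))))"
    by (rule Suc(1)[OF n \<alpha>' \<beta>' y])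
  also have "\<dots> = J P \<beta> (\<lambda>R \<in> pieces (interior P) \<beta>.
           J R (arcs_through \<alpha> R) (restrict x (pieces (interior R) (arcs_through \<alpha> R))))"
    using J_refine_step[OF P Suc.prems(1) \<beta>' _ Suc.prems(3)] d
    by (intro arg_cong[where f = "J P \<beta>"] restrict_ext) blast
  finally show ?case .
qed

section \<open>The cells of the infinite associahedron\<close>

text \<open>The associahedron of a triangle is a ball of dimension \<open>0\<close>. Hence leaving out the coordinates at
  triangular pieces loses nothing.\<close>

lemma triangle_space:
  assumes "triangle R"
  shows "\<exists>y. topspace (X R) = {y}"
proof -
  have R: "polygon R" "card (polygon_vertices R) = 3" using assms by (auto simp: triangle_def)
  obtain h where "homeomorphic_map (unit_ball 0) (X R) h"
    using associahedron_ball[OF R(1)] R(2) by auto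
  then have "h ` topspace (unit_ball 0) = topspace (X R)"
    by (rule homeomorphic_imp_surjective_map)
  moreover have "topspace (unit_ball 0) = {\<lambda>i. 0}"
    by (auto simp: unit_ball_def topspace_Euclidean_space)
  ultimately show ?thesis by auto
qed

text \<open>Restores the coordinates at triangular pieces, turning a point of \<open>cell X A\<close> into a point of the
  product over all pieces.\<close>

definition pad :: "(complex set \<Rightarrow> 'a) \<Rightarrow> complex set \<Rightarrow> 'a" where
  "pad x R = (if triangle R then THE y. y \<in> topspace (X R) else x R)"

lemma the_triangle_point:
  assumes "triangle R" "y \<in> topspace (X R)" shows "(THE y. y \<in> topspace (X R)) = y"
  using triangle_space[OF assms(1)] assms(2) by auto

lemma pad_in:
  assumes "R \<in> pieces disk A" "x \<in> topspace (cell X A)"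
  shows "pad x R \<in> topspace (X R)"
proof (cases "triangle R")
  case True
  then obtain y where y: "topspace (X R) = {y}" using triangle_space by blast
  then have "(THE y. y \<in> topspace (X R)) = y" by simp
  then show ?thesis using True y by (simp add: pad_def)
next
  case False
  then show ?thesis using assms by (auto simp: pad_def topspace_cell nontriangular_pieces_def PiE_iff)
qed

lemma cell_incl_eq:
  "cell_incl X J A B x = (\<lambda>Q \<in> nontriangular_pieces B.
     J Q (arcs_through A Q) (restrict (pad x) (pieces (interior Q) (arcs_through A Q))))"
  unfolding cell_incl_def pad_def restrict_def ..

text \<open>In the following \<open>A\<close> is the finer and \<open>B\<close> the coarser tessellation, so the cell of \<open>A\<close> is a face of the
  cell of \<open>B\<close>.\<close>

context
  fixes A B :: "complex set set"
  assumes A: "disk_tessellation A" and B: "disk_tessellation B" and BA: "B \<subseteq> A"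
begin

lemma slit_region_fine: "slit_region disk A"
  using A by (simp add: disk_tessellation_def)

lemma polygon_coarse_piece: "Q \<in> pieces disk B \<Longrightarrow> polygon Q"
  using B by (simp add: disk_tessellation_def)

lemma pieces_in_piece:
  "Q \<in> pieces disk B \<Longrightarrow>
     pieces (interior Q) (arcs_through A Q) = {R \<in> pieces disk A. interior R \<subseteq> interior Q}"
  using pieces_arcs_through(2)[OF slit_region_fine BA] .

lemma tessellation_piece: "Q \<in> pieces disk B \<Longrightarrow> tessellation Q (arcs_through A Q)"
  using A by (intro tessellation_arcs_through[OF slit_region_fine _ _ BA]) (auto simp: disk_tessellation_def)

lemma pad_face:
  assumes "x \<in> topspace (cell X A)" "Q \<in> pieces disk B"
  shows "restrict (pad x) (pieces (interior Q) (arcs_through A Q)) \<in> topspace (face_space X Q (arcs_through A Q))"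
  using assms pieces_in_piece pad_in by (intro restrict_in_face_space) auto

text \<open>A triangle has no diagonals, so it is not cut further. Hence non-triangular fine pieces lie in
  non-triangular coarse pieces, and their coordinates are seen by \<open>cell_incl\<close>.\<close>

lemma triangle_piece:
  assumes Q: "Q \<in> pieces disk B" "triangle Q" and R: "R \<in> pieces disk A" "interior R \<subseteq> interior Q"
  shows "R = Q"
proof -
  have "arcs_through A Q = {}"
    using tessellation_piece[OF Q(1)] triangle_no_diagonals[OF Q(2)] by (simp add: tessellation_def)
  then have "pieces (interior Q) (arcs_through A Q) = {Q}"
    using pieces_empty closure_interior_polygon[OF polygon_coarse_piece[OF Q(1)]] by simp
  then show ?thesis using pieces_in_piece[OF Q(1)] R by auto
qed

lemma cell_incl_cont: "continuous_map (cell X A) (cell X B) (cell_incl X J A B)"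
proof -
  have "continuous_map (cell X A) (X Q)
     (\<lambda>x. J Q (arcs_through A Q) (restrict (pad x) (pieces (interior Q) (arcs_through A Q))))"
    if Q: "Q \<in> nontriangular_pieces B" for Q
  proof -
    have Q': "Q \<in> pieces disk B" using Q by (simp add: nontriangular_pieces_def)
    have "continuous_map (cell X A) (X R) (\<lambda>x. pad x R)" if "R \<in> pieces disk A" for R
    proof (cases "triangle R")
      case True
      then obtain y where "topspace (X R) = {y}" using triangle_space by blast
      then show ?thesis using True by (simp add: pad_def)
    next
      case False
      then show ?thesis
        using that unfolding pad_def cell_def
        by (simp add: continuous_map_product_projection nontriangular_pieces_def)
    qed
    then have "continuous_map (cell X A) (face_space X Q (arcs_through A Q))
        (\<lambda>x. restrict (pad x) (pieces (interior Q) (arcs_through A Q)))"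
      using pieces_in_piece[OF Q'] unfolding face_space_def
      by (auto simp: continuous_map_componentwise)
    from continuous_map_compose[OF this J_embedding(1)[OF polygon_coarse_piece[OF Q'] tessellation_piece[OF Q']]]
    show ?thesis by (simp add: o_def)
  qed
  then show ?thesis
    unfolding cell_incl_eq cell_def[of X B] continuous_map_componentwise by auto
qed

text \<open>Every coordinate of a point of \<open>cell X A\<close> belongs to a fine piece inside some non-triangular coarse
  piece \<open>Q\<close>, and can be recovered because the face inclusion into \<open>X Q\<close> is injective.\<close>

lemma cell_incl_inj: "inj_on (cell_incl X J A B) (topspace (cell X A))"
proof (rule inj_onI)
  fix x y assume x: "x \<in> topspace (cell X A)" and y: "y \<in> topspace (cell X A)"
    and eq: "cell_incl X J A B x = cell_incl X J A B y"
  have "x R = y R" if R: "R \<in> nontriangular_pieces A" for R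
  proof -
    have R': "R \<in> pieces disk A" "\<not> triangle R" using R by (auto simp: nontriangular_pieces_def)
    obtain Q where Q: "Q \<in> pieces disk B" "interior R \<subseteq> interior Q"
      using piece_superset[OF slit_region_fine BA R'(1)] by blast
    have nt: "\<not> triangle Q" using triangle_piece[OF Q(1) _ R'(1) Q(2)] R' by blast
    let ?p = "pieces (interior Q) (arcs_through A Q)"
    have "J Q (arcs_through A Q) (restrict (pad x) ?p) = J Q (arcs_through A Q) (restrict (pad y) ?p)"
      using fun_cong[OF eq, of Q] Q nt by (simp add: cell_incl_eq nontriangular_pieces_def)
    then have "restrict (pad x) ?p = restrict (pad y) ?p"
      using J_embedding(2)[OF polygon_coarse_piece tessellation_piece, OF Q(1) Q(1)] pad_face[OF x Q(1)] pad_face[OF y Q(1)]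
      by (meson inj_onD)
    moreover have "R \<in> ?p" using pieces_in_piece Q R' by auto
    ultimately show ?thesis using R' by (metis pad_def restrict_apply')
  qed
  then show "x = y" using x y unfolding topspace_cell by (auto intro: PiE_ext)
qed

end

lemma cell_incl_refl:
  assumes A: "disk_tessellation A" and x: "x \<in> topspace (cell X A)"
  shows "cell_incl X J A A x = x"
proof
  fix Q show "cell_incl X J A A x Q = x Q"
  proof (cases "Q \<in> nontriangular_pieces A")
    case True
    then have Q: "Q \<in> pieces disk A" "\<not> triangle Q" by (auto simp: nontriangular_pieces_def)
    have Qp: "polygon Q" using polygon_coarse_piece[OF A A order_refl Q(1)] .
    have a: "arcs_through A Q = {}" using pieceD(5)[OF slit_region_fine[OF A A order_refl] Q(1)] by (auto simp: arcs_through_def)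
    have p: "pieces (interior Q) {} = {Q}"
      using pieces_empty closure_interior_polygon[OF Qp] by simp
    have "restrict (pad x) {Q} \<in> topspace (face_space X Q {})"
      using pad_face[OF A A order_refl x Q(1)] a p by simp
    then show ?thesis using True a p J_empty[OF Qp] Q by (simp add: cell_incl_eq pad_def)
  next
    case False
    then show ?thesis using x by (auto simp: cell_incl_eq topspace_cell PiE_iff extensional_def)
  qed
qed

text \<open>In each piece of \<open>D\<close> this is \<open>J_refine\<close>, applied to the tessellations that \<open>A\<close> and \<open>B\<close> induce on it.
  At triangular intermediate pieces both sides take the only available value.\<close>

lemma cell_incl_comp:
  assumes A: "disk_tessellation A" and B: "disk_tessellation B" and D: "disk_tessellation D"
    and BA: "B \<subseteq> A" and DB: "D \<subseteq> B" and x: "x \<in> topspace (cell X A)"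
  shows "cell_incl X J B D (cell_incl X J A B x) = cell_incl X J A D x"
proof -
  have DA: "D \<subseteq> A" using BA DB by blast
  let ?y = "cell_incl X J A B x"
  have "J Q (arcs_through B Q) (restrict (pad ?y) (pieces (interior Q) (arcs_through B Q))) =
        J Q (arcs_through A Q) (restrict (pad x) (pieces (interior Q) (arcs_through A Q)))"
    if Q: "Q \<in> nontriangular_pieces D" for Q
  proof -
    let ?\<alpha> = "arcs_through A Q" and ?\<beta> = "arcs_through B Q"
    let ?x = "restrict (pad x) (pieces (interior Q) ?\<alpha>)"
    have Q': "Q \<in> pieces disk D" using Q by (simp add: nontriangular_pieces_def)
    have Qp: "polygon Q" using polygon_coarse_piece[OF B D DB Q'] .
    have x': "?x \<in> topspace (face_space X Q ?\<alpha>)" using pad_face[OF A D DA x Q'] .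
    have \<beta>: "?\<beta> \<subseteq> ?\<alpha>" using BA by (auto simp: arcs_through_def)
    have \<alpha>: "tessellation Q ?\<alpha>" using tessellation_piece[OF A D DA Q'] .
    have "J Q ?\<alpha> ?x = J Q ?\<beta> (\<lambda>R \<in> pieces (interior Q) ?\<beta>.
           J R (arcs_through ?\<alpha> R) (restrict ?x (pieces (interior R) (arcs_through ?\<alpha> R))))"
      by (rule J_refine[OF Qp \<alpha> \<beta> x'])
    also have "\<dots> = J Q ?\<beta> (restrict (pad ?y) (pieces (interior Q) ?\<beta>))"
    proof (intro arg_cong[where f = "J Q ?\<beta>"] restrict_ext)
      fix R assume R: "R \<in> pieces (interior Q) ?\<beta>"
      then have R': "R \<in> pieces disk B" "interior R \<subseteq> interior Q"
        using pieces_in_piece[OF B D DB Q'] by auto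
      have a: "arcs_through ?\<alpha> R = arcs_through A R" using R' by (auto simp: arcs_through_def)
      have Rp: "polygon R" using polygon_coarse_piece[OF A B BA R'(1)] .
      have "pieces (interior R) (arcs_through A R) \<subseteq> pieces (interior Q) ?\<alpha>"
        using pieces_in_piece[OF A D DA Q'] pieces_in_piece[OF A B BA R'(1)] R' by auto
      then have r: "restrict ?x (pieces (interior R) (arcs_through A R)) = restrict (pad x) (pieces (interior R) (arcs_through A R))"
        by (auto simp: restrict_def fun_eq_iff)
      let ?j = "J R (arcs_through A R) (restrict (pad x) (pieces (interior R) (arcs_through A R)))"
      have j: "?j \<in> topspace (X R)"
        using J_embedding(3)[OF Rp tessellation_piece[OF A B BA R'(1)] pad_face[OF A B BA x R'(1)]] .
      have "?j = pad ?y R"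
      proof (cases "triangle R")
        case True
        then show ?thesis using the_triangle_point[OF True j] by (simp add: pad_def)
      next
        case False
        then have "R \<in> nontriangular_pieces B" using R' by (simp add: nontriangular_pieces_def)
        moreover have "pad ?y R = ?y R" using False by (simp add: pad_def)
        ultimately show ?thesis by (simp add: cell_incl_eq)
      qed
      then show "J R (arcs_through ?\<alpha> R) (restrict ?x (pieces (interior R) (arcs_through ?\<alpha> R))) = pad ?y R"
        using a r by simp
    qed
    finally show ?thesis ..
  qed
  then show ?thesis unfolding cell_incl_eq[of B D] cell_incl_eq[of A D] by (intro restrict_ext) blast
qed

lemma cell_extensor:
  assumes "disk_tessellation A"
  shows "compact_space (cell X A)" "Hausdorff_space (cell X A)" "topspace (cell X A) \<noteq> {}"
    "extends_into (prod_topology (top_of_set {0..1::real}) (cell X A)) (cell X A)"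
proof -
  have poly: "polygon Q" if "Q \<in> nontriangular_pieces A" for Q
    using assms that by (auto simp: disk_tessellation_def nontriangular_pieces_def)
  have c: "compact_space (X Q)" and H: "Hausdorff_space (X Q)" and n: "topspace (X Q) \<noteq> {}"
    and e: "normal_space Z \<Longrightarrow> extends_into Z (X Q)"
    if "polygon Q" for Q and Z :: "(real \<times> (complex set \<Rightarrow> 'a)) topology"
  proof -
    obtain h where h: "homeomorphic_map (unit_ball (card (polygon_vertices Q) - 3)) (X Q) h"
      using associahedron_ball[OF \<open>polygon Q\<close>] by blast
    then have hs: "unit_ball (card (polygon_vertices Q) - 3) homeomorphic_space X Q"
      using homeomorphic_space by blast
    show "compact_space (X Q)" using homeomorphic_compact_space[OF hs] compact_unit_ball by blast
    show "Hausdorff_space (X Q)" using homeomorphic_Hausdorff_space[OF hs] Hausdorff_unit_ball by blast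
    show "topspace (X Q) \<noteq> {}"
      using homeomorphic_imp_surjective_map[OF h] zero_in_unit_ball by blast
    show "normal_space Z \<Longrightarrow> extends_into Z (X Q)"
      using extends_into_homeomorphic[OF extends_into_unit_ball h] by blast
  qed
  show C: "compact_space (cell X A)"
    unfolding cell_def using c poly by (simp add: compact_space_product_topology)
  show HA: "Hausdorff_space (cell X A)"
    unfolding cell_def using H poly by (simp add: Hausdorff_space_product_topology)
  show "topspace (cell X A) \<noteq> {}"
    unfolding topspace_cell using n poly by (simp add: PiE_eq_empty_iff)
  have "normal_space (prod_topology (top_of_set {0..1::real}) (cell X A))"
    by (rule compact_Hausdorff_or_regular_imp_normal_space)
       (use C HA in \<open>auto simp: compact_space_prod_topology Hausdorff_space_prod_topology compact_space_subtopology Hausdorff_space_subtopology\<close>)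
  then show "extends_into (prod_topology (top_of_set {0..1::real}) (cell X A)) (cell X A)"
    unfolding cell_def using e poly by (intro extends_into_product) auto
qed

end

section \<open>Points, chords and triangles of the circle\<close>

abbreviation disk_radius :: real where "disk_radius \<equiv> 1 / (2 * pi)"

lemma closure_disk: "closure disk = cball 0 disk_radius"
  by (simp add: disk_def)

text \<open>Points of a sphere are extreme, since the norm is strictly convex.\<close>

lemma extreme_point_cball:
  fixes v :: complex
  assumes "norm v = r" shows "v extreme_point_of cball 0 r"
  unfolding extreme_point_of_def
proof (intro conjI ballI notI)
  show "v \<in> cball 0 r" using assms by simp
  fix a b assume "a \<in> cball 0 r" "b \<in> cball 0 r" "v \<in> open_segment a b"
  then show False using dist_decreases_open_segment[of v a b 0] assms by auto
qed

lemma open_segment_in_ball: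
  fixes a b :: complex
  assumes "norm a \<le> r" "norm b \<le> r"
  shows "open_segment a b \<subseteq> ball 0 r"
proof
  fix z assume "z \<in> open_segment a b"
  then show "z \<in> ball 0 r" using dist_decreases_open_segment[of z a b 0] assms by auto
qed

lemma norm_circle_param: "norm (circle_param t) = disk_radius"
  by (simp add: circle_param_def norm_divide)

lemma circle_param_not_in_disk: "circle_param t \<notin> disk"
  by (simp add: disk_def norm_circle_param)

lemma circle_param_neq:
  assumes "x < y" "y < x + 1" shows "circle_param x \<noteq> circle_param y"
proof
  assume "circle_param x = circle_param y"
  then have "cis (2 * pi * y) = cis (2 * pi * x)" by (simp add: circle_param_def)
  then have "sin (2 * pi * y) = sin (2 * pi * x) \<and> cos (2 * pi * y) = cos (2 * pi * x)"
    by (simp add: complex_eq_iff)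
  then obtain n :: int where "2 * pi * y = 2 * pi * x + 2 * pi * n"
    using sin_cos_eq_iff by blast
  then have "2 * pi * y = 2 * pi * (x + n)" by (simp add: algebra_simps)
  then have "y = x + n" by simp
  then show False using assms by simp
qed

lemma chord_spanning:
  assumes "circle_param x \<noteq> circle_param y" shows "spanning_chord disk (chord x y)"
  unfolding spanning_chord_def chord_def closure_disk
  using assms extreme_point_cball[OF norm_circle_param] open_segment_in_ball[of "circle_param x" disk_radius "circle_param y"]
  by (intro exI[of _ "circle_param x"] exI[of _ "circle_param y"]) (simp add: norm_circle_param disk_def)

lemma chord_in_disk:
  assumes "circle_param x \<noteq> circle_param y"
  shows "chord x y \<inter> disk = open_segment (circle_param x) (circle_param y)"
  using open_segment_in_ball[of "circle_param x" disk_radius "circle_param y"] circle_param_not_in_disk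
  unfolding chord_def closed_segment_eq_open disk_def by (auto simp: norm_circle_param)

text \<open>The affine function that vanishes on the line through \<open>circle_param x\<close> and \<open>circle_param y\<close>
  (\<open>side_ends\<close>) and whose gradient is the unit vector towards the midpoint of the circular arc from \<open>x\<close>
  to \<open>y\<close>. It turns questions about chords into inequalities between parameters.\<close>

definition side :: "real \<Rightarrow> real \<Rightarrow> complex \<Rightarrow> real" where
  "side x y z = cis (pi * (x + y)) \<bullet> z - disk_radius * cos (pi * (y - x))"

text \<open>On the circle, \<open>side\<close> compares the distance from the midpoint parameter \<open>(x + y) / 2\<close> with half the
  length of the arc.\<close>

lemma side_circle_param:
  "side x y (circle_param t) = disk_radius * (cos (pi * (2 * t - (x + y))) - cos (pi * (y - x)))"
proof -
  have "cos (pi * (2 * t - (x + y))) = cos (2 * pi * t - pi * (x + y))" by (simp add: algebra_simps)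
  also have "\<dots> = cos (2 * pi * t) * cos (pi * (x + y)) + sin (2 * pi * t) * sin (pi * (x + y))"
    by (rule cos_diff)
  finally show ?thesis
    by (simp add: side_def circle_param_def inner_complex_def right_diff_distrib distrib_left mult.commute mult.left_commute)
qed

lemma side_ends: "side x y (circle_param x) = 0" "side x y (circle_param y) = 0"
proof -
  show "side x y (circle_param x) = 0"
    using cos_minus[of "pi * (y - x)"] unfolding side_circle_param by (simp add: algebra_simps)
  show "side x y (circle_param y) = 0"
    unfolding side_circle_param by (simp add: algebra_simps)
qed

lemma side_inside_pos:
  assumes "x < t" "t < y" "y \<le> x + 1" shows "0 < side x y (circle_param t)"
proof -
  have "cos (pi * (y - x)) < cos \<bar>pi * (2 * t - (x + y))\<bar>"
  proof (rule cos_monotone_0_pi)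
    show "\<bar>pi * (2 * t - (x + y))\<bar> < pi * (y - x)" using assms by (simp add: abs_mult)
    show "pi * (y - x) \<le> pi" using assms by simp
  qed simp
  then show ?thesis unfolding side_circle_param cos_abs_real by simp
qed

lemma side_inside_nonneg:
  assumes "x \<le> t" "t \<le> y" "y \<le> x + 1" shows "0 \<le> side x y (circle_param t)"
  using side_inside_pos[of x t y] side_ends[of x y] assms by (cases "t = x \<or> t = y") auto

lemma side_outside_nonpos:
  assumes "0 \<le> x" "x \<le> y" "y \<le> 1" "0 \<le> t" "t \<le> 1" "t \<le> x \<or> y \<le> t"
  shows "side x y (circle_param t) \<le> 0"
proof -
  let ?u = "\<bar>2 * t - (x + y)\<bar>"
  have u: "y - x \<le> ?u" "?u \<le> 2 - (y - x)" using assms by linarith+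
  have "cos (pi * ?u) \<le> cos (pi * (y - x))"
  proof (cases "?u \<le> 1")
    case True
    then show ?thesis using u assms by (intro cos_monotone_0_pi_le) auto
  next
    case False
    have "cos (pi * (2 - ?u)) \<le> cos (pi * (y - x))"
      using u assms False by (intro cos_monotone_0_pi_le) auto
    moreover have "cos (pi * (2 - ?u)) = cos (2 * pi - pi * ?u)" by (simp add: algebra_simps)
    ultimately show ?thesis by (simp add: cos_diff)
  qed
  moreover have "cos (pi * ?u) = cos (pi * (2 * t - (x + y)))"
    using cos_abs_real[of "pi * (2 * t - (x + y))"] by (simp add: abs_mult)
  ultimately show ?thesis unfolding side_circle_param by (intro mult_nonneg_nonpos) auto
qed

lemma side_convex_combination3:
  assumes "u + v + w = 1"
  shows "side x y (u *\<^sub>R p + v *\<^sub>R q + w *\<^sub>R s) = u * side x y p + v * side x y q + w * side x y s"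
proof -
  define c where "c = disk_radius * cos (pi * (y - x))"
  have "c = u * c + v * c + w * c" using assms by (metis distrib_right mult_1)
  then show ?thesis unfolding side_def c_def[symmetric] by (simp add: inner_right_distrib right_diff_distrib)
qed

lemma side_convex_combination:
  assumes "u + v = 1"
  shows "side x y (u *\<^sub>R p + v *\<^sub>R q) = u * side x y p + v * side x y q"
  using side_convex_combination3[of u v 0 x y p q 0] assms by simp

lemma side_zero_imp_chord:
  assumes "circle_param x \<noteq> circle_param y" "norm z \<le> disk_radius" "side x y z = 0"
  shows "z \<in> chord x y"
  unfolding chord_def
proof (rule on_line_through_extreme_points)
  show "circle_param x extreme_point_of cball 0 disk_radius" "circle_param y extreme_point_of cball 0 disk_radius"
    using extreme_point_cball[OF norm_circle_param] by auto
  show "cis (pi * (x + y)) \<noteq> 0" by simp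
  show "cis (pi * (x + y)) \<bullet> circle_param y = cis (pi * (x + y)) \<bullet> circle_param x"
    "cis (pi * (x + y)) \<bullet> z = cis (pi * (x + y)) \<bullet> circle_param x"
    using side_ends[of x y] assms(3) by (auto simp: side_def)
qed (use assms in auto)

lemma side_nonneg_hull:
  assumes "\<And>p. p \<in> V \<Longrightarrow> 0 \<le> side x y p"
  shows "convex hull V \<subseteq> {z. 0 \<le> side x y z}" "interior (convex hull V) \<subseteq> {z. 0 < side x y z}"
proof -
  have "convex hull V \<subseteq> {z. disk_radius * cos (pi * (y - x)) \<le> cis (pi * (x + y)) \<bullet> z}"
    by (rule hull_minimal) (use assms in \<open>auto simp: side_def convex_halfspace_ge\<close>)
  from this interior_mono[OF this] show "convex hull V \<subseteq> {z. 0 \<le> side x y z}"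
      "interior (convex hull V) \<subseteq> {z. 0 < side x y z}"
    by (auto simp: side_def)
qed

lemma side_nonpos_hull:
  assumes "\<And>p. p \<in> V \<Longrightarrow> side x y p \<le> 0"
  shows "convex hull V \<subseteq> {z. side x y z \<le> 0}" "interior (convex hull V) \<subseteq> {z. side x y z < 0}"
proof -
  have "convex hull V \<subseteq> {z. cis (pi * (x + y)) \<bullet> z \<le> disk_radius * cos (pi * (y - x))}"
    by (rule hull_minimal) (use assms in \<open>auto simp: side_def convex_halfspace_le\<close>)
  from this interior_mono[OF this] show "convex hull V \<subseteq> {z. side x y z \<le> 0}"
      "interior (convex hull V) \<subseteq> {z. side x y z < 0}"
    by (auto simp: side_def)
qed

definition arc_triangle :: "real \<Rightarrow> real \<Rightarrow> real \<Rightarrow> complex set" where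
  "arc_triangle x t y = interior (convex hull {circle_param x, circle_param t, circle_param y})"

text \<open>The middle point lies strictly on the positive side of the line through the other two.\<close>

lemma arc_points_not_collinear:
  assumes "x < t" "t < y" "y < x + 1"
  shows "\<not> collinear {circle_param x, circle_param t, circle_param y}"
proof
  let ?p = "circle_param x" and ?q = "circle_param t" and ?s = "circle_param y"
  assume "collinear {?p, ?q, ?s}"
  then have "collinear {?p, ?s, ?q}" by (simp add: insert_commute)
  moreover have "?p \<noteq> ?s" using circle_param_neq assms by simp
  ultimately have "?q \<in> affine hull {?p, ?s}" using collinear_3_affine_hull by blast
  then obtain u v where "?q = u *\<^sub>R ?p + v *\<^sub>R ?s" "u + v = 1" unfolding affine_hull_2 by blast
  then have "side x y ?q = 0" using side_convex_combination[of u v x y ?p ?s] side_ends[of x y] by simp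
  then show False using side_inside_pos[of x t y] assms by simp
qed

lemma open_triangle_arc_triangle:
  assumes "x < t" "t < y" "y < x + 1" shows "open_triangle (arc_triangle x t y)"
  using arc_points_not_collinear[OF assms] unfolding open_triangle_def arc_triangle_def by blast

lemma noncollinear_affine_hull:
  fixes p q s :: complex
  assumes "\<not> collinear {p, q, s}" shows "affine hull {p, q, s} = UNIV"
proof -
  \<comment> \<open>The plane has dimension two, so an affine dimension above one is full.\<close>
  have "aff_dim {p, q, s} > 1" using assms collinear_aff_dim by (meson not_le)
  moreover have "aff_dim {p, q, s} \<le> 2" using aff_dim_le_DIM[of "{p, q, s}"] by simp
  ultimately have "aff_dim {p, q, s} = int DIM(complex)" by simp
  then show ?thesis by (simp only: aff_dim_eq_full)
qed

lemma noncollinear_interior: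
  fixes p q s :: complex
  assumes "\<not> collinear {p, q, s}" shows "interior (convex hull {p, q, s}) \<noteq> {}"
proof -
  have "rel_interior (convex hull {p, q, s}) = interior (convex hull {p, q, s})"
    using noncollinear_affine_hull[OF assms] by (intro rel_interior_interior) simp
  then show ?thesis using rel_interior_eq_empty[of "convex hull {p, q, s}"] by simp
qed

text \<open>The open triangle is the cap over the arc from \<open>x\<close> to \<open>y\<close> minus the closed caps over its two halves.
  Up to nonzero factors the three functions are barycentric coordinates: each vanishes at two vertices
  and has the right sign at the third.\<close>

lemma arc_triangle_iff:
  assumes "0 \<le> x" "x < t" "t < y" "y \<le> 1" "y < x + 1"
  shows "arc_triangle x t y = {z. 0 < side x y z \<and> side x t z < 0 \<and> side t y z < 0}"
proof
  let ?p = "circle_param x" and ?q = "circle_param t" and ?s = "circle_param y"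
  show "arc_triangle x t y \<subseteq> {z. 0 < side x y z \<and> side x t z < 0 \<and> side t y z < 0}"
  proof -
    have "arc_triangle x t y \<subseteq> {z. 0 < side x y z}"
      unfolding arc_triangle_def using assms
      by (intro side_nonneg_hull(2)) (auto intro!: side_inside_nonneg)
    moreover have "arc_triangle x t y \<subseteq> {z. side x t z < 0}" "arc_triangle x t y \<subseteq> {z. side t y z < 0}"
      unfolding arc_triangle_def using assms
      by (intro side_nonpos_hull(2); auto intro!: side_outside_nonpos)+
    ultimately show ?thesis by blast
  qed
  let ?S = "{z. 0 < side x y z \<and> side x t z < 0 \<and> side t y z < 0}"
  have "?S \<subseteq> convex hull {?p, ?q, ?s}"
  proof
    fix z assume z: "z \<in> ?S"
    have "z \<in> affine hull {?p, ?q, ?s}"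
      using noncollinear_affine_hull arc_points_not_collinear[of x t y] assms by simp
    then obtain u v w where uvw: "u + v + w = 1" "z = u *\<^sub>R ?p + v *\<^sub>R ?q + w *\<^sub>R ?s"
      unfolding affine_hull_3 by blast
    have pq: "side x y ?q > 0" using side_inside_pos assms by simp
    \<comment> \<open>A point of the circle at which \<open>side a b\<close> vanishes is an end of the chord.\<close>
    have strict: "side a b (circle_param c) < 0"
      if "0 \<le> a" "a < b" "b \<le> 1" "0 \<le> c" "c \<le> 1" "c < a \<or> b < c" "b < a + 1" "c < a + 1" "b < c + 1" for a b c
    proof -
      have "side a b (circle_param c) \<noteq> 0"
      proof
        assume 0: "side a b (circle_param c) = 0"
        have ab: "circle_param a \<noteq> circle_param b" using circle_param_neq that by simp
        have "circle_param c \<in> chord a b"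
          by (rule side_zero_imp_chord[OF ab _ 0]) (simp add: norm_circle_param)
        moreover have "circle_param c \<notin> open_segment (circle_param a) (circle_param b)"
          using chord_in_disk[OF ab] circle_param_not_in_disk by blast
        ultimately have "circle_param c = circle_param a \<or> circle_param c = circle_param b"
          unfolding chord_def closed_segment_eq_open by blast
        then show False
          using circle_param_neq[of a c] circle_param_neq[of c a] circle_param_neq[of b c] circle_param_neq[of c b] that by auto
      qed
      then show ?thesis using side_outside_nonpos[of a b c] that by auto
    qed
    have sxt: "side x t ?s < 0" and sty: "side t y ?p < 0" using strict assms by auto
    have "side x y z = v * side x y ?q"
      unfolding uvw(2) side_convex_combination3[OF uvw(1)] by (simp add: side_ends)
    then have "0 \<le> v" using z pq by (simp add: zero_less_mult_iff)
    moreover have "side x t z = w * side x t ?s"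
      unfolding uvw(2) side_convex_combination3[OF uvw(1)] by (simp add: side_ends)
    then have "0 \<le> w" using z sxt by (simp add: mult_less_0_iff)
    moreover have "side t y z = u * side t y ?p"
      unfolding uvw(2) side_convex_combination3[OF uvw(1)] by (simp add: side_ends)
    then have "0 \<le> u" using z sty by (simp add: mult_less_0_iff)
    ultimately show "z \<in> convex hull {?p, ?q, ?s}" unfolding convex_hull_3 using uvw by blast
  qed
  moreover have "open ?S"
  proof -
    have "?S = {z. disk_radius * cos (pi * (y - x)) < cis (pi * (x + y)) \<bullet> z} \<inter>
      {z. cis (pi * (x + t)) \<bullet> z < disk_radius * cos (pi * (t - x))} \<inter>
      {z. cis (pi * (t + y)) \<bullet> z < disk_radius * cos (pi * (y - t))}"
      by (auto simp: side_def)
    then show ?thesis by (simp only: open_Int open_halfspace_gt open_halfspace_lt)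
  qed
  ultimately show "?S \<subseteq> arc_triangle x t y"
    unfolding arc_triangle_def by (simp add: interior_maximal)
qed

lemma arc_triangle_in_disk: "arc_triangle x t y \<subseteq> disk"
proof -
  have "convex hull {circle_param x, circle_param t, circle_param y} \<subseteq> cball 0 disk_radius"
    by (rule hull_minimal) (auto simp: norm_circle_param)
  then show ?thesis
    unfolding arc_triangle_def disk_def using interior_mono interior_cball by metis
qed

lemma closure_arc_triangle:
  assumes "x < t" "t < y" "y < x + 1"
  shows "closure (arc_triangle x t y) = convex hull {circle_param x, circle_param t, circle_param y}"
proof -
  have "closure (interior (convex hull {circle_param x, circle_param t, circle_param y})) =
        closure (convex hull {circle_param x, circle_param t, circle_param y})"
    by (rule convex_closure_interior[OF convex_convex_hull noncollinear_interior[OF arc_points_not_collinear[OF assms]]])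
  moreover have "closed (convex hull {circle_param x, circle_param t, circle_param y})"
    by (intro compact_imp_closed finite_imp_compact_convex_hull) simp
  ultimately show ?thesis unfolding arc_triangle_def by simp
qed

section \<open>The dyadic triangulation of the disk\<close>

definition dyadic_point :: "nat \<Rightarrow> nat \<Rightarrow> real" where
  "dyadic_point n m = real m / 2 ^ n"

text \<open>Two dyadic points are compared by writing them with a common denominator.\<close>

lemma dyadic_point_scale: "dyadic_point n m = dyadic_point (n + i) (m * 2 ^ i)"
  by (simp add: dyadic_point_def power_add)

lemma dyadic_point_Suc: "dyadic_point (Suc n) (2 * m) = dyadic_point n m"
  by (simp add: dyadic_point_def)

lemma dyadic_point_le_iff: "dyadic_point n m \<le> dyadic_point n j \<longleftrightarrow> m \<le> j"
  by (simp add: dyadic_point_def divide_le_cancel)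

lemma dyadic_point_less_iff: "dyadic_point n m < dyadic_point n j \<longleftrightarrow> m < j"
  by (simp add: dyadic_point_def divide_less_cancel)

lemma dyadic_point_bounds:
  assumes "1 \<le> n" "m < 2 ^ n"
  shows "0 \<le> dyadic_point n m" "dyadic_point n m < dyadic_point (Suc n) (2 * m + 1)" "dyadic_point (Suc n) (2 * m + 1) < dyadic_point n (m + 1)"
    "dyadic_point n (m + 1) \<le> 1" "dyadic_point n (m + 1) < dyadic_point n m + 1" "dyadic_point n m < dyadic_point n (m + 1)"
proof -
  show "0 \<le> dyadic_point n m" by (simp add: dyadic_point_def)
  show "dyadic_point n m < dyadic_point (Suc n) (2 * m + 1)" unfolding dyadic_point_Suc[of n m, symmetric] dyadic_point_less_iff by simp
  show "dyadic_point (Suc n) (2 * m + 1) < dyadic_point n (m + 1)" unfolding dyadic_point_Suc[of n "m + 1", symmetric] dyadic_point_less_iff by simp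
  have "real (m + 1) \<le> real (2 ^ n)" using assms(2) by linarith
  then show "dyadic_point n (m + 1) \<le> 1" by (simp add: dyadic_point_def)
  have "(2::real) ^ 1 \<le> 2 ^ n" using assms(1) by (intro power_increasing) auto
  then have "1 / (2::real) ^ n < 1" by simp
  moreover have "dyadic_point n (m + 1) = dyadic_point n m + 1 / 2 ^ n" by (simp add: dyadic_point_def add_divide_distrib)
  ultimately show "dyadic_point n (m + 1) < dyadic_point n m + 1" by simp
  show "dyadic_point n m < dyadic_point n (m + 1)" unfolding dyadic_point_less_iff by simp
qed

text \<open>Standard dyadic intervals are nested or have disjoint interiors. Stated here for the two ends and the
  midpoint of one interval relative to a different one: they lie all in its left half, or all in its right
  half, or none of them is in its interior. The last case covers both disjoint intervals and intervals of
  lower level that contain it.\<close>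

lemma dyadic_position:
  assumes "(k, j) \<noteq> (n, m)"
  shows "(\<forall>t\<in>{dyadic_point k j, dyadic_point (Suc k) (2 * j + 1), dyadic_point k (j + 1)}. dyadic_point n m \<le> t \<and> t \<le> dyadic_point (Suc n) (2 * m + 1)) \<or>
    (\<forall>t\<in>{dyadic_point k j, dyadic_point (Suc k) (2 * j + 1), dyadic_point k (j + 1)}. dyadic_point (Suc n) (2 * m + 1) \<le> t \<and> t \<le> dyadic_point n (m + 1)) \<or>
    (\<forall>t\<in>{dyadic_point k j, dyadic_point (Suc k) (2 * j + 1), dyadic_point k (j + 1)}. t \<le> dyadic_point n m \<or> dyadic_point n (m + 1) \<le> t)"
proof -
  consider i where "k = Suc n + i" | "n = k" | i where "n = Suc k + i"
    by (metis less_imp_Suc_add add_Suc linorder_neqE_nat)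
  then show ?thesis
  proof cases
    case 1
    define f :: nat where "f = 2 ^ i"
    define a where "a = m * f"
    have I: "dyadic_point n m = dyadic_point (Suc k) (4 * a)" "dyadic_point (Suc n) (2 * m + 1) = dyadic_point (Suc k) (4 * a + 2 * f)"
      "dyadic_point n (m + 1) = dyadic_point (Suc k) (4 * a + 4 * f)"
      using dyadic_point_scale[of n m "Suc (Suc i)"] dyadic_point_scale[of "Suc n" "2 * m + 1" "Suc i"] dyadic_point_scale[of n "m + 1" "Suc (Suc i)"]
      by (simp_all add: 1 a_def f_def algebra_simps)
    have Jj: "dyadic_point k j = dyadic_point (Suc k) (2 * j)" "dyadic_point k (j + 1) = dyadic_point (Suc k) (2 * j + 2)"
      using dyadic_point_Suc[of k j] dyadic_point_Suc[of k "j + 1"] by simp_all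
    consider "j < 2 * a" | "2 * a \<le> j" "j < 2 * a + f" | "2 * a + f \<le> j" "j < 2 * a + 2 * f" | "2 * a + 2 * f \<le> j"
      by linarith
    then show ?thesis unfolding I Jj by cases (simp_all add: dyadic_point_le_iff)
  next
    case 2
    then have "j \<noteq> m" using assms by simp
    have I: "dyadic_point n m = dyadic_point (Suc n) (2 * m)" "dyadic_point n (m + 1) = dyadic_point (Suc n) (2 * m + 2)" for m
      using dyadic_point_Suc[of n m] dyadic_point_Suc[of n "m + 1"] by simp_all
    show ?thesis unfolding 2[symmetric] I using \<open>j \<noteq> m\<close> by (simp only: ball_simps dyadic_point_le_iff) presburger
  next
    case 3
    define f :: nat where "f = 2 ^ i"
    define a where "a = j * f"
    have Jj: "dyadic_point k j = dyadic_point (Suc n) (4 * a)" "dyadic_point (Suc k) (2 * j + 1) = dyadic_point (Suc n) (4 * a + 2 * f)"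
      "dyadic_point k (j + 1) = dyadic_point (Suc n) (4 * a + 4 * f)"
      using dyadic_point_scale[of k j "Suc (Suc i)"] dyadic_point_scale[of "Suc k" "2 * j + 1" "Suc i"] dyadic_point_scale[of k "j + 1" "Suc (Suc i)"]
      by (simp_all add: 3 a_def f_def algebra_simps)
    have I: "dyadic_point n m = dyadic_point (Suc n) (2 * m)" "dyadic_point n (m + 1) = dyadic_point (Suc n) (2 * m + 2)"
      using dyadic_point_Suc[of n m] dyadic_point_Suc[of n "m + 1"] by simp_all
    have "s \<le> m \<or> m + 1 \<le> s" for s by linarith
    from this[of "2 * a"] this[of "2 * a + f"] this[of "2 * a + 2 * f"]
    have "4 * a \<le> 2 * m \<or> 2 * m + 2 \<le> 4 * a" "4 * a + 2 * f \<le> 2 * m \<or> 2 * m + 2 \<le> 4 * a + 2 * f"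
      "4 * a + 4 * f \<le> 2 * m \<or> 2 * m + 2 \<le> 4 * a + 4 * f"
      by linarith+
    then show ?thesis unfolding I Jj by (simp only: ball_simps dyadic_point_le_iff) blast
  qed
qed

definition dyadic_arc :: "nat \<Rightarrow> nat \<Rightarrow> complex set" where
  "dyadic_arc n m = chord (dyadic_point n m) (dyadic_point n (m + 1))"

definition dyadic_triangle :: "nat \<Rightarrow> nat \<Rightarrow> complex set" where
  "dyadic_triangle n m = arc_triangle (dyadic_point n m) (dyadic_point (Suc n) (2 * m + 1)) (dyadic_point n (m + 1))"

lemma circle_param_0_1: "circle_param 1 = circle_param 0"
  by (simp add: circle_param_def)

text \<open>Both halves of the circle have the same chord, which is why \<open>A_F\<close> lists the diameter separately.\<close>

lemma dyadic_arc_1: "dyadic_arc 1 0 = chord 0 (1/2)" "dyadic_arc 1 1 = chord 0 (1/2)"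
  by (simp_all add: dyadic_arc_def dyadic_point_def chord_def circle_param_0_1 closed_segment_commute)

text \<open>A uniform description of the dyadic triangulation, in which the diameter is the arc of level one.\<close>

lemma A_F_eq: "A_F = {dyadic_arc n m | n m. 1 \<le> n \<and> m < 2 ^ n}"
proof
  show "A_F \<subseteq> {dyadic_arc n m | n m. 1 \<le> n \<and> m < 2 ^ n}"
  proof
    fix a assume "a \<in> A_F"
    then consider "a = dyadic_arc 1 0" | n m where "a = dyadic_arc n m" "n > 1" "m < 2 ^ n"
      unfolding A_F_def dyadic_arc_1(1) by (auto simp: dyadic_arc_def dyadic_point_def)
    then show "a \<in> {dyadic_arc n m | n m. 1 \<le> n \<and> m < 2 ^ n}"
    proof cases
      case 1 then show ?thesis by (intro CollectI exI[of _ 1] exI[of _ 0]) simp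
    next
      case 2 then show ?thesis by (auto intro: less_imp_le)
    qed
  qed
  show "{dyadic_arc n m | n m. 1 \<le> n \<and> m < 2 ^ n} \<subseteq> A_F"
  proof clarify
    fix n m :: nat assume nm: "1 \<le> n" "m < 2 ^ n"
    show "dyadic_arc n m \<in> A_F"
    proof (cases "n = 1")
      case True
      then have "m = 0 \<or> m = 1" using nm by auto
      then show ?thesis using True dyadic_arc_1 by (auto simp: A_F_def)
    next
      case False
      then have "n > 1" using nm by simp
      then show ?thesis using nm unfolding A_F_def dyadic_arc_def dyadic_point_def by blast
    qed
  qed
qed

lemma dyadic_arc_ends_neq:
  assumes "1 \<le> n" "m < 2 ^ n" shows "circle_param (dyadic_point n m) \<noteq> circle_param (dyadic_point n (m + 1))"
  using circle_param_neq dyadic_point_bounds[OF assms] by blast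

lemma dyadic_arc_hull: "dyadic_arc n m = convex hull {circle_param (dyadic_point n m), circle_param (dyadic_point n (m + 1))}"
  by (simp add: dyadic_arc_def chord_def segment_convex_hull)

lemma dyadic_triangle_iff:
  assumes "1 \<le> n" "m < 2 ^ n"
  shows "dyadic_triangle n m = {z. 0 < side (dyadic_point n m) (dyadic_point n (m + 1)) z \<and>
    side (dyadic_point n m) (dyadic_point (Suc n) (2 * m + 1)) z < 0 \<and> side (dyadic_point (Suc n) (2 * m + 1)) (dyadic_point n (m + 1)) z < 0}"
  unfolding dyadic_triangle_def using dyadic_point_bounds[OF assms] by (intro arc_triangle_iff) auto

text \<open>Each of the three edges of the triangle separates it from the hull of the points in the
  corresponding circular arc.\<close>

lemma dyadic_triangle_disjoint_hull:
  assumes nm: "1 \<le> n" "m < 2 ^ n" and V: "V \<subseteq> {0..1}"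
    and pos: "(\<forall>t\<in>V. dyadic_point n m \<le> t \<and> t \<le> dyadic_point (Suc n) (2 * m + 1)) \<or>
      (\<forall>t\<in>V. dyadic_point (Suc n) (2 * m + 1) \<le> t \<and> t \<le> dyadic_point n (m + 1)) \<or> (\<forall>t\<in>V. t \<le> dyadic_point n m \<or> dyadic_point n (m + 1) \<le> t)"
  shows "dyadic_triangle n m \<inter> convex hull (circle_param ` V) = {}"
proof -
  note b = dyadic_point_bounds[OF nm]
  let ?x = "dyadic_point n m" and ?t = "dyadic_point (Suc n) (2 * m + 1)" and ?y = "dyadic_point n (m + 1)"
  consider "\<forall>t\<in>V. ?x \<le> t \<and> t \<le> ?t" | "\<forall>t\<in>V. ?t \<le> t \<and> t \<le> ?y" | "\<forall>t\<in>V. t \<le> ?x \<or> ?y \<le> t"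
    using pos by blast
  then show ?thesis
  proof cases
    case 1
    have "convex hull (circle_param ` V) \<subseteq> {z. 0 \<le> side ?x ?t z}"
      by (rule side_nonneg_hull(1)) (use 1 b in \<open>auto intro!: side_inside_nonneg\<close>)
    then show ?thesis unfolding dyadic_triangle_iff[OF nm] by fastforce
  next
    case 2
    have "convex hull (circle_param ` V) \<subseteq> {z. 0 \<le> side ?t ?y z}"
      by (rule side_nonneg_hull(1)) (use 2 b in \<open>auto intro!: side_inside_nonneg\<close>)
    then show ?thesis unfolding dyadic_triangle_iff[OF nm] by fastforce
  next
    case 3
    have "convex hull (circle_param ` V) \<subseteq> {z. side ?x ?y z \<le> 0}"
      by (rule side_nonpos_hull(1)) (use 3 b V in \<open>auto intro!: side_outside_nonpos\<close>)
    then show ?thesis unfolding dyadic_triangle_iff[OF nm] by fastforce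
  qed
qed

lemma dyadic_triangle_disjoint_arc:
  assumes nm: "1 \<le> n" "m < 2 ^ n" and kj: "1 \<le> k" "j < 2 ^ k"
  shows "dyadic_triangle n m \<inter> dyadic_arc k j = {}"
proof -
  let ?V = "{dyadic_point k j, dyadic_point k (j + 1)}"
  have "dyadic_triangle n m \<inter> convex hull (circle_param ` ?V) = {}"
  proof (rule dyadic_triangle_disjoint_hull[OF nm])
    show "?V \<subseteq> {0..1}" using dyadic_point_bounds[OF kj] by auto
    show "(\<forall>t\<in>?V. dyadic_point n m \<le> t \<and> t \<le> dyadic_point (Suc n) (2 * m + 1)) \<or>
      (\<forall>t\<in>?V. dyadic_point (Suc n) (2 * m + 1) \<le> t \<and> t \<le> dyadic_point n (m + 1)) \<or> (\<forall>t\<in>?V. t \<le> dyadic_point n m \<or> dyadic_point n (m + 1) \<le> t)"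
      using dyadic_position[of k j n m] by (cases "(k, j) = (n, m)") auto
  qed
  then show ?thesis by (simp add: dyadic_arc_hull)
qed

lemma dyadic_triangle_disjoint_triangle:
  assumes nm: "1 \<le> n" "m < 2 ^ n" and kj: "1 \<le> k" "j < 2 ^ k" and ne: "(k, j) \<noteq> (n, m)"
  shows "dyadic_triangle n m \<inter> dyadic_triangle k j = {}"
proof -
  let ?V = "{dyadic_point k j, dyadic_point (Suc k) (2 * j + 1), dyadic_point k (j + 1)}"
  have "dyadic_triangle n m \<inter> convex hull (circle_param ` ?V) = {}"
    by (rule dyadic_triangle_disjoint_hull[OF nm _ dyadic_position[OF ne]]) (use dyadic_point_bounds[OF kj] in auto)
  moreover have "dyadic_triangle k j \<subseteq> convex hull (circle_param ` ?V)"
    unfolding dyadic_triangle_def arc_triangle_def using interior_subset by simp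
  ultimately show ?thesis by blast
qed

lemma chord_side_zero:
  assumes "z \<in> chord x y" shows "side x y z = 0"
proof -
  obtain u where "0 \<le> u" "u \<le> 1" "z = (1 - u) *\<^sub>R circle_param x + u *\<^sub>R circle_param y"
    using assms unfolding chord_def closed_segment_def by blast
  then show ?thesis using side_convex_combination[of "1 - u" u x y] by (simp add: side_ends)
qed

text \<open>By \<open>dyadic_position\<close> the ends of one arc are weakly on the same side of the other. A common point in
  the open disk is an interior point of the first arc, so both ends have to lie on the line of the second,
  and then the arcs coincide.\<close>

lemma dyadic_arcs_noncrossing:
  assumes nm: "1 \<le> n" "m < 2 ^ n" and kj: "1 \<le> k" "j < 2 ^ k"
    and z: "z \<in> dyadic_arc n m" "z \<in> dyadic_arc k j" "z \<in> disk"
  shows "dyadic_arc n m = dyadic_arc k j"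
proof (cases "(k, j) = (n, m)")
  case False
  let ?x = "dyadic_point n m" and ?t = "dyadic_point (Suc n) (2 * m + 1)" and ?y = "dyadic_point n (m + 1)"
  let ?a = "dyadic_point k j" and ?b = "dyadic_point k (j + 1)"
  note b = dyadic_point_bounds[OF nm] and b' = dyadic_point_bounds[OF kj]
  have ne: "circle_param ?x \<noteq> circle_param ?y" "circle_param ?a \<noteq> circle_param ?b"
    using dyadic_arc_ends_neq[OF nm] dyadic_arc_ends_neq[OF kj] by auto
  have "z \<in> open_segment (circle_param ?a) (circle_param ?b)"
    using z(2,3) chord_in_disk[OF ne(2)] by (auto simp: dyadic_arc_def)
  then obtain u where u: "0 < u" "u < 1" "z = (1 - u) *\<^sub>R circle_param ?a + u *\<^sub>R circle_param ?b"
    unfolding in_segment by blast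
  have "side ?x ?y z = 0" using z(1) chord_side_zero unfolding dyadic_arc_def by blast
  then have 0: "(1 - u) * side ?x ?y (circle_param ?a) + u * side ?x ?y (circle_param ?b) = 0"
    using side_convex_combination[of "1 - u" u ?x ?y "circle_param ?a" "circle_param ?b"] u(3) by simp
  have "(0 \<le> side ?x ?y (circle_param ?a) \<and> 0 \<le> side ?x ?y (circle_param ?b)) \<or>
        (side ?x ?y (circle_param ?a) \<le> 0 \<and> side ?x ?y (circle_param ?b) \<le> 0)"
  proof -
    consider "?x \<le> ?a \<and> ?a \<le> ?y \<and> ?x \<le> ?b \<and> ?b \<le> ?y" | "(?a \<le> ?x \<or> ?y \<le> ?a) \<and> (?b \<le> ?x \<or> ?y \<le> ?b)"
      using dyadic_position[OF False] b by fastforce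
    then show ?thesis
    proof cases
      case 1
      then show ?thesis using side_inside_nonneg[of ?x ?a ?y] side_inside_nonneg[of ?x ?b ?y] b by simp
    next
      case 2
      then show ?thesis using side_outside_nonpos[of ?x ?y ?a] side_outside_nonpos[of ?x ?y ?b] b b' by simp
    qed
  qed
  then have "side ?x ?y (circle_param ?a) = 0 \<and> side ?x ?y (circle_param ?b) = 0"
  proof
    assume s: "0 \<le> side ?x ?y (circle_param ?a) \<and> 0 \<le> side ?x ?y (circle_param ?b)"
    have "0 \<le> (1 - u) * side ?x ?y (circle_param ?a)" "0 \<le> u * side ?x ?y (circle_param ?b)"
      using s u by simp_all
    then have "(1 - u) * side ?x ?y (circle_param ?a) = 0 \<and> u * side ?x ?y (circle_param ?b) = 0"
      using 0 by linarith
    then show ?thesis using u by simp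
  next
    assume s: "side ?x ?y (circle_param ?a) \<le> 0 \<and> side ?x ?y (circle_param ?b) \<le> 0"
    have "(1 - u) * side ?x ?y (circle_param ?a) \<le> 0" "u * side ?x ?y (circle_param ?b) \<le> 0"
      using s u by (simp_all add: mult_nonneg_nonpos)
    then have "(1 - u) * side ?x ?y (circle_param ?a) = 0 \<and> u * side ?x ?y (circle_param ?b) = 0"
      using 0 by linarith
    then show ?thesis using u by simp
  qed
  then have "circle_param ?a \<in> chord ?x ?y" "circle_param ?b \<in> chord ?x ?y"
    using side_zero_imp_chord[OF ne(1)] by (simp_all add: norm_circle_param)
  moreover have "circle_param s \<notin> open_segment (circle_param ?x) (circle_param ?y)" for s
    using chord_in_disk[OF ne(1)] circle_param_not_in_disk by blast
  ultimately have "circle_param ?a \<in> {circle_param ?x, circle_param ?y}" "circle_param ?b \<in> {circle_param ?x, circle_param ?y}"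
    unfolding chord_def closed_segment_eq_open by auto
  then have "{circle_param ?a, circle_param ?b} = {circle_param ?x, circle_param ?y}" using ne by auto
  then show ?thesis by (simp add: dyadic_arc_hull)
qed simp

lemma noncrossing_A_F: "noncrossing disk A_F"
  unfolding noncrossing_def pairwise_def A_F_eq using dyadic_arcs_noncrossing by blast

lemma A_F_dyadic_arcs: "A_F \<subseteq> dyadic_arcs"
proof
  fix a assume "a \<in> A_F"
  then obtain n m where nm: "a = dyadic_arc n m" "1 \<le> n" "m < 2 ^ n" unfolding A_F_eq by blast
  have "dyadic_point n k \<in> dyadics" if "0 \<le> dyadic_point n k" "dyadic_point n k \<le> 1" for k
  proof -
    have "dyadic_point n k = real_of_int (int k) / 2 ^ n" by (simp add: dyadic_point_def)
    then show ?thesis using that unfolding dyadics_def by (metis (mono_tags, lifting) IntI atLeastAtMost_iff mem_Collect_eq)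
  qed
  then show "a \<in> dyadic_arcs"
    using nm dyadic_arc_ends_neq[OF nm(2,3)] dyadic_point_bounds[OF nm(2,3)] unfolding dyadic_arcs_def dyadic_arc_def by force
qed

text \<open>Arcs of high level are close to the circle, at a distance of order \<open>1 / 4 ^ n\<close>.\<close>

lemma level_bound:
  assumes "\<rho> < disk_radius" shows "\<exists>N. \<forall>n\<ge>N. \<rho> < disk_radius * cos (pi / 2 ^ n)"
proof -
  have "(\<lambda>n. (1/2::real) ^ n) \<longlonglongrightarrow> 0"
    by (rule LIMSEQ_power_zero) simp
  then have "(\<lambda>n. disk_radius * cos (pi * (1/2) ^ n)) \<longlonglongrightarrow> disk_radius * cos (pi * 0)"
    by (intro tendsto_mult tendsto_const tendsto_cos)
  moreover have "pi * (1/2) ^ n = pi / 2 ^ n" for n by (simp add: power_divide)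
  ultimately have "(\<lambda>n. disk_radius * cos (pi / 2 ^ n)) \<longlonglongrightarrow> disk_radius"
    by (simp only: mult_zero_right cos_zero mult_1_right)
  from order_tendstoD(1)[OF this assms] show ?thesis by (simp add: eventually_sequentially)
qed

lemma side_norm: "side x y z \<le> norm z - disk_radius * cos (pi * (y - x))"
  using norm_cauchy_schwarz[of "cis (pi * (x + y))" z] by (simp add: side_def)

lemma dyadic_point_length: "dyadic_point n (m + 1) - dyadic_point n m = 1 / 2 ^ n"
  by (simp add: dyadic_point_def add_divide_distrib)

lemma side_level:
  "side (dyadic_point n m) (dyadic_point n (m + 1)) z \<le> norm z - disk_radius * cos (pi / 2 ^ n)"
  using side_norm[of "dyadic_point n m" "dyadic_point n (m + 1)" z] dyadic_point_length[of n m] by simp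

text \<open>Start with the half-disk that contains \<open>z\<close>. By \<open>level_bound\<close> the point lies in caps of only finitely
  many levels; in a cap of the highest level it lies beyond neither of the two shorter chords, hence in
  the triangle.\<close>

lemma dyadic_triangles_cover:
  assumes z: "z \<in> disk" "z \<notin> \<Union>A_F"
  shows "\<exists>n m. 1 \<le> n \<and> m < 2 ^ n \<and> z \<in> dyadic_triangle n m"
proof -
  have nz: "norm z < disk_radius" using z(1) by (simp add: disk_def)
  have nonzero: "side (dyadic_point n m) (dyadic_point n (m + 1)) z \<noteq> 0" if "1 \<le> n" "m < 2 ^ n" for n m
  proof
    assume "side (dyadic_point n m) (dyadic_point n (m + 1)) z = 0"
    then have "z \<in> dyadic_arc n m"
      using side_zero_imp_chord[OF dyadic_arc_ends_neq[OF that], of z] nz unfolding dyadic_arc_def by simp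
    then show False using z(2) that unfolding A_F_eq by blast
  qed
  let ?S = "{n. 1 \<le> n \<and> (\<exists>m<2 ^ n. 0 < side (dyadic_point n m) (dyadic_point n (m + 1)) z)}"
  obtain N where N: "\<And>n. n \<ge> N \<Longrightarrow> norm z < disk_radius * cos (pi / 2 ^ n)"
    using level_bound[OF nz] by blast
  have "?S \<subseteq> {..<N}"
  proof
    fix n assume "n \<in> ?S"
    then obtain m where "0 < side (dyadic_point n m) (dyadic_point n (m + 1)) z" by blast
    then have "disk_radius * cos (pi / 2 ^ n) < norm z" using side_level[of n m z] by linarith
    then show "n \<in> {..<N}" using N[of n] by (cases "n < N") auto
  qed
  then have fin: "finite ?S" using finite_subset by blast
  \<comment> \<open>The two half-disks have opposite functions, so one of the two is positive at \<open>z\<close>.\<close>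
  have "side (dyadic_point 1 1) (dyadic_point 1 (1 + 1)) z = - side (dyadic_point 1 0) (dyadic_point 1 (0 + 1)) z"
  proof -
    have "cos (pi * (3 / 2)) = 0" "sin (pi * (3 / 2)) = -1"
      using cos_add[of pi "pi/2"] sin_add[of pi "pi/2"] by (simp_all add: field_simps)
    then show ?thesis by (simp add: side_def dyadic_point_def inner_complex_def)
  qed
  moreover have "side (dyadic_point 1 0) (dyadic_point 1 (0 + 1)) z \<noteq> 0" using nonzero[of 1 0] by simp
  ultimately have "0 < side (dyadic_point 1 0) (dyadic_point 1 (0 + 1)) z \<or> 0 < side (dyadic_point 1 1) (dyadic_point 1 (1 + 1)) z" by linarith
  then have "1 \<in> ?S" by (auto simp del: One_nat_def intro: exI[of _ 0] exI[of _ 1])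
  then have M: "Max ?S \<in> ?S" using fin Max_in by blast
  define n where "n = Max ?S"
  obtain m where m: "1 \<le> n" "m < 2 ^ n" "0 < side (dyadic_point n m) (dyadic_point n (m + 1)) z"
    using M unfolding n_def[symmetric] by blast
  have "Suc n \<notin> ?S" using Max_ge[OF fin, of "Suc n"] unfolding n_def[symmetric] by auto
  then have neg: "side (dyadic_point (Suc n) k) (dyadic_point (Suc n) (k + 1)) z < 0" if "k < 2 ^ Suc n" for k
    using nonzero[of "Suc n" k] that by (force simp: not_less)
  have "side (dyadic_point n m) (dyadic_point (Suc n) (2 * m + 1)) z < 0"
    using neg[of "2 * m"] m(2) dyadic_point_Suc[of n m] by simp
  moreover have "side (dyadic_point (Suc n) (2 * m + 1)) (dyadic_point n (m + 1)) z < 0"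
    using neg[of "2 * m + 1"] m(2) dyadic_point_Suc[of n "m + 1"] by simp
  ultimately have "z \<in> dyadic_triangle n m" unfolding dyadic_triangle_iff[OF m(1,2)] using m(3) by blast
  then show ?thesis using m by blast
qed

lemma disk_minus_A_F: "disk - \<Union>A_F = \<Union>{dyadic_triangle n m | n m. 1 \<le> n \<and> m < 2 ^ n}"
proof
  show "disk - \<Union>A_F \<subseteq> \<Union>{dyadic_triangle n m | n m. 1 \<le> n \<and> m < 2 ^ n}" using dyadic_triangles_cover by blast
  have "dyadic_triangle n m \<subseteq> disk" for n m unfolding dyadic_triangle_def by (rule arc_triangle_in_disk)
  moreover have "dyadic_triangle n m \<inter> \<Union>A_F = {}" if "1 \<le> n" "m < 2 ^ n" for n m
    using dyadic_triangle_disjoint_arc[OF that] unfolding A_F_eq by blast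
  ultimately show "\<Union>{dyadic_triangle n m | n m. 1 \<le> n \<and> m < 2 ^ n} \<subseteq> disk - \<Union>A_F" by blast
qed

lemma open_triangle_dyadic_triangle:
  assumes "1 \<le> n" "m < 2 ^ n" shows "open_triangle (dyadic_triangle n m)"
  unfolding dyadic_triangle_def using dyadic_point_bounds[OF assms] by (intro open_triangle_arc_triangle) auto

lemma triangulates_A_F: "triangulates_disk A_F"
  unfolding triangulates_disk_def
proof (intro exI conjI)
  show "disk - \<Union>A_F = \<Union>{dyadic_triangle n m | n m. 1 \<le> n \<and> m < 2 ^ n}" by (rule disk_minus_A_F)
  show "\<forall>T\<in>{dyadic_triangle n m | n m. 1 \<le> n \<and> m < 2 ^ n}. open_triangle T" using open_triangle_dyadic_triangle by blast
  show "pairwise disjnt {dyadic_triangle n m | n m. 1 \<le> n \<and> m < 2 ^ n}"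
    unfolding pairwise_def disjnt_def using dyadic_triangle_disjoint_triangle by blast
qed

lemma open_triangleD:
  assumes "open_triangle T"
  shows "open T" "convex T" "T \<noteq> {}" "polytope (closure T)"
    "\<exists>a b c. closure T = convex hull {a, b, c}"
proof -
  obtain a b c where T: "\<not> collinear {a, b, c}" "T = interior (convex hull {a, b, c})"
    using assms unfolding open_triangle_def by blast
  show "open T" "convex T" using T by (auto intro: convex_interior)
  show ne: "T \<noteq> {}" using T noncollinear_interior by blast
  have "closure T = closure (convex hull {a, b, c})"
    unfolding T(2) by (rule convex_closure_interior) (use ne T in auto)
  moreover have "closed (convex hull {a, b, c})"
    by (intro compact_imp_closed finite_imp_compact_convex_hull) simp
  ultimately have c: "closure T = convex hull {a, b, c}" by simp
  then show "\<exists>a b c. closure T = convex hull {a, b, c}" by (intro exI)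
  show "polytope (closure T)" unfolding c polytope_def by (intro exI[of _ "{a, b, c}"]) simp
qed

lemma connected_in_one:
  assumes "connected C" "C \<noteq> {}" "C \<subseteq> \<Union>\<T>" "pairwise disjnt \<T>" "\<And>T. T \<in> \<T> \<Longrightarrow> open T"
  shows "\<exists>T\<in>\<T>. C \<subseteq> T"
proof -
  obtain z T where zT: "z \<in> C" "T \<in> \<T>" "z \<in> T" using assms by blast
  have "open T" "open (\<Union>(\<T> - {T}))" using assms(5) zT by (auto intro: open_Union)
  moreover have "C \<subseteq> T \<union> \<Union>(\<T> - {T})" using assms(3) by blast
  moreover have "T \<inter> \<Union>(\<T> - {T}) \<inter> C = {}"
    using assms(4) zT(2) unfolding pairwise_def disjnt_def by blast
  ultimately have "T \<inter> C = {} \<or> \<Union>(\<T> - {T}) \<inter> C = {}"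
    using connectedD[OF assms(1), of T "\<Union>(\<T> - {T})"] by simp
  then have "\<Union>(\<T> - {T}) \<inter> C = {}"
    using zT(1,3) by blast
  then have "C \<subseteq> T" using assms(3) by blast
  then show ?thesis using zT by blast
qed

text \<open>Points of the circle are extreme in the closed disk, hence in any subset that contains them, and a
  triangle has at most three extreme points.\<close>

lemma no_open_triangle_with_four_circle_points:
  assumes T: "open_triangle T" "T \<subseteq> disk" and V: "V \<subseteq> closure T" "\<And>v. v \<in> V \<Longrightarrow> norm v = disk_radius" "card V = 4"
  shows False
proof -
  obtain a b c where abc: "closure T = convex hull {a, b, c}" using open_triangleD(5)[OF T(1)] by blast
  have "closure T \<subseteq> cball 0 disk_radius" using closure_mono[OF T(2)] closure_disk by simp
  then have "v extreme_point_of closure T" if "v \<in> V" for v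
    using extreme_point_of_subset[OF extreme_point_cball[of v disk_radius]] V that by blast
  then have "V \<subseteq> {a, b, c}" unfolding abc using extreme_point_of_convex_hull by blast
  then have "card V \<le> card {a, b, c}" by (intro card_mono) auto
  also have "\<dots> \<le> 3" by (simp add: card_insert_if)
  finally show False using V(3) by simp
qed

lemma closure_dyadic_triangle:
  assumes "1 \<le> n" "m < 2 ^ n"
  shows "closure (dyadic_triangle n m) = convex hull {circle_param (dyadic_point n m), circle_param (dyadic_point (Suc n) (2 * m + 1)), circle_param (dyadic_point n (m + 1))}"
  unfolding dyadic_triangle_def using dyadic_point_bounds[OF assms] by (intro closure_arc_triangle) auto

text \<open>Without the arc, the two triangles adjacent to it lie in one component, together with the open arc.
  The closure of that component contains all four vertices of the quadrilateral, which lie on the circle,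
  so that it cannot be a triangle.\<close>

lemma not_triangulates_remove:
  assumes nm: "1 \<le> n" "m < 2 ^ n" and kj: "1 \<le> k" "j < 2 ^ k"
    and ends: "circle_param x \<noteq> circle_param y" "{circle_param x, circle_param y} \<subseteq> closure (dyadic_triangle n m)"
      "{circle_param x, circle_param y} \<subseteq> closure (dyadic_triangle k j)"
    and a: "chord x y \<in> A_F"
    and V: "V \<subseteq> closure (dyadic_triangle n m) \<union> closure (dyadic_triangle k j)" "\<And>v. v \<in> V \<Longrightarrow> norm v = disk_radius" "card V = 4"
  shows "\<not> triangulates_disk (A_F - {chord x y})"
proof
  let ?a = "chord x y" and ?s = "open_segment (circle_param x) (circle_param y)"
  let ?C = "(dyadic_triangle n m \<union> ?s) \<union> (dyadic_triangle k j \<union> ?s)"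
  assume "triangulates_disk (A_F - {?a})"
  then obtain \<T> where \<T>: "pairwise disjnt \<T>" "\<And>T. T \<in> \<T> \<Longrightarrow> open_triangle T"
      "disk - \<Union>(A_F - {?a}) = \<Union>\<T>"
    unfolding triangulates_disk_def by blast
  have s: "?s \<subseteq> chord x y" "?s \<subseteq> disk"
    using chord_in_disk[OF ends(1)] by auto
  have con: "connected (dyadic_triangle p q \<union> ?s)" if "1 \<le> p" "q < 2 ^ p" "{circle_param x, circle_param y} \<subseteq> closure (dyadic_triangle p q)" for p q
  proof (rule connected_intermediate_closure)
    have t: "open_triangle (dyadic_triangle p q)" using open_triangle_dyadic_triangle that by blast
    then show "connected (dyadic_triangle p q)" using open_triangleD(2) convex_connected by blast
    have "closed_segment (circle_param x) (circle_param y) \<subseteq> closure (dyadic_triangle p q)"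
      using that(3) convex_closure[OF open_triangleD(2)[OF t]] by (intro closed_segment_subset) auto
    then show "dyadic_triangle p q \<union> ?s \<subseteq> closure (dyadic_triangle p q)"
      using closure_subset segment_open_subset_closed by blast
  qed blast
  have "?s \<noteq> {}" using ends(1) by simp
  then have "connected ?C"
    by (intro connected_Un[OF con[OF nm ends(2)] con[OF kj ends(3)]]) blast
  moreover have "?C \<noteq> {}" using \<open>?s \<noteq> {}\<close> by blast
  moreover have "?C \<subseteq> \<Union>\<T>"
  proof -
    have "dyadic_triangle n m \<subseteq> disk - \<Union>A_F" "dyadic_triangle k j \<subseteq> disk - \<Union>A_F"
      using disk_minus_A_F nm kj by blast+
    moreover have "?s \<inter> b = {}" if "b \<in> A_F - {?a}" for b
      using noncrossing_A_F a that s unfolding noncrossing_def pairwise_def by blast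
    ultimately show ?thesis unfolding \<T>(3)[symmetric] using s(2) by blast
  qed
  ultimately obtain T where T: "T \<in> \<T>" "?C \<subseteq> T"
    using connected_in_one[OF _ _ _ \<T>(1)] open_triangleD(1) \<T>(2) by metis
  have "closure (dyadic_triangle n m) \<union> closure (dyadic_triangle k j) \<subseteq> closure T"
    using T(2) closure_mono[of "dyadic_triangle n m" T] closure_mono[of "dyadic_triangle k j" T] by blast
  then show False
    using no_open_triangle_with_four_circle_points[OF \<T>(2)[OF T(1)] _ _ V(2,3)] V(1) T(1) \<T>(3) by blast
qed

lemma four_circle_points:
  assumes "a < b" "b < c" "c < d" "d < a + 1"
  shows "card {circle_param a, circle_param b, circle_param c, circle_param d} = 4"
proof -
  have "circle_param a \<noteq> circle_param b" "circle_param a \<noteq> circle_param c" "circle_param a \<noteq> circle_param d"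
    "circle_param b \<noteq> circle_param c" "circle_param b \<noteq> circle_param d" "circle_param c \<noteq> circle_param d"
    using circle_param_neq assms by force+
  then show ?thesis by simp
qed

text \<open>The two triangles at the arc over an interval are its own triangle and that of the interval one level
  up; at the diameter they are the two triangles of level one.\<close>

lemma A_F_minimal:
  assumes "a \<in> A_F" shows "\<not> triangulates_disk (A_F - {a})"
proof -
  obtain n m where nm: "a = dyadic_arc n m" "1 \<le> n" "m < 2 ^ n" using assms unfolding A_F_eq by blast
  show ?thesis
  proof (cases "n = 1")
    case True
    then have "m = 0 \<or> m = 1" using nm by auto
    then have a: "a = chord 0 (1/2)" using nm dyadic_arc_1 True by auto
    have c0: "closure (dyadic_triangle 1 0) = convex hull {circle_param 0, circle_param (1/4), circle_param (1/2)}"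
      and c1: "closure (dyadic_triangle 1 1) = convex hull {circle_param (1/2), circle_param (3/4), circle_param 0}"
      using closure_dyadic_triangle[of 1 0] closure_dyadic_triangle[of 1 1] by (simp_all add: dyadic_point_def circle_param_0_1)
    have h: "S \<subseteq> convex hull S" for S :: "complex set" by (rule hull_subset)
    show ?thesis unfolding a
    proof (rule not_triangulates_remove[of 1 0 1 1 _ _ "{circle_param 0, circle_param (1/4), circle_param (1/2), circle_param (3/4)}"])
      show "circle_param 0 \<noteq> circle_param (1/2)" by (rule circle_param_neq) auto
      show "{circle_param 0, circle_param (1 / 2)} \<subseteq> closure (dyadic_triangle 1 0)"
        "{circle_param 0, circle_param (1 / 2)} \<subseteq> closure (dyadic_triangle 1 1)"
        "{circle_param 0, circle_param (1/4), circle_param (1/2), circle_param (3/4)} \<subseteq> closure (dyadic_triangle 1 0) \<union> closure (dyadic_triangle 1 1)"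
        unfolding c0 c1 using h[of "{circle_param 0, circle_param (1/4), circle_param (1/2)}"]
          h[of "{circle_param (1/2), circle_param (3/4), circle_param 0}"] by blast+
      show "card {circle_param 0, circle_param (1/4), circle_param (1/2), circle_param (3/4)} = 4"
        by (rule four_circle_points) auto
      show "chord 0 (1/2) \<in> A_F" using assms a by simp
    qed (auto simp: norm_circle_param)
  next
    case False
    define p where "p = n - 1"
    have p: "n = Suc p" "1 \<le> p" using nm False by (auto simp: p_def)
    define q where "q = m div 2"
    have q: "q < 2 ^ p" using nm(3) by (simp add: p q_def less_mult_imp_div_less mult.commute)
    let ?x = "dyadic_point n m" and ?y = "dyadic_point n (m + 1)" and ?t = "dyadic_point (Suc n) (2 * m + 1)"
    let ?l = "dyadic_point n (2 * q)" and ?c = "dyadic_point n (2 * q + 1)" and ?r = "dyadic_point n (2 * q + 2)"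
    have cP: "closure (dyadic_triangle p q) = convex hull {circle_param ?l, circle_param ?c, circle_param ?r}"
      using closure_dyadic_triangle[OF p(2) q] dyadic_point_Suc[of p q] dyadic_point_Suc[of p "q + 1"] by (simp add: p(1))
    have cI: "closure (dyadic_triangle n m) = convex hull {circle_param ?x, circle_param ?t, circle_param ?y}"
      using closure_dyadic_triangle[OF nm(2,3)] .
    have h: "S \<subseteq> convex hull S" for S :: "complex set" by (rule hull_subset)
    have m: "m = 2 * q \<or> m = 2 * q + 1" unfolding q_def by linarith
    \<comment> \<open>the three vertices of the triangle one level up, and the midpoint of the interval itself\<close>
    let ?V = "{circle_param ?l, circle_param ?c, circle_param ?r, circle_param ?t}"
    have len: "?r < ?l + 1"
      using dyadic_point_bounds(5)[OF p(2) q] dyadic_point_Suc[of p q] dyadic_point_Suc[of p "q + 1"] by (simp add: p(1))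
    have lcr: "?l < ?c" "?c < ?r" by (simp_all add: dyadic_point_less_iff)
    note b = dyadic_point_bounds[OF nm(2,3)]
    have "card ?V = 4"
      using m
    proof
      assume "m = 2 * q"
      then have "card {circle_param ?l, circle_param ?t, circle_param ?c, circle_param ?r} = 4"
        using b len lcr by (intro four_circle_points) auto
      then show ?thesis by (simp add: insert_commute)
    next
      assume mq: "m = 2 * q + 1"
      have "?y = ?r" using mq by simp
      then have "card {circle_param ?l, circle_param ?c, circle_param ?t, circle_param ?r} = 4"
        using b(2,3) len lcr mq by (intro four_circle_points) auto
      then show ?thesis by (simp add: insert_commute)
    qed
    moreover have "{circle_param ?x, circle_param ?y} \<subseteq> {circle_param ?l, circle_param ?c, circle_param ?r}"
      using m by auto
    then have "{circle_param ?x, circle_param ?y} \<subseteq> closure (dyadic_triangle p q)" unfolding cP using h by blast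
    moreover have "{circle_param ?x, circle_param ?y} \<subseteq> closure (dyadic_triangle n m)"
      unfolding cI using h[of "{circle_param ?x, circle_param ?t, circle_param ?y}"] by blast
    moreover have "?V \<subseteq> closure (dyadic_triangle n m) \<union> closure (dyadic_triangle p q)"
      unfolding cI cP using h[of "{circle_param ?x, circle_param ?t, circle_param ?y}"]
        h[of "{circle_param ?l, circle_param ?c, circle_param ?r}"] by blast
    ultimately have "\<not> triangulates_disk (A_F - {chord ?x ?y})"
      using assms dyadic_arc_ends_neq[OF nm(2,3)] nm(1)
      by (intro not_triangulates_remove[OF nm(2,3) p(2) q, of _ _ ?V]) (auto simp: norm_circle_param dyadic_arc_def)
    then show ?thesis using nm(1) by (simp add: dyadic_arc_def)
  qed
qed

theorem F_triangulation_A_F: "F_triangulation A_F"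
  unfolding F_triangulation_def
  using A_F_dyadic_arcs noncrossing_A_F triangulates_A_F A_F_minimal by simp

section \<open>F-tessellations cut the disk into polygons\<close>

text \<open>An \<open>F\<close>-tessellation still differs from \<open>A_F\<close> by finitely many arcs, since only finitely many are
  removed.\<close>

lemma F_tessellation_dyadic:
  assumes "F_tessellation A"
  shows "A \<subseteq> dyadic_arcs" "noncrossing disk A" "finite (A - A_F)" "finite (A_F - A)"
proof -
  obtain T S where T: "F_triangulation T" "finite S" "S \<subseteq> T" "A = T - S"
    using assms unfolding F_tessellation_def by blast
  then show "A \<subseteq> dyadic_arcs" unfolding F_triangulation_def by blast
  have "noncrossing disk T" using T(1) unfolding F_triangulation_def by blast
  then show "noncrossing disk A" unfolding noncrossing_def T(4) by (rule pairwise_subset) blast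
  have "finite (T - A_F)" "finite (A_F - T)" using T(1) unfolding F_triangulation_def by auto
  moreover have "A - A_F \<subseteq> T - A_F" "A_F - A \<subseteq> (A_F - T) \<union> S" using T by auto
  ultimately show "finite (A - A_F)" "finite (A_F - A)"
    using T(2) finite_subset by blast+
qed

lemma F_tessellation_Int:
  assumes "F_tessellation A" "F_tessellation B"
  shows "F_tessellation (A \<inter> B)"
proof -
  obtain T S where T: "F_triangulation T" "finite S" "S \<subseteq> T" "A = T - S"
    using assms(1) unfolding F_tessellation_def by blast
  have "finite (T - A_F)" using T(1) unfolding F_triangulation_def by auto
  moreover have "T - B \<subseteq> (T - A_F) \<union> (A_F - B)" by blast
  ultimately have "finite (T - B)" using F_tessellation_dyadic(4)[OF assms(2)] finite_subset by blast
  moreover have "A \<inter> B = T - (S \<union> (T - B))" using T(4) by blast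
  ultimately show ?thesis
    unfolding F_tessellation_def using T(1-3) by (intro exI[of _ T] exI[of _ "S \<union> (T - B)"]) simp
qed

lemma countable_dyadic_arcs: "countable dyadic_arcs"
proof -
  have "dyadics \<subseteq> (\<lambda>(m::int, n::nat). real_of_int m / 2 ^ n) ` UNIV" unfolding dyadics_def by auto
  then have "countable dyadics" by (rule countable_subset) (intro countable_image countableI_type)
  moreover have "dyadic_arcs \<subseteq> (\<lambda>(x, y). chord x y) ` (dyadics \<times> dyadics)" unfolding dyadic_arcs_def by auto
  moreover have "countable ((\<lambda>(x, y). chord x y) ` (dyadics \<times> dyadics))"
    using \<open>countable dyadics\<close> by (intro countable_image countable_SIGMA)
  ultimately show ?thesis using countable_subset by blast
qed

text \<open>A finite modification of \<open>A_F\<close> is determined by the finite sets of arcs that are removed and added.\<close>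

lemma countable_F_tessellations: "countable {A. F_tessellation A}"
proof -
  let ?P = "{S. finite S \<and> S \<subseteq> dyadic_arcs}"
  have c: "countable ?P"
    using countable_Collect_finite_subset[OF countable_dyadic_arcs] .
  have "{A. F_tessellation A} \<subseteq> (\<lambda>(S, T). (A_F - S) \<union> T) ` (?P \<times> ?P)"
  proof
    fix A assume "A \<in> {A. F_tessellation A}"
    then have A: "F_tessellation A" by simp
    have "A = (A_F - (A_F - A)) \<union> (A - A_F)" by blast
    moreover have "(A_F - A, A - A_F) \<in> ?P \<times> ?P"
      using F_tessellation_dyadic[OF A] A_F_dyadic_arcs by auto
    ultimately show "A \<in> (\<lambda>(S, T). (A_F - S) \<union> T) ` (?P \<times> ?P)" by (metis (no_types, lifting) case_prod_conv image_eqI)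
  qed
  then show ?thesis
    by (rule countable_subset) (intro countable_image countable_SIGMA c)
qed

lemma dyadic_arc_far_from_centre:
  assumes nm: "1 \<le> n" "m < 2 ^ n" and z: "z \<in> dyadic_arc n m"
  shows "disk_radius * cos (pi / 2 ^ n) \<le> norm z"
  using side_level[of n m z] chord_side_zero[of z] z unfolding dyadic_arc_def by simp

text \<open>A ball around \<open>z\<close> that stays away from the circle meets no arc of \<open>A_F\<close> of high level, and only
  finitely many arcs have low level or lie outside \<open>A_F\<close>.\<close>

lemma slit_region_disk:
  assumes A: "A \<subseteq> dyadic_arcs" "finite (A - A_F)"
  shows "slit_region disk A" "\<forall>a\<in>A. spanning_chord disk a"
proof -
  show sc: "\<forall>a\<in>A. spanning_chord disk a"
    using A(1) chord_spanning unfolding dyadic_arcs_def by blast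
  show "slit_region disk A"
    unfolding slit_region_def
  proof (intro conjI ballI)
    show "open disk" "convex disk" by (simp_all add: disk_def)
    show "slit disk a" if "a \<in> A" for a using sc that slit_spanning_chord by blast
    fix z assume "z \<in> disk"
    then have nz: "norm z < disk_radius" by (simp add: disk_def)
    define e where "e = (disk_radius - norm z) / 2"
    have e: "0 < e" "norm z + e < disk_radius" using nz unfolding e_def by (simp_all add: field_simps)
    obtain N where N: "\<And>n. n \<ge> N \<Longrightarrow> norm z + e < disk_radius * cos (pi / 2 ^ n)"
      using level_bound[OF e(2)] by blast
    have "{a \<in> A. a \<inter> ball z e \<noteq> {}} \<subseteq> (A - A_F) \<union> (\<lambda>(n, m). dyadic_arc n m) ` (SIGMA n:{..<N}. {..<2 ^ n})"
    proof
      fix a assume a: "a \<in> {a \<in> A. a \<inter> ball z e \<noteq> {}}"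
      show "a \<in> (A - A_F) \<union> (\<lambda>(n, m). dyadic_arc n m) ` (SIGMA n:{..<N}. {..<2 ^ n})"
      proof (cases "a \<in> A_F")
        case True
        then obtain n m where nm: "a = dyadic_arc n m" "1 \<le> n" "m < 2 ^ n" unfolding A_F_eq by blast
        obtain y where y: "y \<in> a" "y \<in> ball z e" using a by blast
        have "norm y \<le> norm z + norm (y - z)" by (rule norm_triangle_sub)
        also have "\<dots> < norm z + e" using y(2) by (simp add: dist_norm norm_minus_commute)
        finally have "norm y < norm z + e" .
        then have "n < N" using dyadic_arc_far_from_centre[OF nm(2,3), of y] y(1) nm(1) N[of n] by (cases "n < N") auto
        then show ?thesis using nm by auto
      qed (use a in auto)
    qed
    then have "finite {a \<in> A. a \<inter> ball z e \<noteq> {}}" using A(2) finite_subset by blast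
    then show "\<exists>e>0. finite {a \<in> A. a \<inter> ball z e \<noteq> {}}" using e(1) by blast
  qed
qed

lemma polytope_pieces_triangulation:
  assumes "triangulates_disk T" "Q \<in> pieces disk T"
  shows "polytope Q"
proof -
  obtain \<T> where \<T>: "pairwise disjnt \<T>" "\<And>T. T \<in> \<T> \<Longrightarrow> open_triangle T" "disk - \<Union>T = \<Union>\<T>"
    using assms(1) unfolding triangulates_disk_def by blast
  obtain c where c: "c \<in> components (disk - \<Union>T)" "Q = closure c" using assms(2) unfolding pieces_def by blast
  have "\<exists>t\<in>\<T>. c \<subseteq> t"
    by (rule connected_in_one[OF in_components_connected[OF c(1)] in_components_nonempty[OF c(1)] _ \<T>(1)])
       (use in_components_subset[OF c(1)] \<T> open_triangleD(1) in auto)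
  then obtain t where t: "t \<in> \<T>" "c \<subseteq> t" by blast
  have "t \<subseteq> c"
  proof (rule components_maximal[OF c(1)])
    show "connected t" using open_triangleD(2)[OF \<T>(2)[OF t(1)]] by (rule convex_connected)
  qed (use t \<T>(3) in_components_nonempty[OF c(1)] in auto)
  then show ?thesis using c(2) t open_triangleD(4)[OF \<T>(2)[OF t(1)]] by (metis subset_antisym)
qed

text \<open>The union is the convex hull of all vertices of the finitely many polytopes.\<close>

lemma polytope_finite_Union_convex:
  assumes "finite \<K>" "\<And>K. K \<in> \<K> \<Longrightarrow> polytope K" "convex (\<Union>\<K>)"
  shows "polytope (\<Union>\<K>)"
proof -
  obtain V where V: "\<And>K. K \<in> \<K> \<Longrightarrow> finite (V K) \<and> K = convex hull (V K)"
    using assms(2) unfolding polytope_def by metis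
  have "\<Union>\<K> = convex hull (\<Union>(V ` \<K>))"
  proof
    show "\<Union>\<K> \<subseteq> convex hull (\<Union>(V ` \<K>))"
    proof
      fix x assume "x \<in> \<Union>\<K>"
      then obtain K where K: "K \<in> \<K>" "x \<in> K" by blast
      then have "x \<in> convex hull (V K)" using V by blast
      moreover have "convex hull (V K) \<subseteq> convex hull (\<Union>(V ` \<K>))" by (rule hull_mono) (use K in blast)
      ultimately show "x \<in> convex hull (\<Union>(V ` \<K>))" by blast
    qed
    have "V K \<subseteq> K" if "K \<in> \<K>" for K using V[OF that] hull_subset by metis
    then show "convex hull (\<Union>(V ` \<K>)) \<subseteq> \<Union>\<K>" using assms(3) by (intro hull_minimal) auto
  qed
  moreover have "finite (\<Union>(V ` \<K>))" using assms(1) V by blast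
  ultimately show ?thesis unfolding polytope_def by blast
qed

text \<open>A line has no interior, so removing it from an open set leaves a dense subset.\<close>

lemma open_subset_closure_minus_hyperplane:
  fixes c :: "complex set"
  assumes "open c" "n \<noteq> 0"
  shows "closure (c - {z. n \<bullet> z = b}) = closure c"
proof
  let ?H = "{z. n \<bullet> z = b}"
  show "closure (c - ?H) \<subseteq> closure c" by (rule closure_mono) blast
  have "open (c - closure (c - ?H))" using assms(1) by (simp add: open_Diff)
  moreover have "c - closure (c - ?H) \<subseteq> ?H" using closure_subset[of "c - ?H"] by blast
  ultimately have "c - closure (c - ?H) \<subseteq> interior ?H" by (simp add: interior_maximal)
  then have "c \<subseteq> closure (c - ?H)" using assms(2) by simp
  then show "closure c \<subseteq> closure (c - ?H)" by (simp add: closure_minimal)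
qed

text \<open>The slit \<open>a\<close> cuts the piece into at most two components, one on each side of its line. Their closures
  are polytopes and cover the piece, which is convex.\<close>

lemma polytope_pieces_remove:
  assumes s: "slit_region U (insert a \<alpha>)" and P: "\<And>Q. Q \<in> pieces U (insert a \<alpha>) \<Longrightarrow> polytope Q"
    and Q: "Q \<in> pieces U \<alpha>"
  shows "polytope Q"
proof -
  have s': "slit_region U \<alpha>" using slit_region_subset[OF s] by blast
  note Q' = pieceD[OF s' Q]
  let ?c = "interior Q"
  obtain n b where nb: "n \<noteq> 0" "a \<inter> U = {z \<in> U. n \<bullet> z = b}"
    using s unfolding slit_region_def slit_def by blast
  have cm: "?c - \<Union>(insert a \<alpha>) = ?c - {z. n \<bullet> z = b}" using Q'(4,5) nb(2) by blast
  let ?K = "components (?c - \<Union>(insert a \<alpha>))"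
  have K: "?K \<subseteq> components (U - \<Union>(insert a \<alpha>))"
    using components_within_component[of \<alpha> "insert a \<alpha>", OF _ Q'(1)] by blast
  \<comment> \<open>the two sides of the line of \<open>a\<close> in the piece\<close>
  define P1 where "P1 = ?c \<inter> {z. b < n \<bullet> z}"
  define P2 where "P2 = ?c \<inter> {z. n \<bullet> z < b}"
  have "convex P1" "convex P2"
    unfolding P1_def P2_def by (intro convex_Int Q'(6) convex_halfspace_gt convex_halfspace_lt)+
  then have con: "connected P1" "connected P2" using convex_connected by blast+
  have P12: "?c - \<Union>(insert a \<alpha>) = P1 \<union> P2" unfolding cm P1_def P2_def by auto
  have unique: "k = k'" if "k \<in> ?K" "k' \<in> ?K" "k \<inter> W \<noteq> {}" "k' \<inter> W \<noteq> {}" "W \<in> {P1, P2}" for k k' W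
  proof -
    have W: "connected W" "W \<subseteq> ?c - \<Union>(insert a \<alpha>)" using con P12 that(5) by auto
    have "W \<subseteq> k" using components_maximal[OF that(1) W that(3)] .
    moreover have "W \<subseteq> k'" using components_maximal[OF that(2) W that(4)] .
    ultimately have "k \<inter> k' \<noteq> {}" using that(3) by blast
    then show ?thesis using that(1,2) pairwise_disjoint_components unfolding pairwise_def by blast
  qed
  have fin1: "finite {k \<in> ?K. k \<inter> W \<noteq> {}}" if W: "W \<in> {P1, P2}" for W
  proof (cases "{k \<in> ?K. k \<inter> W \<noteq> {}} = {}")
    case False
    then obtain k where k: "k \<in> ?K" "k \<inter> W \<noteq> {}" by blast
    have "{k \<in> ?K. k \<inter> W \<noteq> {}} \<subseteq> {k}" using unique[OF _ k(1) _ k(2) W] by blast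
    then show ?thesis using finite_subset by blast
  next
    case True
    then show ?thesis by (simp only: finite.emptyI)
  qed
  have "?K \<subseteq> {k \<in> ?K. k \<inter> P1 \<noteq> {}} \<union> {k \<in> ?K. k \<inter> P2 \<noteq> {}}"
  proof
    fix k assume k: "k \<in> ?K"
    have "k \<noteq> {}" "k \<subseteq> P1 \<union> P2" using in_components_nonempty[OF k] in_components_subset[OF k] P12 by auto
    then show "k \<in> {k \<in> ?K. k \<inter> P1 \<noteq> {}} \<union> {k \<in> ?K. k \<inter> P2 \<noteq> {}}" using k by blast
  qed
  then have fin: "finite ?K" using fin1[of P1] fin1[of P2] finite_subset by blast
  have "Q = closure (?c - \<Union>(insert a \<alpha>))"
    unfolding cm using open_subset_closure_minus_hyperplane[OF open_interior nb(1)] Q'(2) by simp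
  also have "\<dots> = closure (\<Union>?K)" by simp
  also have "\<dots> = \<Union>(closure ` ?K)" using fin by (induction rule: finite_induct) auto
  finally have Qeq: "Q = \<Union>(closure ` ?K)" .
  have "convex Q" using closed_piece(2)[OF s' Q] .
  moreover have "polytope K" if "K \<in> closure ` ?K" for K
    using that K P unfolding pieces_def by blast
  ultimately show ?thesis
    using polytope_finite_Union_convex[of "closure ` ?K"] fin Qeq by simp
qed

text \<open>The pieces of an \<open>F\<close>-triangulation are closed triangles, and the finitely many arcs are removed one
  after the other.\<close>

lemma polytope_pieces_F_tessellation:
  assumes "F_tessellation A" "Q \<in> pieces disk A"
  shows "polytope Q"
proof -
  obtain T S where T: "F_triangulation T" "finite S" "S \<subseteq> T" "A = T - S"
    using assms(1) unfolding F_tessellation_def by blast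
  have s: "slit_region disk T"
    using T(1) unfolding F_triangulation_def by (intro slit_region_disk) auto
  have "\<forall>Q \<in> pieces disk (T - S). polytope Q"
    using T(2,3)
  proof (induction S rule: finite_induct)
    case empty
    then show ?case using polytope_pieces_triangulation T(1) unfolding F_triangulation_def by auto
  next
    case (insert a S)
    have eq: "T - S = insert a (T - insert a S)" using insert by blast
    have "slit_region disk (insert a (T - insert a S))"
      using slit_region_subset[OF s, of "insert a (T - insert a S)"] insert by blast
    moreover have "\<forall>Q \<in> pieces disk (insert a (T - insert a S)). polytope Q"
      using insert eq by simp
    ultimately show ?case using polytope_pieces_remove by blast
  qed
  then show ?thesis using assms(2) T(4) by simp
qed

lemma disk_tessellation_F:
  assumes "F_tessellation A" shows "disk_tessellation A"
  unfolding disk_tessellation_def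
proof (intro conjI ballI)
  note A = F_tessellation_dyadic[OF assms]
  show s: "slit_region disk A" "\<And>a. a \<in> A \<Longrightarrow> spanning_chord disk a" using slit_region_disk[OF A(1,3)] by auto
  show "noncrossing disk A" by fact
  show "polygon Q" if "Q \<in> pieces disk A" for Q
    using polytope_pieces_F_tessellation[OF assms that] pieceD(3)[OF s(1) that] by (simp add: polygon_def)
qed

lemma F_tessellation_A_F: "F_tessellation A_F"
  unfolding F_tessellation_def using F_triangulation_A_F by (intro exI[of _ A_F] exI[of _ "{}"]) simp

text \<open>Along an enumeration of all \<open>F\<close>-tessellations, intersect the first \<open>n + 1\<close> of them.\<close>

lemma F_tessellation_sequence:
  obtains s :: "nat \<Rightarrow> complex set set" where
    "\<And>n. F_tessellation (s n)" "\<And>n. s (Suc n) \<subseteq> s n" "\<And>A. F_tessellation A \<Longrightarrow> \<exists>n. s n \<subseteq> A"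
proof -
  let ?I = "{A. F_tessellation A}"
  have "?I \<noteq> {}" using F_tessellation_A_F by blast
  then obtain e :: "nat \<Rightarrow> complex set set" where e: "range e = ?I"
    using countable_F_tessellations by (metis uncountable_def)
  define s where "s n = (\<Inter>i\<le>n. e i)" for n
  have S: "s (Suc n) = s n \<inter> e (Suc n)" for n
    by (auto simp: s_def atMost_Suc)
  have F: "F_tessellation (s n)" for n
  proof (induction n)
    case 0 then show ?case using e by (auto simp: s_def)
  next
    case (Suc n) then show ?case unfolding S using e by (intro F_tessellation_Int) auto
  qed
  moreover have "s (Suc n) \<subseteq> s n" for n unfolding S by blast
  moreover have "\<exists>n. s n \<subseteq> A" if "F_tessellation A" for A
  proof -
    obtain n where "A = e n" using e \<open>F_tessellation A\<close> by blast
    then show ?thesis by (intro exI[of _ n]) (auto simp: s_def)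
  qed
  ultimately show thesis using that by blast
qed

section \<open>The infinite associahedron is contractible\<close>

theorem corollary1:
  fixes X :: "complex set \<Rightarrow> 'a topology"
    and J :: "complex set \<Rightarrow> complex set set \<Rightarrow> (complex set \<Rightarrow> 'a) \<Rightarrow> 'a"
  assumes "stasheff_associahedra X J"
  shows "topspace (infinite_associahedron X J) \<noteq> {} \<and>
         contractible_space (infinite_associahedron X J)"
proof -
  interpret stasheff X J by unfold_locales fact
  let ?I = "{A. F_tessellation A}"
  interpret G: directed_gluing "cell X" ?I "\<lambda>A B. B \<subseteq> A" "cell_incl X J"
  proof
    fix A B D assume A: "A \<in> ?I"
    note dA = disk_tessellation_F[OF A[simplified]]
    show "cell_incl X J A A x = x" if "x \<in> topspace (cell X A)" for x
      by (rule cell_incl_refl[OF dA that])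
    assume B: "B \<in> ?I" "B \<subseteq> A"
    note dB = disk_tessellation_F[OF B(1)[simplified]]
    show "continuous_map (cell X A) (cell X B) (cell_incl X J A B)" by (rule cell_incl_cont[OF dA dB B(2)])
    show "inj_on (cell_incl X J A B) (topspace (cell X A))" by (rule cell_incl_inj[OF dA dB B(2)])
    show "cell_incl X J B D (cell_incl X J A B x) = cell_incl X J A D x"
      if "D \<in> ?I" "D \<subseteq> B" "x \<in> topspace (cell X A)" for x
      by (rule cell_incl_comp[OF dA dB _ B(2) that(2,3)]) (use disk_tessellation_F that in simp)
  qed auto
  \<comment> \<open>Proper inclusion of \<open>F\<close>-tessellations is \<open>le\<close> together with \<open>i \<noteq> j\<close>.\<close>
  have eq: "infinite_associahedron X J = glue (cell X) ?I G.inclusions"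
  proof -
    have "G.inclusions = {((A, x), (B, cell_incl X J A B x)) | A B x.
          F_tessellation A \<and> F_tessellation B \<and> B \<subset> A \<and> x \<in> topspace (cell X A)}"
      unfolding G.inclusions_def by blast
    then show ?thesis unfolding infinite_associahedron_def by simp
  qed
  obtain s :: "nat \<Rightarrow> complex set set" where s: "\<And>n. F_tessellation (s n)" "\<And>n. s (Suc n) \<subseteq> s n"
    "\<And>A. F_tessellation A \<Longrightarrow> \<exists>n. s n \<subseteq> A"
    using F_tessellation_sequence by blast
  have cells: "compact_space (cell X A)" "Hausdorff_space (cell X A)" "topspace (cell X A) \<noteq> {}"
    "extends_into (prod_topology (top_of_set {0..1::real}) (cell X A)) (cell X A)" if "A \<in> ?I" for A
    using cell_extensor[OF disk_tessellation_F] that by auto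
  have "contractible_space (glue (cell X) ?I G.inclusions)"
    by (rule G.contractible_glue[of s]) (use s cells in auto)
  moreover have "topspace (glue (cell X) ?I G.inclusions) \<noteq> {}"
  proof -
    have "topspace (cell X A_F) \<noteq> {}" using cells(3) F_tessellation_A_F by blast
    then obtain x where "x \<in> topspace (cell X A_F)" by blast
    then have "(A_F, x) \<in> topspace (sum_topology (cell X) ?I)" using F_tessellation_A_F by simp
    then have "topspace (sum_topology (cell X) ?I) \<noteq> {}" by blast
    moreover have "topspace (glue (cell X) ?I G.inclusions) = G.glue_class ` topspace (sum_topology (cell X) ?I)"
      by (rule sym) (use G.quotient_map_glue_class in \<open>simp only: quotient_map_def\<close>)
    ultimately show ?thesis by (simp only: image_is_empty not_False_eq_True)
  qed
  ultimately show ?thesis unfolding eq by blast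
qed

end
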